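(* Let $n\ge 1$. For $f\in\dot H^{1/2}(\mathbf R^n)$ let $u(t,x)$ be the solution to $i\partial_t u+\Delta u=0$, $u(0,x)=f(x)$, $(t,x)\in\mathbf R\times\mathbf R^n$. Then, for every $f\in\dot H^{1/2}(\mathbf R^n)$, the limit below exists and $$\lim_{R\to\infty}\frac1R\int_{-\infty}^{\infty}\int_{B_R}|\partial_r u|^2\,dx\,dt=2\pi\,\|f\|_{\dot H^{1/2}(\mathbf R^n)}^2,$$ and in particular $$\sup_{R\in(0,\infty)}\frac1R\int_{-\infty}^{\infty}\int_{B_R}|\nabla u|^2\,dx\,dt\ \ge\ 2\pi\,\|f\|_{\dot H^{1/2}(\mathbf R^n)}^2 .$$ If moreover $u$ satisfies $$\liminf_{R\to\infty}\frac1R\int_{-\infty}^{\infty}\int_{B_R}|\nabla u|^2\,dx\,dt=0,$$ then $u(t,x)=0$ identically.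
   Context: The Fourier transform is normalized as $\hat f(\xi)=\int_{\mathbf R^n}e^{-2\pi i x\cdot\xi}f(x)\,dx$. $\dot H^{1/2}(\mathbf R^n)$ is the homogeneous Sobolev space with norm $\|f\|_{\dot H^{1/2}(\mathbf R^n)}^2=\int_{\mathbf R^n}|\hat f(\xi)|^2|\xi|\,d\xi$. The solution $u$ with initial datum $f$ is the free Schrödinger evolution, i.e. (in this normalization) $\hat u(t,\xi)=e^{-4\pi^2 i t|\xi|^2}\hat f(\xi)$. $B_R$ is the ball of $\mathbf R^n$ centered at the origin with radius $R$; $\nabla$ is the gradient in the space variables and $\partial_r$ is the radial derivative, $\partial_r u=\frac{x}{|x|}\cdot\nabla u$. *)

theory Defs
  imports "HOL-Analysis.Analysis"
begin

definition partial :: "'a::euclidean_space \<Rightarrow> ('a \<Rightarrow> complex) \<Rightarrow> 'a \<Rightarrow> complex" where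
  "partial b \<phi> = (\<lambda>x. frechet_derivative \<phi> (at x) b)"

(* iter_partial [b1, ..., bk] is the composition of the partial derivatives along b1, ..., bk. *)
definition iter_partial :: "'a::euclidean_space list \<Rightarrow> ('a \<Rightarrow> complex) \<Rightarrow> 'a \<Rightarrow> complex" where
  "iter_partial bs \<phi> = foldr partial bs \<phi>"

definition smooth :: "('a::euclidean_space \<Rightarrow> complex) \<Rightarrow> bool" where
  "smooth \<phi> \<longleftrightarrow> (\<forall>bs. set bs \<subseteq> Basis \<longrightarrow> (\<forall>x. iter_partial bs \<phi> differentiable (at x)))"

definition test_function :: "('a::euclidean_space \<Rightarrow> complex) \<Rightarrow> bool" where
  "test_function \<phi> \<longleftrightarrow> smooth \<phi> \<and> compact (closure {x. \<phi> x \<noteq> 0})"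

definition schwartz :: "('a::euclidean_space \<Rightarrow> complex) \<Rightarrow> bool" where
  "schwartz \<phi> \<longleftrightarrow> smooth \<phi> \<and>
     (\<forall>k bs. set bs \<subseteq> Basis \<longrightarrow> bounded (range (\<lambda>x. norm x ^ k *\<^sub>R iter_partial bs \<phi> x)))"

definition schwartz_seminorm :: "nat \<Rightarrow> ('a::euclidean_space \<Rightarrow> complex) \<Rightarrow> real" where
  "schwartz_seminorm N \<phi> =
     (SUP (bs, x) \<in> {bs. set bs \<subseteq> Basis \<and> length bs \<le> N} \<times> UNIV.
        (1 + norm x) ^ N * cmod (iter_partial bs \<phi> x))"

(* Distributions are functionals on the full function space of which only the values on
   Schwartz functions (or on test functions) are meaningful. *)
type_synonym 'a distribution = "('a \<Rightarrow> complex) \<Rightarrow> complex"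

definition tempered :: "'a::euclidean_space distribution \<Rightarrow> bool" where
  "tempered T \<longleftrightarrow>
     (\<forall>\<phi> \<psi>. schwartz \<phi> \<longrightarrow> schwartz \<psi> \<longrightarrow> T (\<lambda>x. \<phi> x + \<psi> x) = T \<phi> + T \<psi>) \<and>
     (\<forall>c \<phi>. schwartz \<phi> \<longrightarrow> T (\<lambda>x. c * \<phi> x) = c * T \<phi>) \<and>
     (\<exists>C N. \<forall>\<phi>. schwartz \<phi> \<longrightarrow> cmod (T \<phi>) \<le> C * schwartz_seminorm N \<phi>)"

definition distribution_of :: "('a::euclidean_space \<Rightarrow> complex) \<Rightarrow> 'a distribution" where
  "distribution_of g = (\<lambda>\<phi>. LINT x|lborel. g x * \<phi> x)"

definition locally_integrable :: "('a::euclidean_space \<Rightarrow> complex) \<Rightarrow> bool" where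
  "locally_integrable g \<longleftrightarrow> (\<forall>K. compact K \<longrightarrow> set_integrable lborel K g)"

definition represented_by :: "'a::euclidean_space distribution \<Rightarrow> ('a \<Rightarrow> complex) \<Rightarrow> bool" where
  "represented_by T g \<longleftrightarrow>
     locally_integrable g \<and> (\<forall>\<phi>. test_function \<phi> \<longrightarrow> T \<phi> = distribution_of g \<phi>)"

(* The locally integrable function representing a regular distribution is unique only almost
   everywhere; function_of picks one representative. *)
definition function_of :: "'a::euclidean_space distribution \<Rightarrow> 'a \<Rightarrow> complex" where
  "function_of T = (SOME g. represented_by T g)"

definition fourier :: "('a::euclidean_space \<Rightarrow> complex) \<Rightarrow> 'a \<Rightarrow> complex" where
  "fourier \<phi> = (\<lambda>\<xi>. LINT x|lborel. cis (- 2 * pi * (x \<bullet> \<xi>)) * \<phi> x)"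

definition inv_fourier :: "('a::euclidean_space \<Rightarrow> complex) \<Rightarrow> 'a \<Rightarrow> complex" where
  "inv_fourier \<phi> = (\<lambda>x. LINT \<xi>|lborel. cis (2 * pi * (x \<bullet> \<xi>)) * \<phi> \<xi>)"

definition fourier_dist :: "'a::euclidean_space distribution \<Rightarrow> 'a distribution" where
  "fourier_dist T = (\<lambda>\<phi>. T (fourier \<phi>))"

definition inv_fourier_dist :: "'a::euclidean_space distribution \<Rightarrow> 'a distribution" where
  "inv_fourier_dist T = (\<lambda>\<phi>. T (inv_fourier \<phi>))"

definition partial_dist :: "'a::euclidean_space \<Rightarrow> 'a distribution \<Rightarrow> 'a distribution" where
  "partial_dist b T = (\<lambda>\<phi>. - T (partial b \<phi>))"

(* The homogeneous Sobolev space of order 1/2, realised as a space of tempered distributions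
   (not modulo polynomials): the Fourier transform is a locally integrable function which is
   square integrable with weight norm \<xi>. *)
definition hdot_half :: "'a::euclidean_space distribution set" where
  "hdot_half = {f. tempered f \<and> (\<exists>g. represented_by (fourier_dist f) g) \<and>
     integrable lborel (\<lambda>\<xi>. (cmod (function_of (fourier_dist f) \<xi>))\<^sup>2 * norm \<xi>)}"

definition hdot_half_norm :: "'a::euclidean_space distribution \<Rightarrow> real" where
  "hdot_half_norm f =
     sqrt (LINT \<xi>|lborel. (cmod (function_of (fourier_dist f) \<xi>))\<^sup>2 * norm \<xi>)"

(* The tempered distribution at time t whose Fourier transform is the function
   exp (-4 pi^2 i t |\<xi>|^2) times the Fourier transform of f. *)
definition schroedinger_evolution ::
    "'a::euclidean_space distribution \<Rightarrow> real \<Rightarrow> 'a distribution" where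
  "schroedinger_evolution f t = inv_fourier_dist (distribution_of
     (\<lambda>\<xi>. cis (- 4 * pi\<^sup>2 * t * (norm \<xi>)\<^sup>2) * function_of (fourier_dist f) \<xi>))"

(* The jointly measurable function v is the distributional gradient in x of u: for almost every
   time t, each partial derivative of u t is the locally integrable function given by the
   corresponding component of v t. For initial data in hdot_half the gradient need not be a
   function at every single time, so only almost every t can be asked for. *)
definition space_gradient ::
    "(real \<Rightarrow> (real^'n) distribution) \<Rightarrow> (real \<Rightarrow> real^'n \<Rightarrow> complex^'n) \<Rightarrow> bool" where
  "space_gradient u v \<longleftrightarrow>
     (\<lambda>(t, x). v t x) \<in> borel_measurable borel \<and>
     (AE t in lborel. \<forall>j. represented_by (partial_dist (axis j 1) (u t)) (\<lambda>x. v t x $ j))"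

definition radial_component :: "real^'n \<Rightarrow> complex^'n \<Rightarrow> complex" where
  "radial_component x w = (\<Sum>j\<in>UNIV. of_real (x $ j / norm x) * w $ j)"

end

theory Submission
  imports Defs "HOL-Probability.Probability" "HOL-Complex_Analysis.Complex_Analysis"
begin

text \<open>
  Write \<open>F\<close> for the Fourier transform of the datum. Two facts carry the proof.

  Local smoothing: the space-time integral of \<open>|grad u|^2\<close> over the cylinder of radius \<open>R\<close> is at most
  \<open>C R\<close> times the integral of \<open>|\<xi>| |F|^2\<close>. Inserting Gaussian weights in \<open>t\<close> and \<open>x\<close> turns the
  square integral into a quadratic form in \<open>F\<close> whose positive kernel is concentrated near
  \<open>|\<xi>| = |\<eta>|\<close> and \<open>|\<xi> - \<eta>| < 1/R\<close>, and Schur's test applies. The bound also produces the gradient of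
  \<open>u\<close> as a function of \<open>(t, x)\<close>, as a limit over frequency truncations.

  Dispersion: for a test function \<open>F\<close> and \<open>z = x / (4 pi t)\<close> the radial derivative of \<open>u\<close> at \<open>(t, x)\<close> equals,
  up to a phase and the factor \<open>(4 pi |t|)^(-n/2)\<close>, the function \<open>2 pi |z| F(z)\<close>, with an error whose
  \<open>L^2\<close> norm in \<open>x\<close> is \<open>O(1 / (1 + |t|))\<close>, hence square integrable in \<open>t\<close>. The main term spends time
  \<open>R / (2 pi |z|)\<close> in the ball of radius \<open>R\<close>, which gives exactly \<open>2 pi R\<close> times the integral of
  \<open>|\<xi>| |F|^2\<close>, while the error stays bounded as \<open>R\<close> grows.

  Test functions are dense in \<open>L^2(|\<xi>| d\<xi>)\<close>, and local smoothing extends the limit to all data.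
\<close>

section \<open>Gaussian integrals\<close>

text \<open>Neither Plancherel's identity nor surface measure on spheres enters. All L^2 bounds come
  from one Schur estimate for oscillatory integrals with a Gaussian weight: with a linear phase it
  gives Bessel's inequality, with the phase of the wave it gives local smoothing. One-sided bounds
  suffice, because the main term of the dispersion is known pointwise and its integral is computed
  exactly by scaling and Fubini.

  The datum is rough: |\<xi>| F need not be integrable or square integrable, so the gradient is not
  given by a convergent integral and may fail to be a function at single times. It is built by
  truncating F so fast (error 4^-k) that the gradients converge off a null set, and is identified by
  pairing with test functions. The gradient is unique almost everywhere, so a single v settles the
  claim for all v.

  Limits are taken for square roots of the integrals, where the L^2 triangle inequality is
  available: replacing F by a test function costs \<open>sqrt R\<close> times a small factor uniform
  in R, dispersion costs a constant. Dividing by \<open>sqrt R\<close>, the radius tends to infinity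
  while the approximation is held fixed.\<close>

lemma norm_exp_minus_one_le: "cmod (exp z - 1) \<le> cmod z * exp (cmod z)"
proof -
  have "cmod (exp z - exp 0) \<le> exp (cmod z) * cmod (z - 0)"
  proof (rule field_differentiable_bound[where S = "closed_segment 0 z" and f' = exp])
    fix w assume "w \<in> closed_segment 0 z"
    then have "cmod w \<le> cmod z"
      using segment_bound1[of w 0 z] by simp
    then show "cmod (exp w) \<le> exp (cmod z)"
      by (smt (verit) exp_le_cancel_iff norm_exp)
  qed (auto intro!: derivative_eq_intros)
  then show ?thesis by (simp add: mult.commute)
qed

lemma
  fixes c :: real assumes "c > 0"
  shows integrable_gaussian: "integrable lborel (\<lambda>y::real. exp (- (c * y\<^sup>2)))"
    and integrable_gaussian_square: "integrable lborel (\<lambda>y::real. y\<^sup>2 * exp (- (c * y\<^sup>2)))"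
proof -
  have "exp (- (c * y\<^sup>2)) = sqrt (pi / c) * normal_density 0 (sqrt (1 / (2 * c))) y"
    if "c > 0" for c y :: real
    using that by (simp add: normal_density_def real_sqrt_divide real_sqrt_mult field_simps)
  then have *: "integrable lborel (\<lambda>y::real. exp (- (c * y\<^sup>2)))" if "c > 0" for c :: real
    using that by (simp add: integrable_normal_density)
  then show "integrable lborel (\<lambda>y::real. exp (- (c * y\<^sup>2)))"
    using assms by blast
  \<comment> \<open>Half of the exponent absorbs the factor y^2, by s <= exp s with s = c y^2 /
    2.\<close>
  have bd: "y\<^sup>2 * exp (- (c * y\<^sup>2)) \<le> (2 / c) * exp (- (c / 2 * y\<^sup>2))" for y :: real
  proof -
    have "c / 2 * y\<^sup>2 \<le> exp (c / 2 * y\<^sup>2)"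
      using exp_ge_add_one_self[of "c / 2 * y\<^sup>2"] by linarith
    then have "c / 2 * y\<^sup>2 * exp (- (c * y\<^sup>2)) \<le> exp (c / 2 * y\<^sup>2) * exp (- (c * y\<^sup>2))"
      by (intro mult_right_mono) auto
    also have "\<dots> = exp (- (c / 2 * y\<^sup>2))"
      by (simp add: exp_add[symmetric] field_simps)
    finally have "(2 / c) * (c / 2 * y\<^sup>2 * exp (- (c * y\<^sup>2))) \<le> (2 / c) * exp (- (c / 2 * y\<^sup>2))"
      using assms by (intro mult_left_mono) auto
    then show ?thesis using assms by simp
  qed
  have i: "integrable lborel (\<lambda>y. (2 / c) * exp (- (c / 2 * y\<^sup>2)))"
    using *[of "c / 2"] assms by simp
  show "integrable lborel (\<lambda>y::real. y\<^sup>2 * exp (- (c * y\<^sup>2)))"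
    by (rule Bochner_Integration.integrable_bound[OF i]) (use assms bd in \<open>simp_all add: abs_mult\<close>)
qed

text \<open>This is the characteristic function of the standard normal distribution, rescaled by y =
  s x with s^2 = 1 / (2 pi a).\<close>

lemma gaussian_fourier_real:
  fixes a z :: real assumes "a > 0"
  shows "(LINT y|lborel. exp (complex_of_real (- (pi * a * y\<^sup>2)) + \<i> * of_real (2 * pi * y * z))) =
    exp (- of_real (pi * z\<^sup>2 / a)) / of_real (sqrt a)"
proof -
  let ?s = "sqrt (1 / (2 * pi * a))"
  have s: "?s > 0" using assms by simp
  have s2: "?s\<^sup>2 = 1 / (2 * pi * a)" using assms by simp
  let ?t = "2 * pi * z * ?s"
  have "char std_normal_distribution ?t =
      (LINT x|lborel. std_normal_density x *\<^sub>R iexp (?t * x))"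
    unfolding char_def
    by (subst integral_density) (auto simp: normal_density_nonneg)
  then have "(LINT x|lborel. std_normal_density x *\<^sub>R iexp (?t * x)) = exp (- of_real (?t\<^sup>2 / 2))"
    by (simp add: char_std_normal_distribution exp_of_real[symmetric])
  also have "?t\<^sup>2 / 2 = pi * z\<^sup>2 / a"
    using assms by (simp add: power_mult_distrib s2 power2_eq_square field_simps)
  finally have 1: "(LINT x|lborel. std_normal_density x *\<^sub>R iexp (?t * x)) = exp (- of_real (pi * z\<^sup>2 / a))" .
  have "(LINT y|lborel. exp (complex_of_real (- (pi * a * y\<^sup>2)) + \<i> * of_real (2 * pi * y * z))) =
     ?s *\<^sub>R (LINT x|lborel. exp (complex_of_real (- (pi * a * (?s * x)\<^sup>2)) + \<i> * of_real (2 * pi * (?s * x) * z)))"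
    using s by (subst lborel_integral_real_affine[where c = ?s and t = 0]) auto
  also have "(\<lambda>x. exp (complex_of_real (- (pi * a * (?s * x)\<^sup>2)) + \<i> * of_real (2 * pi * (?s * x) * z))) =
     (\<lambda>x. sqrt (2 * pi) *\<^sub>R (std_normal_density x *\<^sub>R iexp (?t * x)))"
  proof
    fix x
    have "pi * a * (?s * x)\<^sup>2 = x\<^sup>2 / 2"
      using assms by (simp add: power_mult_distrib s2)
    then show "exp (complex_of_real (- (pi * a * (?s * x)\<^sup>2)) + \<i> * of_real (2 * pi * (?s * x) * z)) =
      sqrt (2 * pi) *\<^sub>R (std_normal_density x *\<^sub>R iexp (?t * x))"
      by (simp only: exp_add std_normal_density_def)
         (simp add: scaleR_conv_of_real exp_of_real mult_ac flip: of_real_power of_real_mult of_real_minus)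
  qed
  also have "?s *\<^sub>R (LINT x|lborel. sqrt (2 * pi) *\<^sub>R (std_normal_density x *\<^sub>R iexp (?t * x))) =
     (?s * sqrt (2 * pi)) *\<^sub>R exp (- of_real (pi * z\<^sup>2 / a))"
    by (subst integral_scaleR_right) (simp only: 1 scaleR_scaleR)
  also have "?s * sqrt (2 * pi) = 1 / sqrt a"
    using assms by (simp add: real_sqrt_mult real_sqrt_divide)
  finally show ?thesis by (simp add: scaleR_conv_of_real)
qed

text \<open>Both sides of the formula are holomorphic in a on the right half plane and agree on the
  positive reals, so the identity theorem applies. The principal root \<open>csqrt\<close> is the
  right branch, since the half plane avoids its cut.\<close>

lemma
  fixes a :: complex and z :: real assumes a: "Re a > 0"
  shows integrable_complex_gaussian:
      "integrable lborel (\<lambda>y::real. exp (- (of_real pi * a * of_real (y\<^sup>2)) + \<i> * of_real (2 * pi * y * z)))"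
    and gaussian_fourier_complex:
      "(LINT y|lborel. exp (- (of_real pi * a * of_real (y\<^sup>2)) + \<i> * of_real (2 * pi * y * z))) =
        exp (- (of_real (pi * z\<^sup>2) / a)) / csqrt a"
proof -
  let ?g = "\<lambda>a y. exp (- (of_real pi * a * of_real (y\<^sup>2)) + \<i> * of_real (2 * pi * y * z))"
  let ?S = "{a. Re a > 0}"
  have norm_g: "cmod (?g a y) = exp (- (pi * Re a * y\<^sup>2))" for a and y :: real
    by simp
  have int: "integrable lborel (?g a)" if "Re a > 0" for a
  proof (rule Bochner_Integration.integrable_bound[OF integrable_gaussian[of "pi * Re a"]])
    show "AE y in lborel. norm (?g a y) \<le> norm (exp (- (pi * Re a * y\<^sup>2)))"
      unfolding norm_g by simp
  qed (use that in auto)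
  then show "integrable lborel (?g a)" using a .
  have deriv: "((\<lambda>a. LINT y|lborel. ?g a y) has_field_derivative
      (LINT y|lborel. ?g a y * (- (of_real pi * of_real (y\<^sup>2))))) (at a)" if ra: "Re a > 0" for a
    unfolding DERIV_def tendsto_at_iff_sequentially o_def
  proof (intro allI impI)
    fix h :: "nat \<Rightarrow> complex"
    assume h0: "\<forall>i. h i \<in> UNIV - {0}" and hl: "h \<longlonglongrightarrow> 0"
    obtain N where N: "\<And>i. i \<ge> N \<Longrightarrow> cmod (h i) < Re a / 2"
      using hl ra unfolding lim_sequentially dist_norm by (metis diff_zero half_gt_zero)
    have hS: "Re (a + h i) > 0" if "i \<ge> N" for i
      using N[OF that] abs_Re_le_cmod[of "h i"] ra by (auto simp: abs_if split: if_splits)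
    \<comment> \<open>The difference quotient in a with the Gaussian factored out. As soon as |h| <
      Re a / 2, the loss exp (pi |h| y^2) is absorbed by half of the Gaussian, which yields the
      dominating function.\<close>
    let ?q = "\<lambda>i y. ?g a y * ((exp (- (of_real pi * h i * of_real (y\<^sup>2))) - 1) / h i)"
    have ev: "((LINT y|lborel. ?g (a + h i) y) - (LINT y|lborel. ?g a y)) / h i = (LINT y|lborel. ?q i y)"
      if "i \<ge> N" for i
    proof -
      have "((LINT y|lborel. ?g (a + h i) y) - (LINT y|lborel. ?g a y)) / h i =
         (LINT y|lborel. (?g (a + h i) y - ?g a y) / h i)"
        using int[OF hS[OF that]] int[OF ra] by simp
      also have "(\<lambda>y. (?g (a + h i) y - ?g a y) / h i) = ?q i"
        by (auto simp: fun_eq_iff exp_add[symmetric] algebra_simps diff_divide_distrib)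
      finally show ?thesis .
    qed
    have "(\<lambda>i. LINT y|lborel. ?q (i + N) y) \<longlonglongrightarrow> (LINT y|lborel. ?g a y * (- (of_real pi * of_real (y\<^sup>2))))"
    proof (rule integral_dominated_convergence[where w = "\<lambda>y. pi * (y\<^sup>2 * exp (- (pi * Re a / 2 * y\<^sup>2)))"])
      show "integrable lborel (\<lambda>y. pi * (y\<^sup>2 * exp (- (pi * Re a / 2 * y\<^sup>2))))"
        using ra by (intro integrable_mult_right integrable_gaussian_square) auto
      show "AE y in lborel. (\<lambda>i. ?q (i + N) y) \<longlonglongrightarrow> ?g a y * (- (of_real pi * of_real (y\<^sup>2)))"
      proof (intro AE_I2 tendsto_mult tendsto_const)
        fix y :: real
        have "((\<lambda>h::complex. exp (- (of_real pi * h * of_real (y\<^sup>2)))) has_field_derivative (- (of_real pi * of_real (y\<^sup>2)))) (at 0)"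
          by (auto intro!: derivative_eq_intros)
        then have "((\<lambda>h::complex. (exp (- (of_real pi * h * of_real (y\<^sup>2))) - 1) / h) \<longlongrightarrow> - (of_real pi * of_real (y\<^sup>2))) (at 0)"
          by (simp add: DERIV_def)
        then have "(\<lambda>i. (exp (- (of_real pi * h i * of_real (y\<^sup>2))) - 1) / h i) \<longlonglongrightarrow> - (of_real pi * of_real (y\<^sup>2))"
          using h0 hl unfolding tendsto_at_iff_sequentially o_def by blast
        then show "(\<lambda>i. (exp (- (of_real pi * h (i + N) * of_real (y\<^sup>2))) - 1) / h (i + N)) \<longlonglongrightarrow> - (of_real pi * of_real (y\<^sup>2))"
          by (rule LIMSEQ_ignore_initial_segment)
      qed
      fix i
      show "AE y in lborel. norm (?q (i + N) y) \<le> pi * (y\<^sup>2 * exp (- (pi * Re a / 2 * y\<^sup>2)))"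
      proof (rule AE_I2)
        fix y :: real
        let ?h = "h (i + N)"
        have hn: "cmod ?h < Re a / 2" "?h \<noteq> 0" using N[of "i + N"] h0 by auto
        have "cmod (exp (- (of_real pi * ?h * of_real (y\<^sup>2))) - 1) \<le>
           (pi * cmod ?h * y\<^sup>2) * exp (pi * cmod ?h * y\<^sup>2)"
          using norm_exp_minus_one_le[of "- (of_real pi * ?h * of_real (y\<^sup>2))"]
          by (simp add: norm_mult norm_power)
        also have "\<dots> \<le> (pi * cmod ?h * y\<^sup>2) * exp (pi * (Re a / 2) * y\<^sup>2)"
          using hn by (intro mult_left_mono) (auto intro!: mult_right_mono mult_left_mono simp del: times_divide_eq_left times_divide_eq_right)
        finally have "cmod ((exp (- (of_real pi * ?h * of_real (y\<^sup>2))) - 1) / ?h) \<le>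
           (pi * y\<^sup>2) * exp (pi * (Re a / 2) * y\<^sup>2)"
          using hn by (simp add: norm_divide field_simps)
        then have "cmod (?q (i + N) y) \<le> exp (- (pi * Re a * y\<^sup>2)) * ((pi * y\<^sup>2) * exp (pi * (Re a / 2) * y\<^sup>2))"
          unfolding norm_mult norm_g by (intro mult_left_mono) auto
        also have "\<dots> = pi * y\<^sup>2 * (exp (- (pi * Re a * y\<^sup>2)) * exp (pi * (Re a / 2) * y\<^sup>2))"
          by simp
        also have "exp (- (pi * Re a * y\<^sup>2)) * exp (pi * (Re a / 2) * y\<^sup>2) = exp (- (pi * Re a / 2 * y\<^sup>2))"
          unfolding exp_add[symmetric] by (simp add: field_simps)
        finally show "cmod (?q (i + N) y) \<le> pi * (y\<^sup>2 * exp (- (pi * Re a / 2 * y\<^sup>2)))"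
          by (simp add: mult.assoc)
      qed
    qed measurable
    also have "(\<lambda>i. LINT y|lborel. ?q (i + N) y) = (\<lambda>i. ((LINT y|lborel. ?g (a + h (i + N)) y) - (LINT y|lborel. ?g a y)) / h (i + N))"
      by (intro ext ev[symmetric]) simp
    finally have "(\<lambda>i. ((LINT y|lborel. ?g (a + h (i + N)) y) - (LINT y|lborel. ?g a y)) / h (i + N))
         \<longlonglongrightarrow> (LINT y|lborel. ?g a y * (- (of_real pi * of_real (y\<^sup>2))))" .
    then show "(\<lambda>i. ((LINT y|lborel. ?g (a + h i) y) - (LINT y|lborel. ?g a y)) / h i)
         \<longlonglongrightarrow> (LINT y|lborel. ?g a y * (- (of_real pi * of_real (y\<^sup>2))))"
      by (rule LIMSEQ_offset)
  qed
  have S: "open ?S" "connected ?S"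
    using open_halfspace_Re_gt[of 0] convex_halfspace_Re_gt[of 0] convex_connected by auto
  have hol1: "(\<lambda>a. LINT y|lborel. ?g a y) holomorphic_on ?S"
    using deriv S(1) by (auto simp: holomorphic_on_open)
  have hol2: "(\<lambda>a. exp (- (of_real (pi * z\<^sup>2) / a)) / csqrt a) holomorphic_on ?S"
  proof (intro holomorphic_intros)
    show "\<And>z. z \<in> ?S \<Longrightarrow> z \<notin> \<real>\<^sub>\<le>\<^sub>0" by (auto simp: complex_nonpos_Reals_iff)
  qed auto
  have eq: "(LINT y|lborel. ?g w y) - exp (- (of_real (pi * z\<^sup>2) / w)) / csqrt w = 0"
    if "w \<in> of_real ` {0<..}" for w
    using that gaussian_fourier_real[of _ z] by (auto simp: csqrt_of_real)
  \<comment> \<open>The identity theorem asks for an accumulation point of the set of agreement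
    inside the half plane; 1 is one.\<close>
  have lim: "(1::complex) islimpt (of_real ` {0<..})"
    unfolding islimpt_sequential
  proof (intro exI conjI allI)
    show "complex_of_real (1 + 1 / Suc n) \<in> of_real ` {0<..} - {1}" for n
    proof -
      have "0 < 1 + 1 / real (Suc n)" "1 + 1 / real (Suc n) \<noteq> 1"
        by (simp_all add: add_pos_pos)
      then show ?thesis
        by (metis Diff_iff empty_iff greaterThan_iff imageI insert_iff of_real_eq_1_iff)
    qed
    have "(\<lambda>n. complex_of_real (1 + 1 / Suc n)) \<longlonglongrightarrow> of_real (1 + 0)"
      by (intro tendsto_intros LIMSEQ_Suc lim_1_over_n)
    then show "(\<lambda>n. complex_of_real (1 + 1 / Suc n)) \<longlonglongrightarrow> 1" by simp
  qed
  have "(LINT y|lborel. ?g a y) - exp (- (of_real (pi * z\<^sup>2) / a)) / csqrt a = 0"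
    by (rule analytic_continuation[OF holomorphic_on_diff[OF hol1 hol2] S, of "of_real ` {0<..}" 1])
       (use lim eq a in auto)
  then show "(LINT y|lborel. ?g a y) = exp (- (of_real (pi * z\<^sup>2) / a)) / csqrt a"
    by simp
qed

lemma
  fixes f :: "'a::euclidean_space \<Rightarrow> real \<Rightarrow> 'b::{real_normed_field,banach,second_countable_topology}"
  assumes "\<And>b. b \<in> Basis \<Longrightarrow> integrable lborel (f b)"
  shows lborel_integral_prod: "(LINT x|lborel. (\<Prod>b\<in>Basis. f b (x \<bullet> b))) = (\<Prod>b\<in>Basis. LINT x|lborel. f b x)"
    and lborel_integrable_prod: "integrable lborel (\<lambda>x. (\<Prod>b\<in>Basis. f b (x \<bullet> b)))"
proof -
  interpret product_sigma_finite "\<lambda>_. lborel :: real measure" ..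
  have [measurable]: "\<And>b. b \<in> Basis \<Longrightarrow> f b \<in> borel_measurable borel"
    using assms by (auto dest!: borel_measurable_integrable)
  have *: "(\<Prod>b\<in>Basis. f b ((\<Sum>c\<in>Basis. y c *\<^sub>R c) \<bullet> b)) = (\<Prod>b\<in>Basis. f b (y b))" for y :: "'a \<Rightarrow> real"
    by (intro prod.cong) auto
  show "(LINT x|lborel. (\<Prod>b\<in>Basis. f b (x \<bullet> b))) = (\<Prod>b\<in>Basis. LINT x|lborel. f b x)"
    unfolding lborel_eq[where 'a = 'a]
    by (subst integral_distr) (auto simp: * intro!: product_integral_prod assms)
  show "integrable lborel (\<lambda>x. (\<Prod>b\<in>Basis. f b (x \<bullet> b)))"
    unfolding lborel_eq[where 'a = 'a]
    by (subst integrable_distr_eq) (auto simp: * intro!: product_integrable_prod assms)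
qed

lemma norm_square_Basis: "(norm (x :: 'a::euclidean_space))\<^sup>2 = (\<Sum>b\<in>Basis. (x \<bullet> b)\<^sup>2)"
  unfolding dot_square_norm[symmetric] by (subst euclidean_inner) (simp add: power2_eq_square)

lemma
  fixes z :: "'a::euclidean_space" assumes a: "Re a > 0"
  shows gaussian_fourier_integrable:
      "integrable lborel (\<lambda>y. exp (- (of_real pi * a * of_real ((norm y)\<^sup>2)) + \<i> * of_real (2 * pi * (y \<bullet> z))))"
    and gaussian_fourier:
      "(LINT y|lborel. exp (- (of_real pi * a * of_real ((norm y)\<^sup>2)) + \<i> * of_real (2 * pi * (y \<bullet> z)))) =
        exp (- (of_real (pi * (norm z)\<^sup>2) / a)) / csqrt a ^ DIM('a)"
proof -
  let ?g = "\<lambda>b y. exp (- (of_real pi * a * of_real (y\<^sup>2)) + \<i> * of_real (2 * pi * y * (z \<bullet> b)))"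
  have eq: "exp (- (of_real pi * a * of_real ((norm y)\<^sup>2)) + \<i> * of_real (2 * pi * (y \<bullet> z))) =
      (\<Prod>b\<in>Basis. ?g b (y \<bullet> b))" for y :: 'a
  proof -
    have "- (of_real pi * a * of_real ((norm y)\<^sup>2)) + \<i> * of_real (2 * pi * (y \<bullet> z)) =
       (\<Sum>b\<in>Basis. - (of_real pi * a * of_real ((y \<bullet> b)\<^sup>2)) + \<i> * of_real (2 * pi * (y \<bullet> b) * (z \<bullet> b)))"
      unfolding norm_square_Basis euclidean_inner[of y z]
      by (simp add: sum.distrib sum_subtractf sum_distrib_left sum_negf mult_ac)
    then show ?thesis by (simp add: exp_sum)
  qed
  show "integrable lborel (\<lambda>y. exp (- (of_real pi * a * of_real ((norm y)\<^sup>2)) + \<i> * of_real (2 * pi * (y \<bullet> z))))"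
    unfolding eq by (intro lborel_integrable_prod integrable_complex_gaussian a)
  have "(LINT y|lborel. exp (- (of_real pi * a * of_real ((norm y)\<^sup>2)) + \<i> * of_real (2 * pi * (y \<bullet> z)))) =
     (\<Prod>b\<in>Basis. exp (- (of_real (pi * (z \<bullet> b)\<^sup>2) / a)) / csqrt a)"
    unfolding eq
    by (subst lborel_integral_prod)
       (intro integrable_complex_gaussian a, intro prod.cong refl gaussian_fourier_complex a)
  also have "\<dots> = exp (\<Sum>b\<in>Basis. - (of_real (pi * (z \<bullet> b)\<^sup>2) / a)) / csqrt a ^ DIM('a)"
    by (simp add: prod_dividef exp_sum)
  also have "(\<Sum>b\<in>Basis. - (of_real (pi * (z \<bullet> b)\<^sup>2) / a)) = - (of_real (pi * (norm z)\<^sup>2) / a)"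
    by (simp add: norm_square_Basis sum_negf sum_distrib_left sum_divide_distrib)
  finally show "(LINT y|lborel. exp (- (of_real pi * a * of_real ((norm y)\<^sup>2)) + \<i> * of_real (2 * pi * (y \<bullet> z)))) =
        exp (- (of_real (pi * (norm z)\<^sup>2) / a)) / csqrt a ^ DIM('a)" .
qed

section \<open>Oscillatory integrals with Gaussian weight\<close>

lemma
  fixes f :: "'a::euclidean_space \<Rightarrow> ennreal" and c :: real assumes [measurable]: "f \<in> borel_measurable borel"
  shows nn_integral_lborel_scale: "c \<noteq> 0 \<Longrightarrow> (\<integral>\<^sup>+x. f x \<partial>lborel) = ennreal (\<bar>c\<bar> ^ DIM('a)) * (\<integral>\<^sup>+x. f (c *\<^sub>R x) \<partial>lborel)"
    and nn_integral_lborel_shift: "(\<integral>\<^sup>+x. f x \<partial>lborel) = (\<integral>\<^sup>+x. f (x + a) \<partial>lborel)"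
proof -
  show "(\<integral>\<^sup>+x. f x \<partial>lborel) = ennreal (\<bar>c\<bar> ^ DIM('a)) * (\<integral>\<^sup>+x. f (c *\<^sub>R x) \<partial>lborel)" if "c \<noteq> 0"
    using that
    by (subst lborel_affine[of c 0])
       (auto simp: nn_integral_density nn_integral_distr nn_integral_cmult ennreal_power)
  show "(\<integral>\<^sup>+x. f x \<partial>lborel) = (\<integral>\<^sup>+x. f (x + a) \<partial>lborel)"
    by (subst lborel_distr_plus[of a, symmetric]) (auto simp: nn_integral_distr add.commute)
qed

lemma nn_integral_gaussian_real:
  fixes c :: real assumes "c > 0"
  shows "(\<integral>\<^sup>+y. ennreal (exp (- (pi * c * (y - p)\<^sup>2))) \<partial>lborel) = ennreal (1 / sqrt c)"
proof -
  let ?s = "sqrt (1 / (2 * pi * c))"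
  have s: "?s > 0" using assms by simp
  have eq: "exp (- (pi * c * (y - p)\<^sup>2)) = (1 / sqrt c) * normal_density p ?s y" for y
    using assms by (simp add: normal_density_def real_sqrt_divide real_sqrt_mult field_simps)
  have i: "integrable lborel (\<lambda>y. (1 / sqrt c) * normal_density p ?s y)"
    using s by (intro integrable_mult_right integrable_normal_density)
  have "(LINT y|lborel. (1 / sqrt c) * normal_density p ?s y) = 1 / sqrt c"
    using s by simp
  then show ?thesis
    unfolding eq using assms i by (subst nn_integral_eq_integral) auto
qed

lemma nn_integral_gaussian:
  fixes p :: "'a::euclidean_space" assumes "c > 0"
  shows "(\<integral>\<^sup>+y. ennreal (exp (- (pi * c * (norm (y - p))\<^sup>2))) \<partial>lborel) = ennreal ((1 / sqrt c) ^ DIM('a))"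
proof -
  have "ennreal (exp (- (pi * c * (norm (y - p))\<^sup>2))) =
      (\<Prod>b\<in>Basis. ennreal (exp (- (pi * c * (y \<bullet> b - p \<bullet> b)\<^sup>2))))" for y :: 'a
    by (subst prod_ennreal) (auto simp: norm_square_Basis exp_sum[symmetric] sum_distrib_left sum_negf inner_diff_left)
  then have "(\<integral>\<^sup>+y. ennreal (exp (- (pi * c * (norm (y - p))\<^sup>2))) \<partial>lborel) =
     (\<Prod>b\<in>(Basis::'a set). ennreal (1 / sqrt c))"
    using assms by (simp only:, subst nn_integral_lborel_prod) (auto simp: nn_integral_gaussian_real)
  then show ?thesis using assms by (simp add: ennreal_power)
qed

text \<open>Fatou's lemma for a uniform bound; it removes Gaussian cutoffs from estimates that do
  not depend on them.\<close>

lemma nn_integral_le_of_tendsto: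
  assumes [measurable]: "\<And>k. f k \<in> borel_measurable M"
    and "\<And>x. x \<in> space M \<Longrightarrow> (\<lambda>k. f k x) \<longlonglongrightarrow> g x" and "\<And>k. (\<integral>\<^sup>+x. f k x \<partial>M) \<le> (B::ennreal)"
  shows "(\<integral>\<^sup>+x. g x \<partial>M) \<le> B"
proof -
  have "(\<integral>\<^sup>+x. g x \<partial>M) = (\<integral>\<^sup>+x. liminf (\<lambda>k. f k x) \<partial>M)"
    using assms(2) by (intro nn_integral_cong) (metis lim_imp_Liminf sequentially_bot)
  also have "\<dots> \<le> liminf (\<lambda>k. \<integral>\<^sup>+x. f k x \<partial>M)"
    by (rule nn_integral_liminf) simp
  also have "\<dots> \<le> liminf (\<lambda>k::nat. B)"
    by (rule Liminf_mono) (simp add: assms)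
  finally show ?thesis by (simp add: Liminf_const)
qed

section \<open>Fubini for integrands dominated by a product\<close>

lemma integrable_dominated_product:
  fixes F :: "'a::euclidean_space \<times> 'b::euclidean_space \<Rightarrow> complex"
  assumes F[measurable]: "F \<in> borel_measurable borel"
    and "\<And>x y. norm (F (x, y)) \<le> g x * h y"
    and g: "integrable lborel g" and h: "integrable lborel h"
  shows "integrable (lborel \<Otimes>\<^sub>M lborel) F"
proof (rule Bochner_Integration.integrable_bound)
  have [measurable]: "g \<in> borel_measurable borel" "h \<in> borel_measurable borel"
    using g h by auto
  show "integrable (lborel \<Otimes>\<^sub>M lborel) (\<lambda>(x, y). g x * h y)"
  proof (rule lborel_pair.Fubini_integrable)
    show "integrable lborel (\<lambda>x. LINT y|lborel. norm (case (x, y) of (x, y) \<Rightarrow> g x * h y))"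
      using g by (simp add: abs_mult)
    show "AE x in lborel. integrable lborel (\<lambda>y. case (x, y) of (x, y) \<Rightarrow> g x * h y)"
      using h by simp
  qed simp
  show "F \<in> borel_measurable (lborel \<Otimes>\<^sub>M lborel)"
    using F by (simp add: lborel_prod)
  show "AE x in lborel \<Otimes>\<^sub>M lborel. norm (F x) \<le> norm (case x of (x, y) \<Rightarrow> g x * h y)"
    by (intro AE_I2) (use assms(2) in \<open>auto intro: order_trans[OF _ abs_ge_self]\<close>)
qed

lemma swap_lebesgue_integrals:
  fixes F :: "'a::euclidean_space \<Rightarrow> 'b::euclidean_space \<Rightarrow> complex"
  assumes "case_prod F \<in> borel_measurable borel"
    and "\<And>x y. norm (F x y) \<le> g x * h y"
    and "integrable lborel g" and "integrable lborel h"
  shows "(LINT x|lborel. LINT y|lborel. F x y) = (LINT y|lborel. LINT x|lborel. F x y)"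
  by (rule lborel_pair.Fubini_integral[symmetric], rule integrable_dominated_product[OF assms(1) _ assms(3,4)])
     (use assms(2) in auto)

lemma nn_swap:
  fixes F :: "'a::euclidean_space \<Rightarrow> 'b::euclidean_space \<Rightarrow> ennreal"
  assumes "case_prod F \<in> borel_measurable borel"
  shows "(\<integral>\<^sup>+x. \<integral>\<^sup>+y. F x y \<partial>lborel \<partial>lborel) = (\<integral>\<^sup>+y. \<integral>\<^sup>+x. F x y \<partial>lborel \<partial>lborel)"
  using lborel_pair.Fubini'[of F] assms by (simp add: lborel_prod)

lemma integrable_gaussian_weight:
  "integrable lborel (\<lambda>y::'a::euclidean_space. exp (- (pi * (norm y)\<^sup>2)))"
  by (rule integrableI_bounded) (use nn_integral_gaussian[of 1 "0::'a"] in auto)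

lemma gaussian_cis:
  fixes z :: "'a::euclidean_space"
  shows "(LINT y|lborel. of_real (exp (- (pi * (norm y)\<^sup>2))) * cis (2 * pi * (y \<bullet> z))) = complex_of_real (exp (- (pi * (norm z)\<^sup>2)))"
proof -
  have "(\<lambda>y. of_real (exp (- (pi * (norm y)\<^sup>2))) * cis (2 * pi * (y \<bullet> z))) =
    (\<lambda>y. exp (- (of_real pi * 1 * of_real ((norm y)\<^sup>2)) + \<i> * of_real (2 * pi * (y \<bullet> z))))"
    by (simp add: exp_add exp_diff cis_conv_exp exp_of_real[symmetric] exp_minus field_simps)
  then show ?thesis
    using gaussian_fourier[of 1 z] by (simp add: exp_of_real[symmetric])
qed

lemma borel_measurable_cis[measurable (raw)]:
  "f \<in> borel_measurable M \<Longrightarrow> (\<lambda>x. cis (f x)) \<in> borel_measurable M"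
  by (rule borel_measurable_continuous_on[where f = cis]) (auto intro!: continuous_intros)

lemma borel_measurable_cnj[measurable (raw)]:
  "f \<in> borel_measurable M \<Longrightarrow> (\<lambda>x. cnj (f x)) \<in> borel_measurable M"
  by (rule borel_measurable_continuous_on[where f = cnj]) (auto intro!: continuous_intros)

text \<open>Write |U|^2 as U times its conjugate and integrate in y first: the Gaussian is its own
  Fourier transform, so a quadratic form in \<Phi> with the positive kernel exp (-pi |p \<xi> - p
  \<eta>|^2) remains, and absolute values may be taken inside. The phase map p is left general; it
  will be a multiple of the identity, and later a parametrization of the space-time frequencies of
  the wave.\<close>

lemma oscillatory_gaussian_bound:
  fixes \<Phi> :: "'a::euclidean_space \<Rightarrow> complex" and p :: "'a \<Rightarrow> 'e::euclidean_space"
  assumes \<Phi>: "integrable lborel \<Phi>" and p[measurable]: "p \<in> borel_measurable borel"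
  shows "(\<integral>\<^sup>+y. ennreal (exp (- (pi * (norm y)\<^sup>2)) * (cmod (LINT \<xi>|lborel. cis (2 * pi * (y \<bullet> p \<xi>)) * \<Phi> \<xi>))\<^sup>2) \<partial>lborel)
    \<le> (\<integral>\<^sup>+\<xi>. \<integral>\<^sup>+\<eta>. ennreal (cmod (\<Phi> \<xi>) * cmod (\<Phi> \<eta>) * exp (- (pi * (norm (p \<xi> - p \<eta>))\<^sup>2))) \<partial>lborel \<partial>lborel)"
proof -
  have \<Phi>m[measurable]: "\<Phi> \<in> borel_measurable borel" using \<Phi> by auto
  let ?w = "\<lambda>y::'e. exp (- (pi * (norm y)\<^sup>2))"
  let ?U = "\<lambda>y. LINT \<xi>|lborel. cis (2 * pi * (y \<bullet> p \<xi>)) * \<Phi> \<xi>"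
  let ?K = "\<lambda>\<xi> \<eta>. exp (- (pi * (norm (p \<xi> - p \<eta>))\<^sup>2))"
  let ?G = "\<lambda>\<xi>. LINT y|lborel. of_real (?w y) * cnj (?U y) * cis (2 * pi * (y \<bullet> p \<xi>))"
  define B where "B = (LINT \<xi>|lborel. cmod (\<Phi> \<xi>))"
  have B0: "0 \<le> B" unfolding B_def by simp
  have Um[measurable]: "?U \<in> borel_measurable borel" by measurable
  have U: "cmod (?U y) \<le> B" for y
    unfolding B_def by (rule integral_norm_bound[THEN order_trans]) (simp add: norm_mult)
  have iw: "integrable lborel ?w" by (rule integrable_gaussian_weight)
  have iwB: "integrable lborel (\<lambda>y. B * ?w y)" using iw by simp
  have iPhi: "integrable lborel (\<lambda>\<xi>. cmod (\<Phi> \<xi>))" using \<Phi> by simp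
  \<comment> \<open>The inner y-integral after Fubini: the conjugate of U contributes the second
    frequency, and \<open>gaussian_cis\<close> evaluates the result at p \<xi> - p \<eta>.\<close>
  have G: "?G \<xi> = (LINT \<eta>|lborel. cnj (\<Phi> \<eta>) * of_real (?K \<xi> \<eta>))" for \<xi>
  proof -
    have "?G \<xi> = (LINT y|lborel. LINT \<eta>|lborel. of_real (?w y) * cis (2 * pi * (y \<bullet> (p \<xi> - p \<eta>))) * cnj (\<Phi> \<eta>))"
    proof (intro Bochner_Integration.integral_cong refl)
      fix y :: 'e
      have "cnj (?U y) = (LINT \<eta>|lborel. cnj (cis (2 * pi * (y \<bullet> p \<eta>)) * \<Phi> \<eta>))"
        by (rule Bochner_Integration.integral_cnj[symmetric])
      also have "\<dots> = (LINT \<eta>|lborel. cis (- (2 * pi * (y \<bullet> p \<eta>))) * cnj (\<Phi> \<eta>))"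
        by (intro Bochner_Integration.integral_cong refl) (simp add: cis_cnj)
      finally have "cnj (?U y) = (LINT \<eta>|lborel. cis (- (2 * pi * (y \<bullet> p \<eta>))) * cnj (\<Phi> \<eta>))" .
      then have "of_real (?w y) * cnj (?U y) * cis (2 * pi * (y \<bullet> p \<xi>)) =
        (of_real (?w y) * cis (2 * pi * (y \<bullet> p \<xi>))) * (LINT \<eta>|lborel. cis (- (2 * pi * (y \<bullet> p \<eta>))) * cnj (\<Phi> \<eta>))"
        by simp
      also have "\<dots> = (LINT \<eta>|lborel. (of_real (?w y) * cis (2 * pi * (y \<bullet> p \<xi>))) * (cis (- (2 * pi * (y \<bullet> p \<eta>))) * cnj (\<Phi> \<eta>)))"
        by (rule integral_mult_right_zero[symmetric])
      also have "\<dots> = (LINT \<eta>|lborel. of_real (?w y) * cis (2 * pi * (y \<bullet> (p \<xi> - p \<eta>))) * cnj (\<Phi> \<eta>))"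
      proof (intro Bochner_Integration.integral_cong refl)
        fix \<eta>
        have "cis (2 * pi * (y \<bullet> p \<xi>)) * cis (- (2 * pi * (y \<bullet> p \<eta>))) = cis (2 * pi * (y \<bullet> (p \<xi> - p \<eta>)))"
          by (simp add: cis_mult inner_diff_right algebra_simps)
        then show "(of_real (?w y) * cis (2 * pi * (y \<bullet> p \<xi>))) * (cis (- (2 * pi * (y \<bullet> p \<eta>))) * cnj (\<Phi> \<eta>)) =
          of_real (?w y) * cis (2 * pi * (y \<bullet> (p \<xi> - p \<eta>))) * cnj (\<Phi> \<eta>)"
          by (metis mult.assoc)
      qed
      finally show "of_real (?w y) * cnj (?U y) * cis (2 * pi * (y \<bullet> p \<xi>)) =
        (LINT \<eta>|lborel. of_real (?w y) * cis (2 * pi * (y \<bullet> (p \<xi> - p \<eta>))) * cnj (\<Phi> \<eta>))" .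
    qed
    also have "\<dots> = (LINT \<eta>|lborel. LINT y|lborel. of_real (?w y) * cis (2 * pi * (y \<bullet> (p \<xi> - p \<eta>))) * cnj (\<Phi> \<eta>))"
    proof (rule swap_lebesgue_integrals[OF _ _ iw iPhi])
      show "(\<lambda>(y, \<eta>). of_real (?w y) * cis (2 * pi * (y \<bullet> (p \<xi> - p \<eta>))) * cnj (\<Phi> \<eta>)) \<in> borel_measurable borel"
        unfolding borel_prod[symmetric] by measurable
    qed (simp add: norm_mult)
    also have "\<dots> = (LINT \<eta>|lborel. cnj (\<Phi> \<eta>) * of_real (?K \<xi> \<eta>))"
      by (simp only: integral_mult_left_zero gaussian_cis) (simp only: mult.commute)
    finally show ?thesis .
  qed
  have "(LINT y|lborel. of_real (?w y * (cmod (?U y))\<^sup>2)) = (LINT y|lborel. LINT \<xi>|lborel. of_real (?w y) * cnj (?U y) * cis (2 * pi * (y \<bullet> p \<xi>)) * \<Phi> \<xi>)"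
  proof (intro Bochner_Integration.integral_cong refl)
    fix y :: 'e
    have "complex_of_real (?w y * (cmod (?U y))\<^sup>2) = (of_real (?w y) * cnj (?U y)) * ?U y"
      unfolding of_real_mult complex_norm_square by (simp only: mult_ac)
    also have "\<dots> = (LINT \<xi>|lborel. (of_real (?w y) * cnj (?U y)) * (cis (2 * pi * (y \<bullet> p \<xi>)) * \<Phi> \<xi>))"
      by (rule integral_mult_right_zero[symmetric])
    finally show "complex_of_real (?w y * (cmod (?U y))\<^sup>2) =
      (LINT \<xi>|lborel. of_real (?w y) * cnj (?U y) * cis (2 * pi * (y \<bullet> p \<xi>)) * \<Phi> \<xi>)"
      by (simp only: mult.assoc)
  qed
  also have "\<dots> = (LINT \<xi>|lborel. LINT y|lborel. of_real (?w y) * cnj (?U y) * cis (2 * pi * (y \<bullet> p \<xi>)) * \<Phi> \<xi>)"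
  proof (rule swap_lebesgue_integrals[OF _ _ iwB iPhi])
    show "(\<lambda>(y, \<xi>). of_real (?w y) * cnj (?U y) * cis (2 * pi * (y \<bullet> p \<xi>)) * \<Phi> \<xi>) \<in> borel_measurable borel"
      unfolding borel_prod[symmetric] by measurable
    show "norm (of_real (?w y) * cnj (?U y) * cis (2 * pi * (y \<bullet> p \<xi>)) * \<Phi> \<xi>) \<le> B * ?w y * cmod (\<Phi> \<xi>)" for y \<xi>
      using mult_right_mono[OF U[of y], of "?w y * cmod (\<Phi> \<xi>)"] by (simp add: norm_mult mult_ac)
  qed
  also have "\<dots> = (LINT \<xi>|lborel. ?G \<xi> * \<Phi> \<xi>)"
    by (intro Bochner_Integration.integral_cong refl) simp
  finally have main: "(LINT y|lborel. of_real (?w y * (cmod (?U y))\<^sup>2)) = (LINT \<xi>|lborel. ?G \<xi> * \<Phi> \<xi>)" .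
  have iU: "integrable lborel (\<lambda>y. ?w y * (cmod (?U y))\<^sup>2)"
  proof (rule Bochner_Integration.integrable_bound)
    show "integrable lborel (\<lambda>y. B\<^sup>2 * ?w y)" using iw by simp
    have "(cmod (?U y))\<^sup>2 \<le> B\<^sup>2" for y using U[of y] by (intro power_mono) auto
    then show "AE y in lborel. norm (?w y * (cmod (?U y))\<^sup>2) \<le> norm (B\<^sup>2 * ?w y)"
      by (intro AE_I2) (simp add: abs_mult)
  qed measurable
  have "(\<integral>\<^sup>+y. ennreal (?w y * (cmod (?U y))\<^sup>2) \<partial>lborel) = ennreal (LINT y|lborel. ?w y * (cmod (?U y))\<^sup>2)"
    by (rule nn_integral_eq_integral[OF iU]) simp
  also have "(LINT y|lborel. ?w y * (cmod (?U y))\<^sup>2) = cmod (LINT y|lborel. of_real (?w y * (cmod (?U y))\<^sup>2))"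
    unfolding integral_complex_of_real by (simp add: integral_nonneg)
  also have "\<dots> = cmod (LINT \<xi>|lborel. ?G \<xi> * \<Phi> \<xi>)" unfolding main ..
  also have "ennreal \<dots> \<le> (\<integral>\<^sup>+\<xi>. ennreal (cmod (?G \<xi> * \<Phi> \<xi>)) \<partial>lborel)"
  \<comment> \<open>The Bochner integral of a function that is not integrable is 0, so the bound
    holds in that case too.\<close>
  proof (cases "integrable lborel (\<lambda>\<xi>. ?G \<xi> * \<Phi> \<xi>)")
    case True then show ?thesis by (rule integral_norm_bound_ennreal)
  next
    case False then show ?thesis by (simp add: not_integrable_integral_eq)
  qed
  also have "\<dots> \<le> (\<integral>\<^sup>+\<xi>. \<integral>\<^sup>+\<eta>. ennreal (cmod (\<Phi> \<xi>) * cmod (\<Phi> \<eta>) * ?K \<xi> \<eta>) \<partial>lborel \<partial>lborel)"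
  proof (rule nn_integral_mono)
    fix \<xi>
    have "integrable lborel (\<lambda>\<eta>. cnj (\<Phi> \<eta>) * of_real (?K \<xi> \<eta>))"
      by (rule Bochner_Integration.integrable_bound[OF iPhi])
         (auto simp: norm_mult intro!: mult_left_le)
    then have "ennreal (cmod (?G \<xi>)) \<le> (\<integral>\<^sup>+\<eta>. ennreal (cmod (\<Phi> \<eta>) * ?K \<xi> \<eta>) \<partial>lborel)"
      unfolding G by (intro integral_norm_bound_ennreal[THEN order_trans]) (auto simp: norm_mult)
    then have "ennreal (cmod (\<Phi> \<xi>)) * ennreal (cmod (?G \<xi>)) \<le> ennreal (cmod (\<Phi> \<xi>)) * (\<integral>\<^sup>+\<eta>. ennreal (cmod (\<Phi> \<eta>) * ?K \<xi> \<eta>) \<partial>lborel)"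
      by (rule mult_left_mono) simp
    also have "\<dots> = (\<integral>\<^sup>+\<eta>. ennreal (cmod (\<Phi> \<xi>) * cmod (\<Phi> \<eta>) * ?K \<xi> \<eta>) \<partial>lborel)"
      by (subst nn_integral_cmult[symmetric]) (auto simp: ennreal_mult[symmetric] mult.assoc)
    finally show "ennreal (cmod (?G \<xi> * \<Phi> \<xi>)) \<le> (\<integral>\<^sup>+\<eta>. ennreal (cmod (\<Phi> \<xi>) * cmod (\<Phi> \<eta>) * ?K \<xi> \<eta>) \<partial>lborel)"
      by (simp add: norm_mult ennreal_mult[symmetric] mult.commute)
  qed
  finally show ?thesis .
qed

text \<open>Schur's test in its simplest form: the kernel is symmetric and nonnegative, so 2 a b <=
  a^2 + b^2 moves the whole weight onto one variable.\<close>

lemma oscillatory_schur_bound: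
  fixes \<Phi> :: "'a::euclidean_space \<Rightarrow> complex" and p :: "'a \<Rightarrow> 'e::euclidean_space"
  assumes \<Phi>: "integrable lborel \<Phi>" and p[measurable]: "p \<in> borel_measurable borel"
  shows "(\<integral>\<^sup>+y. ennreal (exp (- (pi * (norm y)\<^sup>2)) * (cmod (LINT \<xi>|lborel. cis (2 * pi * (y \<bullet> p \<xi>)) * \<Phi> \<xi>))\<^sup>2) \<partial>lborel)
    \<le> (\<integral>\<^sup>+\<xi>. ennreal ((cmod (\<Phi> \<xi>))\<^sup>2) * (\<integral>\<^sup>+\<eta>. ennreal (exp (- (pi * (norm (p \<xi> - p \<eta>))\<^sup>2))) \<partial>lborel) \<partial>lborel)"
proof -
  have \<Phi>m[measurable]: "\<Phi> \<in> borel_measurable borel" using \<Phi> by auto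
  let ?K = "\<lambda>\<xi> \<eta>. exp (- (pi * (norm (p \<xi> - p \<eta>))\<^sup>2))"
  let ?A = "\<lambda>\<xi> \<eta>. ennreal ((cmod (\<Phi> \<xi>))\<^sup>2 * ?K \<xi> \<eta> / 2)"
  have "(\<integral>\<^sup>+\<xi>. \<integral>\<^sup>+\<eta>. ennreal (cmod (\<Phi> \<xi>) * cmod (\<Phi> \<eta>) * ?K \<xi> \<eta>) \<partial>lborel \<partial>lborel)
     \<le> (\<integral>\<^sup>+\<xi>. \<integral>\<^sup>+\<eta>. ?A \<xi> \<eta> + ?A \<eta> \<xi> \<partial>lborel \<partial>lborel)"
  proof (intro nn_integral_mono)
    fix \<xi> \<eta>
    have "2 * (cmod (\<Phi> \<xi>) * cmod (\<Phi> \<eta>)) \<le> (cmod (\<Phi> \<xi>))\<^sup>2 + (cmod (\<Phi> \<eta>))\<^sup>2"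
      using sum_squares_bound[of "cmod (\<Phi> \<xi>)" "cmod (\<Phi> \<eta>)"] by (simp add: mult.assoc)
    then have "2 * (cmod (\<Phi> \<xi>) * cmod (\<Phi> \<eta>)) * ?K \<xi> \<eta> \<le> ((cmod (\<Phi> \<xi>))\<^sup>2 + (cmod (\<Phi> \<eta>))\<^sup>2) * ?K \<xi> \<eta>"
      by (rule mult_right_mono) simp
    then have "cmod (\<Phi> \<xi>) * cmod (\<Phi> \<eta>) * ?K \<xi> \<eta> \<le> (cmod (\<Phi> \<xi>))\<^sup>2 * ?K \<xi> \<eta> / 2 + (cmod (\<Phi> \<eta>))\<^sup>2 * ?K \<eta> \<xi> / 2"
      by (simp add: norm_minus_commute[of "p \<xi>"] algebra_simps)
    then show "ennreal (cmod (\<Phi> \<xi>) * cmod (\<Phi> \<eta>) * ?K \<xi> \<eta>) \<le> ?A \<xi> \<eta> + ?A \<eta> \<xi>"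
      by (subst ennreal_plus[symmetric]) (simp_all del: ennreal_plus)
  qed
  also have "\<dots> = (\<integral>\<^sup>+\<xi>. \<integral>\<^sup>+\<eta>. ?A \<xi> \<eta> \<partial>lborel \<partial>lborel) + (\<integral>\<^sup>+\<xi>. \<integral>\<^sup>+\<eta>. ?A \<eta> \<xi> \<partial>lborel \<partial>lborel)"
    by (simp add: nn_integral_add)
  also have "(\<integral>\<^sup>+\<xi>. \<integral>\<^sup>+\<eta>. ?A \<eta> \<xi> \<partial>lborel \<partial>lborel) = (\<integral>\<^sup>+\<xi>. \<integral>\<^sup>+\<eta>. ?A \<xi> \<eta> \<partial>lborel \<partial>lborel)"
    by (rule nn_swap, unfold borel_prod[symmetric]) measurable
  also have "(\<integral>\<^sup>+\<xi>. \<integral>\<^sup>+\<eta>. ?A \<xi> \<eta> \<partial>lborel \<partial>lborel) + (\<integral>\<^sup>+\<xi>. \<integral>\<^sup>+\<eta>. ?A \<xi> \<eta> \<partial>lborel \<partial>lborel) =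
     (\<integral>\<^sup>+\<xi>. \<integral>\<^sup>+\<eta>. ?A \<xi> \<eta> + ?A \<xi> \<eta> \<partial>lborel \<partial>lborel)"
    by (simp add: nn_integral_add)
  also have "\<dots> = (\<integral>\<^sup>+\<xi>. ennreal ((cmod (\<Phi> \<xi>))\<^sup>2) * (\<integral>\<^sup>+\<eta>. ennreal (?K \<xi> \<eta>) \<partial>lborel) \<partial>lborel)"
    by (intro nn_integral_cong, subst nn_integral_cmult[symmetric])
       (auto simp: ennreal_plus[symmetric] ennreal_mult[symmetric] simp del: ennreal_plus)
  finally show ?thesis
    using oscillatory_gaussian_bound[OF \<Phi> p] by (rule order_trans[rotated])
qed

lemma inv_fourier_measurable[measurable (raw)]:
  assumes [measurable]: "\<Phi> \<in> borel_measurable borel"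
  shows "inv_fourier \<Phi> \<in> borel_measurable borel"
  unfolding inv_fourier_def by measurable

text \<open>The half of Plancherel's theorem that the error estimates use. With p \<xi> = \<xi> / e
  in the Schur bound, the kernel has mass e^n, which cancels the Jacobian e^-n of the rescaling; the
  bound is thus independent of the cutoff, and e tends to 0.\<close>

lemma inv_fourier_bessel:
  fixes \<Phi> :: "'a::euclidean_space \<Rightarrow> complex"
  assumes \<Phi>: "integrable lborel \<Phi>"
  shows "(\<integral>\<^sup>+x. ennreal ((cmod (inv_fourier \<Phi> x))\<^sup>2) \<partial>lborel) \<le> (\<integral>\<^sup>+\<xi>. ennreal ((cmod (\<Phi> \<xi>))\<^sup>2) \<partial>lborel)"
proof -
  have \<Phi>m[measurable]: "\<Phi> \<in> borel_measurable borel" using \<Phi> by auto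
  let ?n = "DIM('a)"
  have bd: "(\<integral>\<^sup>+x. ennreal (exp (- (pi * e\<^sup>2 * (norm x)\<^sup>2)) * (cmod (inv_fourier \<Phi> x))\<^sup>2) \<partial>lborel)
     \<le> (\<integral>\<^sup>+\<xi>. ennreal ((cmod (\<Phi> \<xi>))\<^sup>2) \<partial>lborel)" if e: "e > 0" for e
  proof -
    have "(\<integral>\<^sup>+x. ennreal (exp (- (pi * e\<^sup>2 * (norm x)\<^sup>2)) * (cmod (inv_fourier \<Phi> x))\<^sup>2) \<partial>lborel) =
      ennreal ((1 / e) ^ ?n) * (\<integral>\<^sup>+x. ennreal (exp (- (pi * e\<^sup>2 * (norm ((1 / e) *\<^sub>R x))\<^sup>2)) * (cmod (inv_fourier \<Phi> ((1 / e) *\<^sub>R x)))\<^sup>2) \<partial>lborel)"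
      using e by (subst nn_integral_lborel_scale[where c = "1 / e"]) (auto simp: ennreal_power)
    also have "(\<integral>\<^sup>+x. ennreal (exp (- (pi * e\<^sup>2 * (norm ((1 / e) *\<^sub>R x))\<^sup>2)) * (cmod (inv_fourier \<Phi> ((1 / e) *\<^sub>R x)))\<^sup>2) \<partial>lborel) =
      (\<integral>\<^sup>+y. ennreal (exp (- (pi * (norm y)\<^sup>2)) * (cmod (LINT \<xi>|lborel. cis (2 * pi * (y \<bullet> ((1 / e) *\<^sub>R \<xi>))) * \<Phi> \<xi>))\<^sup>2) \<partial>lborel)"
      using e by (intro nn_integral_cong) (simp add: inv_fourier_def power_divide)
    also have "\<dots> \<le> (\<integral>\<^sup>+\<xi>. ennreal ((cmod (\<Phi> \<xi>))\<^sup>2) * (\<integral>\<^sup>+\<eta>. ennreal (exp (- (pi * (norm ((1 / e) *\<^sub>R \<xi> - (1 / e) *\<^sub>R \<eta>))\<^sup>2))) \<partial>lborel) \<partial>lborel)"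
      by (rule oscillatory_schur_bound[OF \<Phi>]) simp
    also have "\<dots> = (\<integral>\<^sup>+\<xi>. ennreal ((cmod (\<Phi> \<xi>))\<^sup>2) * ennreal (e ^ ?n) \<partial>lborel)"
    proof (intro nn_integral_cong arg_cong2[where f = "(*)"] refl)
      fix \<xi> :: 'a
      have "(norm ((1 / e) *\<^sub>R \<xi> - (1 / e) *\<^sub>R \<eta>))\<^sup>2 = (1 / e\<^sup>2) * (norm (\<eta> - \<xi>))\<^sup>2" for \<eta>
        using e unfolding scaleR_diff_right[symmetric] by (simp add: norm_minus_commute power_divide)
      then show "(\<integral>\<^sup>+\<eta>. ennreal (exp (- (pi * (norm ((1 / e) *\<^sub>R \<xi> - (1 / e) *\<^sub>R \<eta>))\<^sup>2))) \<partial>lborel) = ennreal (e ^ ?n)"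
        using nn_integral_gaussian[of "1 / e\<^sup>2" \<xi>] e by (simp add: real_sqrt_divide mult.assoc)
    qed
    also have "\<dots> = ennreal (e ^ ?n) * (\<integral>\<^sup>+\<xi>. ennreal ((cmod (\<Phi> \<xi>))\<^sup>2) \<partial>lborel)"
      by (subst nn_integral_cmult[symmetric]) (auto simp: mult.commute)
    finally have "(\<integral>\<^sup>+x. ennreal (exp (- (pi * e\<^sup>2 * (norm x)\<^sup>2)) * (cmod (inv_fourier \<Phi> x))\<^sup>2) \<partial>lborel)
      \<le> ennreal ((1 / e) ^ ?n) * (ennreal (e ^ ?n) * (\<integral>\<^sup>+\<xi>. ennreal ((cmod (\<Phi> \<xi>))\<^sup>2) \<partial>lborel))"
      by (simp add: mult_left_mono)
    also have "\<dots> = (\<integral>\<^sup>+\<xi>. ennreal ((cmod (\<Phi> \<xi>))\<^sup>2) \<partial>lborel)"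
      using e by (simp add: mult.assoc[symmetric] ennreal_mult[symmetric] power_mult_distrib[symmetric])
    finally show ?thesis .
  qed
  show ?thesis
  proof (rule nn_integral_le_of_tendsto)
    show "(\<integral>\<^sup>+x. ennreal (exp (- (pi * (1 / Suc k)\<^sup>2 * (norm x)\<^sup>2)) * (cmod (inv_fourier \<Phi> x))\<^sup>2) \<partial>lborel)
       \<le> (\<integral>\<^sup>+\<xi>. ennreal ((cmod (\<Phi> \<xi>))\<^sup>2) \<partial>lborel)" for k :: nat
      by (rule bd) simp
    fix x :: 'a
    have "(\<lambda>k. ennreal (exp (- (pi * (1 / Suc k)\<^sup>2 * (norm x)\<^sup>2)) * (cmod (inv_fourier \<Phi> x))\<^sup>2))
       \<longlonglongrightarrow> ennreal (exp (- (pi * 0\<^sup>2 * (norm x)\<^sup>2)) * (cmod (inv_fourier \<Phi> x))\<^sup>2)"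
      by (intro tendsto_intros tendsto_ennrealI LIMSEQ_Suc lim_1_over_n)
    then show "(\<lambda>k. ennreal (exp (- (pi * (1 / Suc k)\<^sup>2 * (norm x)\<^sup>2)) * (cmod (inv_fourier \<Phi> x))\<^sup>2))
       \<longlonglongrightarrow> ennreal ((cmod (inv_fourier \<Phi> x))\<^sup>2)" by simp
  qed measurable
qed

section \<open>Local smoothing\<close>

text \<open>Here \<Phi> is the Fourier transform of the datum, not the datum. The integral converges
  absolutely for integrable \<Phi>, the only case in which it is used as a wave.\<close>

definition free_wave :: "('a::euclidean_space \<Rightarrow> complex) \<Rightarrow> real \<Rightarrow> 'a \<Rightarrow> complex" where
  "free_wave \<Phi> t x = (LINT \<xi>|lborel. cis (2 * pi * (x \<bullet> \<xi>) - 4 * pi\<^sup>2 * t * (norm \<xi>)\<^sup>2) * \<Phi> \<xi>)"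

lemma free_wave_measurable:
  assumes [measurable]: "\<Phi> \<in> borel_measurable borel"
  shows "(\<lambda>(t, x). free_wave \<Phi> t x) \<in> borel_measurable borel"
  unfolding free_wave_def borel_prod[symmetric] by measurable

lemma free_wave_measurable'[measurable (raw)]:
  assumes "\<Phi> \<in> borel_measurable borel" and [measurable]: "f \<in> borel_measurable M" "g \<in> borel_measurable M"
  shows "(\<lambda>y. free_wave \<Phi> (f y) (g y)) \<in> borel_measurable M"
proof -
  have [measurable]: "(\<lambda>(t, x). free_wave \<Phi> t x) \<in> borel_measurable (borel \<Otimes>\<^sub>M borel)"
    using free_wave_measurable[OF assms(1)] by (simp add: borel_prod)
  have "(\<lambda>y. (\<lambda>(t, x). free_wave \<Phi> t x) (f y, g y)) \<in> borel_measurable M"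
    by measurable
  then show ?thesis by simp
qed

text \<open>On the cone where the coordinate \<open>s\<close> carries its share of the norm, the sphere of
  radius \<open>r\<close> is transversal to the direction of \<open>s\<close>.\<close>

lemma sphere_transversality:
  fixes r m n s :: real
  assumes n: "n \<ge> 1" and r: "r > 0" and cone: "n * s\<^sup>2 \<ge> m\<^sup>2 + s\<^sup>2"
  defines "a \<equiv> sqrt (max 0 (r\<^sup>2 - m\<^sup>2))"
  shows "(r\<^sup>2 / n) * (\<bar>s\<bar> - a)\<^sup>2 \<le> (r\<^sup>2 - (m\<^sup>2 + s\<^sup>2))\<^sup>2"
proof (cases "r\<^sup>2 \<ge> m\<^sup>2")
  \<comment> \<open>The line at distance |m| from the origin meets the sphere at s = a and s = -a,
    and r^2 - (m^2 + s^2) = (a - |s|) (a + |s|). The cone condition bounds the second factor below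
    by r / sqrt n.\<close>
  case True
  then have a2: "a\<^sup>2 = r\<^sup>2 - m\<^sup>2" and a0: "a \<ge> 0" by (auto simp: a_def)
  have "r\<^sup>2 \<le> a\<^sup>2 + n * s\<^sup>2" using a2 cone by (simp add: power2_eq_square) (smt (verit) zero_le_square)
  also have "\<dots> \<le> n * a\<^sup>2 + n * s\<^sup>2" using n by (simp add: mult_left_le_imp_le mult_le_cancel_right1)
  also have "\<dots> \<le> n * (\<bar>s\<bar> + a)\<^sup>2"
    using n a0 by (simp add: power2_sum algebra_simps)
  finally have "r\<^sup>2 / n \<le> (\<bar>s\<bar> + a)\<^sup>2" using n by (simp add: field_simps)
  then have "(r\<^sup>2 / n) * (\<bar>s\<bar> - a)\<^sup>2 \<le> (\<bar>s\<bar> + a)\<^sup>2 * (\<bar>s\<bar> - a)\<^sup>2"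
    by (rule mult_right_mono) simp
  also have "\<dots> = (a\<^sup>2 - s\<^sup>2)\<^sup>2"
    by (simp add: power_mult_distrib[symmetric] algebra_simps power2_eq_square[of "\<bar>s\<bar>"] power2_eq_square[of a] power2_eq_square[of s])
       (simp add: power2_eq_square algebra_simps)
  finally show ?thesis using a2 by (simp add: algebra_simps)
next
  \<comment> \<open>The line misses the sphere. Then the cone condition alone gives r^2 <= n s^2,
    and the defect is at least s^2.\<close>
  case False
  then have a: "a = 0" by (simp add: a_def)
  have 1: "r\<^sup>2 \<le> n * s\<^sup>2" using False cone by (smt (verit) zero_le_power2)
  have "(r\<^sup>2 / n) * s\<^sup>2 \<le> s\<^sup>2 * s\<^sup>2"
    using 1 n by (intro mult_right_mono) (auto simp: field_simps)
  also have "\<dots> = (s\<^sup>2)\<^sup>2" by (simp add: power2_eq_square)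
  also have "\<dots> \<le> ((m\<^sup>2 - r\<^sup>2) + s\<^sup>2)\<^sup>2"
    using False by (intro power_mono) auto
  also have "\<dots> = (r\<^sup>2 - (m\<^sup>2 + s\<^sup>2))\<^sup>2"
    by (simp add: power2_eq_square algebra_simps)
  finally show ?thesis by (simp add: a)
qed

text \<open>By transversality the exponent dominates c (|s| - a)^2 on the cone, so the integrand
  lies below two Gaussians, one for each intersection with the sphere. Each has mass 1 / sqrt c,
  half of the stated bound.\<close>

lemma transversal_line_integral:
  fixes \<eta> b :: "'a::euclidean_space"
  assumes b: "b \<in> Basis" and r: "r > 0" and d: "d > 0"
  defines "n \<equiv> real DIM('a)"
  shows "(\<integral>\<^sup>+s. ennreal (of_bool (n * ((\<eta> + s *\<^sub>R b) \<bullet> b)\<^sup>2 \<ge> (norm (\<eta> + s *\<^sub>R b))\<^sup>2) *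
            exp (- (pi * (2 * pi * (r\<^sup>2 - (norm (\<eta> + s *\<^sub>R b))\<^sup>2) / d)\<^sup>2))) \<partial>lborel)
      \<le> ennreal (sqrt n * d / (pi * r))"
proof -
  have n: "n \<ge> 1" by (simp add: n_def DIM_positive Suc_leI)
  define h m where "h = \<eta> \<bullet> b" and "m = sqrt ((norm \<eta>)\<^sup>2 - h\<^sup>2)"
  have "h\<^sup>2 \<le> (norm \<eta>)\<^sup>2"
    using Cauchy_Schwarz_ineq2[of \<eta> b] b by (simp add: h_def abs_le_square_iff[symmetric])
  then have m2: "m\<^sup>2 = (norm \<eta>)\<^sup>2 - h\<^sup>2" by (simp add: m_def)
  have nrm: "(norm (\<eta> + s *\<^sub>R b))\<^sup>2 = m\<^sup>2 + (s + h)\<^sup>2" for s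
    unfolding m2 power2_norm_eq_inner using b
    by (simp add: inner_add_left inner_add_right h_def inner_commute power2_eq_square algebra_simps)
  have dot: "(\<eta> + s *\<^sub>R b) \<bullet> b = s + h" for s
    using b by (simp add: inner_add_left h_def)
  define a c where "a = sqrt (max 0 (r\<^sup>2 - m\<^sup>2))" and "c = 4 * pi\<^sup>2 * (r\<^sup>2 / n) / d\<^sup>2"
  have c: "c > 0" using r d n by (simp add: c_def)
  have pt: "of_bool (n * s\<^sup>2 \<ge> m\<^sup>2 + s\<^sup>2) * exp (- (pi * (2 * pi * (r\<^sup>2 - (m\<^sup>2 + s\<^sup>2)) / d)\<^sup>2))
      \<le> exp (- (pi * c * (s - a)\<^sup>2)) + exp (- (pi * c * (s - (- a))\<^sup>2))" for s
  proof (cases "n * s\<^sup>2 \<ge> m\<^sup>2 + s\<^sup>2")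
    case True
    have "c * (\<bar>s\<bar> - a)\<^sup>2 = (4 * pi\<^sup>2 / d\<^sup>2) * ((r\<^sup>2 / n) * (\<bar>s\<bar> - a)\<^sup>2)"
      by (simp add: c_def mult_ac)
    also have "\<dots> \<le> (4 * pi\<^sup>2 / d\<^sup>2) * (r\<^sup>2 - (m\<^sup>2 + s\<^sup>2))\<^sup>2"
      using sphere_transversality[OF n r True] by (intro mult_left_mono) (auto simp: a_def)
    also have "\<dots> = (2 * pi * (r\<^sup>2 - (m\<^sup>2 + s\<^sup>2)) / d)\<^sup>2"
      by (simp add: power_mult_distrib power_divide)
    finally have "pi * (c * (\<bar>s\<bar> - a)\<^sup>2) \<le> pi * (2 * pi * (r\<^sup>2 - (m\<^sup>2 + s\<^sup>2)) / d)\<^sup>2"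
      by (rule mult_left_mono) simp
    then have *: "exp (- (pi * (2 * pi * (r\<^sup>2 - (m\<^sup>2 + s\<^sup>2)) / d)\<^sup>2)) \<le> exp (- (pi * c * (\<bar>s\<bar> - a)\<^sup>2))"
      by (simp add: mult.assoc)
    have "exp (- (pi * c * (\<bar>s\<bar> - a)\<^sup>2)) \<le> exp (- (pi * c * (s - a)\<^sup>2)) + exp (- (pi * c * (s - (- a))\<^sup>2))"
    proof (cases "s \<ge> 0")
      case False
      then have "(\<bar>s\<bar> - a)\<^sup>2 = (s - (- a))\<^sup>2" by (simp add: power2_eq_square algebra_simps)
      then show ?thesis by simp
    qed simp
    from order_trans[OF * this] show ?thesis using True by simp
  qed simp
  have "(\<integral>\<^sup>+s. ennreal (of_bool (n * ((\<eta> + s *\<^sub>R b) \<bullet> b)\<^sup>2 \<ge> (norm (\<eta> + s *\<^sub>R b))\<^sup>2) *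
            exp (- (pi * (2 * pi * (r\<^sup>2 - (norm (\<eta> + s *\<^sub>R b))\<^sup>2) / d)\<^sup>2))) \<partial>lborel) =
      (\<integral>\<^sup>+s. ennreal (of_bool (n * (s + h)\<^sup>2 \<ge> m\<^sup>2 + (s + h)\<^sup>2) *
            exp (- (pi * (2 * pi * (r\<^sup>2 - (m\<^sup>2 + (s + h)\<^sup>2)) / d)\<^sup>2))) \<partial>lborel)"
    unfolding nrm dot ..
  also have "\<dots> = (\<integral>\<^sup>+s. ennreal (of_bool (n * s\<^sup>2 \<ge> m\<^sup>2 + s\<^sup>2) *
            exp (- (pi * (2 * pi * (r\<^sup>2 - (m\<^sup>2 + s\<^sup>2)) / d)\<^sup>2))) \<partial>lborel)"
    by (rule nn_integral_lborel_shift[symmetric]) measurable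
  also have "\<dots> \<le> (\<integral>\<^sup>+s. ennreal (exp (- (pi * c * (s - a)\<^sup>2))) + ennreal (exp (- (pi * c * (s - (- a))\<^sup>2))) \<partial>lborel)"
    by (intro nn_integral_mono) (use pt in \<open>auto simp del: ennreal_plus simp: ennreal_plus[symmetric] intro!: ennreal_leI\<close>)
  also have "\<dots> = ennreal (1 / sqrt c) + ennreal (1 / sqrt c)"
    using c by (subst nn_integral_add) (auto simp only: nn_integral_gaussian_real, measurable)
  also have "\<dots> = ennreal (2 / sqrt c)"
    using c by (subst ennreal_plus[symmetric]) auto
  also have "2 / sqrt c = sqrt n * d / (pi * r)"
    using r d n by (simp add: c_def real_sqrt_divide real_sqrt_mult)
  finally show ?thesis .
qed

text \<open>The thickened sphere is integrated by averaging over translations in the direction \<open>b\<close>;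
  this replaces the surface measure.\<close>

lemma sphere_kernel_cone:
  fixes \<xi> b :: "'a::euclidean_space"
  assumes b: "b \<in> Basis" and r: "r > 0" and d: "d > 0" and e: "e > 0"
  defines "n \<equiv> real DIM('a)"
  shows "(\<integral>\<^sup>+\<eta>. ennreal (of_bool (n * (\<eta> \<bullet> b)\<^sup>2 \<ge> (norm \<eta>)\<^sup>2) *
            exp (- (pi * (2 * pi * (r\<^sup>2 - (norm \<eta>)\<^sup>2) / d)\<^sup>2)) * exp (- (pi * (norm (\<xi> - \<eta>) / e)\<^sup>2))) \<partial>lborel)
      \<le> ennreal (sqrt n * sqrt 2 ^ DIM('a) / pi * (d * e ^ DIM('a) / (e * r)))"
proof -
  let ?q = "\<lambda>\<eta>::'a. of_bool (n * (\<eta> \<bullet> b)\<^sup>2 \<ge> (norm \<eta>)\<^sup>2) * exp (- (pi * (2 * pi * (r\<^sup>2 - (norm \<eta>)\<^sup>2) / d)\<^sup>2))"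
  let ?g = "\<lambda>\<eta>. exp (- (pi * (norm (\<xi> - \<eta>) / e)\<^sup>2))"
  \<comment> \<open>A probability density on the line at the scale e of the spatial Gaussian.
    Inserting it averages the integral over translations by s b without changing its value.\<close>
  let ?\<rho> = "\<lambda>s::real. exp (- (pi * (s / e)\<^sup>2)) / e"
  have q0: "?q \<eta> \<ge> 0" for \<eta> by simp
  have \<rho>1: "(\<integral>\<^sup>+s. ennreal (?\<rho> s) \<partial>lborel) = 1"
  proof -
    have "(\<integral>\<^sup>+s. ennreal (?\<rho> s) \<partial>lborel) = (\<integral>\<^sup>+s. ennreal (1 / e) * ennreal (exp (- (pi * (1 / e\<^sup>2) * (s - 0)\<^sup>2))) \<partial>lborel)"
      using e by (intro nn_integral_cong) (simp add: ennreal_mult[symmetric] power_divide)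
    also have "\<dots> = ennreal (1 / e) * ennreal (1 / sqrt (1 / e\<^sup>2))"
      using e by (subst nn_integral_cmult) (simp_all only: nn_integral_gaussian_real zero_less_divide_1_iff zero_less_power, measurable)
    also have "\<dots> = 1"
      using e by (simp add: ennreal_mult[symmetric] real_sqrt_divide)
    finally show ?thesis .
  qed
  \<comment> \<open>By |\<eta> - \<xi>|^2 <= 2 |\<xi> - (\<eta> + s b)|^2 + 2 s^2, the two Gaussians
    lie below a single one, wider by the factor sqrt 2 and independent of s. The s-integral then
    contains only the thickened sphere.\<close>
  have pt: "?\<rho> s * ?g (\<eta> + s *\<^sub>R b) \<le> exp (- (pi * (1 / (2 * e\<^sup>2)) * (norm (\<eta> - \<xi>))\<^sup>2)) / e" for s \<eta>
  proof -
    have "norm (\<eta> - \<xi>) \<le> norm (\<xi> - (\<eta> + s *\<^sub>R b)) + \<bar>s\<bar>"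
      using norm_triangle_ineq4[of "\<xi> - (\<eta> + s *\<^sub>R b)" "- (s *\<^sub>R b)"] b by (simp add: norm_minus_commute)
    then have "(norm (\<eta> - \<xi>))\<^sup>2 \<le> (norm (\<xi> - (\<eta> + s *\<^sub>R b)) + \<bar>s\<bar>)\<^sup>2"
      by (intro power_mono) auto
    also have "\<dots> \<le> 2 * (norm (\<xi> - (\<eta> + s *\<^sub>R b)))\<^sup>2 + 2 * s\<^sup>2"
      using sum_squares_bound[of "norm (\<xi> - (\<eta> + s *\<^sub>R b))" "\<bar>s\<bar>"] by (simp add: power2_sum)
    finally have "(norm (\<eta> - \<xi>))\<^sup>2 / (2 * e\<^sup>2) \<le> (2 * (norm (\<xi> - (\<eta> + s *\<^sub>R b)))\<^sup>2 + 2 * s\<^sup>2) / (2 * e\<^sup>2)"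
      using e by (intro divide_right_mono) auto
    also have "\<dots> = (s / e)\<^sup>2 + (norm (\<xi> - (\<eta> + s *\<^sub>R b)) / e)\<^sup>2"
      using e by (simp add: power_divide field_simps)
    finally have "pi * ((norm (\<eta> - \<xi>))\<^sup>2 / (2 * e\<^sup>2)) \<le> pi * ((s / e)\<^sup>2 + (norm (\<xi> - (\<eta> + s *\<^sub>R b)) / e)\<^sup>2)"
      by (rule mult_left_mono) simp
    then have "exp (- (pi * (s / e)\<^sup>2)) * ?g (\<eta> + s *\<^sub>R b) \<le> exp (- (pi * (1 / (2 * e\<^sup>2)) * (norm (\<eta> - \<xi>))\<^sup>2))"
      unfolding exp_add[symmetric] by (simp add: algebra_simps)
    then show ?thesis using e by (simp add: divide_right_mono)
  qed
  have "(\<integral>\<^sup>+\<eta>. ennreal (?q \<eta> * ?g \<eta>) \<partial>lborel) = (\<integral>\<^sup>+s. ennreal (?\<rho> s) * (\<integral>\<^sup>+\<eta>. ennreal (?q \<eta> * ?g \<eta>) \<partial>lborel) \<partial>lborel)"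
    by (subst nn_integral_multc) (simp_all only: \<rho>1 mult_1, measurable)
  also have "\<dots> = (\<integral>\<^sup>+s. \<integral>\<^sup>+\<eta>. ennreal (?\<rho> s * (?q (\<eta> + s *\<^sub>R b) * ?g (\<eta> + s *\<^sub>R b))) \<partial>lborel \<partial>lborel)"
  proof (intro nn_integral_cong)
    fix s
    have "(\<integral>\<^sup>+\<eta>. ennreal (?q \<eta> * ?g \<eta>) \<partial>lborel) = (\<integral>\<^sup>+\<eta>. ennreal (?q (\<eta> + s *\<^sub>R b) * ?g (\<eta> + s *\<^sub>R b)) \<partial>lborel)"
      by (rule nn_integral_lborel_shift) measurable
    then show "ennreal (?\<rho> s) * (\<integral>\<^sup>+\<eta>. ennreal (?q \<eta> * ?g \<eta>) \<partial>lborel) =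
       (\<integral>\<^sup>+\<eta>. ennreal (?\<rho> s * (?q (\<eta> + s *\<^sub>R b) * ?g (\<eta> + s *\<^sub>R b))) \<partial>lborel)"
      using e by (simp only:, subst nn_integral_cmult[symmetric]) (measurable, simp add: ennreal_mult[symmetric])
  qed
  also have "\<dots> = (\<integral>\<^sup>+\<eta>. \<integral>\<^sup>+s. ennreal (?\<rho> s * (?q (\<eta> + s *\<^sub>R b) * ?g (\<eta> + s *\<^sub>R b))) \<partial>lborel \<partial>lborel)"
    by (rule nn_swap, unfold borel_prod[symmetric]) measurable
  also have "\<dots> \<le> (\<integral>\<^sup>+\<eta>. \<integral>\<^sup>+s. ennreal (exp (- (pi * (1 / (2 * e\<^sup>2)) * (norm (\<eta> - \<xi>))\<^sup>2)) / e) * ennreal (?q (\<eta> + s *\<^sub>R b)) \<partial>lborel \<partial>lborel)"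
  proof (intro nn_integral_mono)
    fix \<eta> s
    have "?\<rho> s * (?q (\<eta> + s *\<^sub>R b) * ?g (\<eta> + s *\<^sub>R b)) = (?\<rho> s * ?g (\<eta> + s *\<^sub>R b)) * ?q (\<eta> + s *\<^sub>R b)"
      by (simp only: mult_ac)
    also have "\<dots> \<le> (exp (- (pi * (1 / (2 * e\<^sup>2)) * (norm (\<eta> - \<xi>))\<^sup>2)) / e) * ?q (\<eta> + s *\<^sub>R b)"
      by (intro mult_right_mono pt q0)
    finally show "ennreal (?\<rho> s * (?q (\<eta> + s *\<^sub>R b) * ?g (\<eta> + s *\<^sub>R b))) \<le>
       ennreal (exp (- (pi * (1 / (2 * e\<^sup>2)) * (norm (\<eta> - \<xi>))\<^sup>2)) / e) * ennreal (?q (\<eta> + s *\<^sub>R b))"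
      using e q0 by (subst ennreal_mult[symmetric]) (auto intro!: ennreal_leI)
  qed
  also have "\<dots> = (\<integral>\<^sup>+\<eta>. ennreal (exp (- (pi * (1 / (2 * e\<^sup>2)) * (norm (\<eta> - \<xi>))\<^sup>2)) / e) * (\<integral>\<^sup>+s. ennreal (?q (\<eta> + s *\<^sub>R b)) \<partial>lborel) \<partial>lborel)"
    by (intro nn_integral_cong nn_integral_cmult) measurable
  also have "\<dots> \<le> (\<integral>\<^sup>+\<eta>. ennreal (exp (- (pi * (1 / (2 * e\<^sup>2)) * (norm (\<eta> - \<xi>))\<^sup>2)) / e) * ennreal (sqrt n * d / (pi * r)) \<partial>lborel)"
    using transversal_line_integral[OF b r d] by (intro nn_integral_mono mult_left_mono) (auto simp: n_def)
  also have "\<dots> = (\<integral>\<^sup>+\<eta>. ennreal (sqrt n * d / (pi * r) / e) * ennreal (exp (- (pi * (1 / (2 * e\<^sup>2)) * (norm (\<eta> - \<xi>))\<^sup>2))) \<partial>lborel)"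
    using e r d by (intro nn_integral_cong) (simp add: ennreal_mult[symmetric] n_def mult_ac)
  also have "\<dots> = ennreal (sqrt n * d / (pi * r) / e) * ennreal ((1 / sqrt (1 / (2 * e\<^sup>2))) ^ DIM('a))"
    using e by (subst nn_integral_cmult) (measurable, subst nn_integral_gaussian, auto)
  also have "\<dots> = ennreal (sqrt n * sqrt 2 ^ DIM('a) / pi * (d * e ^ DIM('a) / (e * r)))"
    using e r d by (simp add: ennreal_mult[symmetric] n_def real_sqrt_divide real_sqrt_mult power_mult_distrib mult_ac)
  finally show ?thesis by (simp only: mult.assoc)
qed

text \<open>The factor n counts the cones, sqrt n / pi comes from the integral over a transversal
  line, and sqrt 2 ^ n from the widened spatial Gaussian.\<close>

definition smoothing_const :: "nat \<Rightarrow> real" where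
  "smoothing_const n = real n * sqrt (real n) * sqrt 2 ^ n / pi"

lemma smoothing_const_nonneg: "smoothing_const n \<ge> 0"
  by (simp add: smoothing_const_def)

text \<open>The cones around the coordinate axes cover the space, because the largest squared
  coordinate is at least the average |\<eta>|^2 / n. The estimate on one cone is summed over the
  axes.\<close>

lemma sphere_kernel_bound:
  fixes \<xi> :: "'a::euclidean_space"
  assumes \<xi>: "\<xi> \<noteq> 0" and d: "d > 0" and e: "e > 0"
  shows "(\<integral>\<^sup>+\<eta>. ennreal (exp (- (pi * (2 * pi * ((norm \<xi>)\<^sup>2 - (norm \<eta>)\<^sup>2) / d)\<^sup>2)) * exp (- (pi * (norm (\<xi> - \<eta>) / e)\<^sup>2))) \<partial>lborel)
      \<le> ennreal (smoothing_const DIM('a) * (d * e ^ DIM('a) / (e * norm \<xi>)))"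
proof -
  let ?n = "real DIM('a)"
  let ?k = "\<lambda>\<eta>. exp (- (pi * (2 * pi * ((norm \<xi>)\<^sup>2 - (norm \<eta>)\<^sup>2) / d)\<^sup>2)) * exp (- (pi * (norm (\<xi> - \<eta>) / e)\<^sup>2))"
  have cover: "1 \<le> (\<Sum>b\<in>Basis. of_bool (?n * (\<eta> \<bullet> b)\<^sup>2 \<ge> (norm \<eta>)\<^sup>2) :: real)" for \<eta> :: 'a
  proof -
    have "\<exists>b\<in>Basis. ?n * (\<eta> \<bullet> b)\<^sup>2 \<ge> (norm \<eta>)\<^sup>2"
    proof (rule ccontr)
      assume "\<not> ?thesis"
      then have "(\<Sum>b\<in>Basis. ?n * (\<eta> \<bullet> b)\<^sup>2) < (\<Sum>b\<in>(Basis::'a set). (norm \<eta>)\<^sup>2)"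
        by (intro sum_strict_mono) auto
      then show False by (simp add: sum_distrib_left[symmetric] norm_square_Basis[symmetric])
    qed
    then obtain b where b: "b \<in> Basis" "?n * (\<eta> \<bullet> b)\<^sup>2 \<ge> (norm \<eta>)\<^sup>2" by blast
    have "(of_bool (?n * (\<eta> \<bullet> b)\<^sup>2 \<ge> (norm \<eta>)\<^sup>2) :: real) \<le> (\<Sum>b\<in>Basis. of_bool (?n * (\<eta> \<bullet> b)\<^sup>2 \<ge> (norm \<eta>)\<^sup>2))"
      by (rule member_le_sum) (use b in auto)
    then show ?thesis using b by simp
  qed
  have "(\<integral>\<^sup>+\<eta>. ennreal (?k \<eta>) \<partial>lborel) \<le>
     (\<integral>\<^sup>+\<eta>. (\<Sum>b\<in>Basis. ennreal (of_bool (?n * (\<eta> \<bullet> b)\<^sup>2 \<ge> (norm \<eta>)\<^sup>2) * ?k \<eta>)) \<partial>lborel)"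
  proof (intro nn_integral_mono)
    fix \<eta> :: 'a
    have "1 * ?k \<eta> \<le> (\<Sum>b\<in>Basis. of_bool (?n * (\<eta> \<bullet> b)\<^sup>2 \<ge> (norm \<eta>)\<^sup>2)) * ?k \<eta>"
      by (intro mult_right_mono cover) simp
    then show "ennreal (?k \<eta>) \<le> (\<Sum>b\<in>Basis. ennreal (of_bool (?n * (\<eta> \<bullet> b)\<^sup>2 \<ge> (norm \<eta>)\<^sup>2) * ?k \<eta>))"
      by (subst sum_ennreal) (simp_all only: mult_1 sum_distrib_right, auto intro!: ennreal_leI)
  qed
  also have "\<dots> = (\<Sum>b\<in>Basis. \<integral>\<^sup>+\<eta>. ennreal (of_bool (?n * (\<eta> \<bullet> b)\<^sup>2 \<ge> (norm \<eta>)\<^sup>2) * ?k \<eta>) \<partial>lborel)"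
    by (rule nn_integral_sum) measurable
  also have "\<dots> \<le> (\<Sum>b\<in>(Basis::'a set). ennreal (sqrt ?n * sqrt 2 ^ DIM('a) / pi * (d * e ^ DIM('a) / (e * norm \<xi>))))"
    using sphere_kernel_cone[OF _ _ d e, of _ "norm \<xi>" \<xi>] \<xi> by (intro sum_mono) (simp add: mult.assoc)
  also have "\<dots> = ennreal (smoothing_const DIM('a) * (d * e ^ DIM('a) / (e * norm \<xi>)))"
    using d e by (simp add: smoothing_const_def ennreal_of_nat_eq_real_of_nat ennreal_mult[symmetric] mult_ac)
  finally show ?thesis .
qed


section \<open>Space-time estimates for waves\<close>

lemma nn_integral_lborel_pair:
  fixes f :: "'a::euclidean_space \<times> 'b::euclidean_space \<Rightarrow> ennreal"
  assumes "f \<in> borel_measurable borel"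
  shows "(\<integral>\<^sup>+y. f y \<partial>lborel) = (\<integral>\<^sup>+s. \<integral>\<^sup>+x. f (s, x) \<partial>lborel \<partial>lborel)"
  using lborel.nn_integral_fst[of f lborel] assms by (simp add: lborel_prod)

text \<open>The Schur bound in space-time. Its kernel forces |\<xi>| and |\<eta>| to be close at
  scale d and \<xi> and \<eta> at scale e; the transversality of the sphere is what yields the gain
  1 / |\<xi>|.\<close>

lemma free_wave_weighted_smoothing:
  fixes \<Phi> :: "'a::euclidean_space \<Rightarrow> complex"
  assumes \<Phi>: "integrable lborel \<Phi>" and d: "d > 0" and e: "e > 0"
  shows "(\<integral>\<^sup>+t. \<integral>\<^sup>+x. ennreal (exp (- (pi * ((d * t)\<^sup>2 + (e * norm x)\<^sup>2))) * (cmod (free_wave \<Phi> t x))\<^sup>2) \<partial>lborel \<partial>lborel)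
    \<le> ennreal (smoothing_const DIM('a) / e) * (\<integral>\<^sup>+\<xi>. ennreal ((cmod (\<Phi> \<xi>))\<^sup>2 / norm \<xi>) \<partial>lborel)"
proof -
  have [measurable]: "\<Phi> \<in> borel_measurable borel" using \<Phi> by auto
  let ?n = "DIM('a)" and ?C = "smoothing_const DIM('a)"
  \<comment> \<open>In the rescaled variables t = s / d and x = y / e, the phase 2 pi (s, y) . p
    \<xi> is exactly that of the wave: 2 pi s * (-2 pi |\<xi>|^2 / d) = -4 pi^2 t |\<xi>|^2.\<close>
  define p :: "'a \<Rightarrow> real \<times> 'a" where "p \<xi> = (- (2 * pi * (norm \<xi>)\<^sup>2 / d), (1 / e) *\<^sub>R \<xi>)" for \<xi>
  have pm: "p \<in> borel_measurable borel"
    unfolding p_def borel_prod[symmetric] by measurable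
  have osc: "(LINT \<xi>|lborel. cis (2 * pi * ((s, x) \<bullet> p \<xi>)) * \<Phi> \<xi>) = free_wave \<Phi> (s / d) ((1 / e) *\<^sub>R x)" for s x
    unfolding free_wave_def p_def
    by (intro Bochner_Integration.integral_cong refl) (simp add: algebra_simps power2_eq_square)
  have nrm: "(norm (s, x))\<^sup>2 = s\<^sup>2 + (norm x)\<^sup>2" for s :: real and x :: 'a
    by (simp add: norm_Pair)
  have K: "exp (- (pi * (norm (p \<xi> - p \<eta>))\<^sup>2)) =
     exp (- (pi * (2 * pi * ((norm \<xi>)\<^sup>2 - (norm \<eta>)\<^sup>2) / d)\<^sup>2)) * exp (- (pi * (norm (\<xi> - \<eta>) / e)\<^sup>2))" for \<xi> \<eta>
  proof -
    have 1: "- (2 * pi * (norm \<xi>)\<^sup>2 / d) - - (2 * pi * (norm \<eta>)\<^sup>2 / d) = - (2 * pi * ((norm \<xi>)\<^sup>2 - (norm \<eta>)\<^sup>2) / d)"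
      by (simp add: algebra_simps diff_divide_distrib)
    have 2: "norm ((1 / e) *\<^sub>R \<xi> - (1 / e) *\<^sub>R \<eta>) = norm (\<xi> - \<eta>) / e"
      unfolding scaleR_diff_right[symmetric] using e by simp
    have "(norm (p \<xi> - p \<eta>))\<^sup>2 = (2 * pi * ((norm \<xi>)\<^sup>2 - (norm \<eta>)\<^sup>2) / d)\<^sup>2 + (norm (\<xi> - \<eta>) / e)\<^sup>2"
      unfolding p_def diff_Pair nrm 1 2 power2_minus ..
    then show ?thesis
      unfolding exp_add[symmetric] by (simp only: distrib_left minus_add_distrib)
  qed
  have sc: "(\<integral>\<^sup>+t. \<integral>\<^sup>+x. ennreal (exp (- (pi * ((d * t)\<^sup>2 + (e * norm x)\<^sup>2))) * (cmod (free_wave \<Phi> t x))\<^sup>2) \<partial>lborel \<partial>lborel)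
    = ennreal (1 / d) * (ennreal ((1 / e) ^ ?n) * (\<integral>\<^sup>+s. \<integral>\<^sup>+x. ennreal (exp (- (pi * (norm (s, x))\<^sup>2)) *
         (cmod (LINT \<xi>|lborel. cis (2 * pi * ((s, x) \<bullet> p \<xi>)) * \<Phi> \<xi>))\<^sup>2) \<partial>lborel \<partial>lborel))" (is "?L = _ * (_ * ?I)")
  proof -
    let ?h = "\<lambda>t x. ennreal (exp (- (pi * ((d * t)\<^sup>2 + (e * norm x)\<^sup>2))) * (cmod (free_wave \<Phi> t x))\<^sup>2)"
    have "?L = ennreal (1 / d) * (\<integral>\<^sup>+s. \<integral>\<^sup>+x. ?h (s / d) x \<partial>lborel \<partial>lborel)"
      using d by (subst nn_integral_lborel_scale[where c = "1 / d"]) auto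
    also have "(\<integral>\<^sup>+s. \<integral>\<^sup>+x. ?h (s / d) x \<partial>lborel \<partial>lborel) =
      (\<integral>\<^sup>+s. ennreal ((1 / e) ^ ?n) * (\<integral>\<^sup>+x. ?h (s / d) ((1 / e) *\<^sub>R x) \<partial>lborel) \<partial>lborel)"
      using e by (intro nn_integral_cong, subst nn_integral_lborel_scale[where c = "1 / e"]) auto
    also have "\<dots> = ennreal ((1 / e) ^ ?n) * (\<integral>\<^sup>+s. \<integral>\<^sup>+x. ?h (s / d) ((1 / e) *\<^sub>R x) \<partial>lborel \<partial>lborel)"
      by (rule nn_integral_cmult) measurable
    also have "(\<integral>\<^sup>+s. \<integral>\<^sup>+x. ?h (s / d) ((1 / e) *\<^sub>R x) \<partial>lborel \<partial>lborel) = ?I"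
      unfolding osc nrm using d e by (intro nn_integral_cong) simp
    finally show ?thesis .
  qed
  have "?I = (\<integral>\<^sup>+y. ennreal (exp (- (pi * (norm y)\<^sup>2)) * (cmod (LINT \<xi>|lborel. cis (2 * pi * (y \<bullet> p \<xi>)) * \<Phi> \<xi>))\<^sup>2) \<partial>lborel)"
    using pm by (subst nn_integral_lborel_pair) simp_all
  also have "\<dots> \<le> (\<integral>\<^sup>+\<xi>. ennreal ((cmod (\<Phi> \<xi>))\<^sup>2) * (\<integral>\<^sup>+\<eta>. ennreal (exp (- (pi * (norm (p \<xi> - p \<eta>))\<^sup>2))) \<partial>lborel) \<partial>lborel)"
    by (rule oscillatory_schur_bound[OF \<Phi> pm])
  also have "\<dots> \<le> (\<integral>\<^sup>+\<xi>. ennreal (?C * (d * e ^ ?n / e)) * ennreal ((cmod (\<Phi> \<xi>))\<^sup>2 / norm \<xi>) \<partial>lborel)"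
  \<comment> \<open>The frequency 0 must be discarded: there the right-hand side is 0 because
    division by zero is.\<close>
  proof (rule nn_integral_mono_AE, rule AE_mp[OF AE_lborel_singleton[of 0]], intro AE_I2 impI)
    fix \<xi> :: 'a assume \<xi>: "\<xi> \<noteq> 0"
    have "ennreal ((cmod (\<Phi> \<xi>))\<^sup>2) * (\<integral>\<^sup>+\<eta>. ennreal (exp (- (pi * (norm (p \<xi> - p \<eta>))\<^sup>2))) \<partial>lborel)
      \<le> ennreal ((cmod (\<Phi> \<xi>))\<^sup>2) * ennreal (?C * (d * e ^ ?n / (e * norm \<xi>)))"
      unfolding K by (intro mult_left_mono sphere_kernel_bound \<xi> d e) simp
    also have "\<dots> = ennreal (?C * (d * e ^ ?n / e)) * ennreal ((cmod (\<Phi> \<xi>))\<^sup>2 / norm \<xi>)"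
      using d e by (simp add: ennreal_mult[symmetric] smoothing_const_nonneg mult_ac)
    finally show "ennreal ((cmod (\<Phi> \<xi>))\<^sup>2) * (\<integral>\<^sup>+\<eta>. ennreal (exp (- (pi * (norm (p \<xi> - p \<eta>))\<^sup>2))) \<partial>lborel)
      \<le> ennreal (?C * (d * e ^ ?n / e)) * ennreal ((cmod (\<Phi> \<xi>))\<^sup>2 / norm \<xi>)" .
  qed
  also have "\<dots> = ennreal (?C * (d * e ^ ?n / e)) * (\<integral>\<^sup>+\<xi>. ennreal ((cmod (\<Phi> \<xi>))\<^sup>2 / norm \<xi>) \<partial>lborel)"
    by (rule nn_integral_cmult) measurable
  finally have I: "?I \<le> ennreal (?C * (d * e ^ ?n / e)) * (\<integral>\<^sup>+\<xi>. ennreal ((cmod (\<Phi> \<xi>))\<^sup>2 / norm \<xi>) \<partial>lborel)" .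
  have "?L \<le> ennreal (1 / d) * (ennreal ((1 / e) ^ ?n) * (ennreal (?C * (d * e ^ ?n / e)) * (\<integral>\<^sup>+\<xi>. ennreal ((cmod (\<Phi> \<xi>))\<^sup>2 / norm \<xi>) \<partial>lborel)))"
    unfolding sc by (intro mult_left_mono I) auto
  also have "\<dots> = ennreal (1 / d * ((1 / e) ^ ?n * (?C * (d * e ^ ?n / e)))) * (\<integral>\<^sup>+\<xi>. ennreal ((cmod (\<Phi> \<xi>))\<^sup>2 / norm \<xi>) \<partial>lborel)"
    using d e by (simp add: mult.assoc[symmetric] ennreal_mult[symmetric] smoothing_const_nonneg)
  \<comment> \<open>All powers of d cancel, so the bound does not see the time cutoff, which can
    therefore be removed.\<close>
  also have "1 / d * ((1 / e) ^ ?n * (?C * (d * e ^ ?n / e))) = ?C / e"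
    using d e by (simp add: power_divide)
  finally show ?thesis .
qed

text \<open>With e = 1 / R the spatial Gaussian is at least exp (-pi) on the ball of radius R, which
  explains the factor exp pi. The cutoff in time is removed by letting d = 1 / (k + 1) tend to
  0.\<close>

lemma free_wave_local_smoothing:
  fixes \<Phi> :: "'a::euclidean_space \<Rightarrow> complex"
  assumes \<Phi>: "integrable lborel \<Phi>" and R: "R > 0"
  shows "(\<integral>\<^sup>+p\<in>UNIV \<times> ball 0 R. ennreal ((cmod (free_wave \<Phi> (fst p) (snd p)))\<^sup>2) \<partial>lborel)
    \<le> ennreal (exp pi * smoothing_const DIM('a) * R) * (\<integral>\<^sup>+\<xi>. ennreal ((cmod (\<Phi> \<xi>))\<^sup>2 / norm \<xi>) \<partial>lborel)" (is "_ \<le> ?B")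
proof (rule nn_integral_le_of_tendsto)
  have [measurable]: "\<Phi> \<in> borel_measurable borel" using \<Phi> by auto
  have [measurable]: "UNIV \<times> ball 0 R \<in> sets (borel :: (real \<times> 'a) measure)"
    by (simp add: borel_prod[symmetric])
  let ?f = "\<lambda>k p. ennreal (exp (- (pi * (1 / Suc k * fst p)\<^sup>2)) * ((cmod (free_wave \<Phi> (fst p) (snd p)))\<^sup>2 * indicator (UNIV \<times> ball 0 R) p))"
  have [measurable]: "(\<lambda>p. fst p) \<in> borel_measurable (borel :: (real \<times> 'a) measure)"
    "(\<lambda>p. snd p) \<in> borel_measurable (borel :: (real \<times> 'a) measure)"
    by (simp_all add: borel_prod[symmetric])
  show fm: "?f k \<in> borel_measurable lborel" for k
    by measurable
  show "(\<lambda>k. ?f k p) \<longlonglongrightarrow> ennreal ((cmod (free_wave \<Phi> (fst p) (snd p)))\<^sup>2) * indicator (UNIV \<times> ball 0 R) p" for p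
  proof -
    have "(\<lambda>k. ?f k p) \<longlonglongrightarrow> ennreal (exp (- (pi * (0 * fst p)\<^sup>2)) * ((cmod (free_wave \<Phi> (fst p) (snd p)))\<^sup>2 * indicator (UNIV \<times> ball 0 R) p))"
      by (intro tendsto_intros tendsto_ennrealI LIMSEQ_Suc lim_1_over_n)
    then show ?thesis by (simp add: ennreal_mult ennreal_indicator)
  qed
  fix k
  let ?d = "1 / real (Suc k)"
  let ?h = "\<lambda>t x. exp (- (pi * ((?d * t)\<^sup>2 + (1 / R * norm x)\<^sup>2))) * (cmod (free_wave \<Phi> t x))\<^sup>2"
  have "(\<integral>\<^sup>+p. ?f k p \<partial>lborel) = (\<integral>\<^sup>+t. \<integral>\<^sup>+x. ?f k (t, x) \<partial>lborel \<partial>lborel)"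
    by (rule nn_integral_lborel_pair) (use fm in simp)
  also have "\<dots> \<le> (\<integral>\<^sup>+t. \<integral>\<^sup>+x. ennreal (exp pi) * ennreal (?h t x) \<partial>lborel \<partial>lborel)"
  proof (intro nn_integral_mono)
    fix t :: real and x :: 'a
    have "exp (- (pi * (?d * t)\<^sup>2)) * ((cmod (free_wave \<Phi> t x))\<^sup>2 * indicator (UNIV \<times> ball 0 R) (t, x)) \<le> exp pi * ?h t x"
    proof (cases "norm x < R")
      case True
      then have "(1 / R * norm x)\<^sup>2 \<le> 1\<^sup>2" using R by (intro power_mono) auto
      then have "pi * (1 / R * norm x)\<^sup>2 \<le> pi * 1" by (intro mult_left_mono) auto
      then have "exp (- (pi * (?d * t)\<^sup>2)) \<le> exp (pi + - (pi * ((?d * t)\<^sup>2 + (1 / R * norm x)\<^sup>2)))"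
        unfolding distrib_left by (subst exp_le_cancel_iff) linarith
      also have "\<dots> = exp pi * exp (- (pi * ((?d * t)\<^sup>2 + (1 / R * norm x)\<^sup>2)))" by (rule exp_add)
      finally show ?thesis
        using True mult_right_mono[OF _ zero_le_power2[of "cmod (free_wave \<Phi> t x)"]]
        by (simp add: mult.assoc[symmetric])
    qed simp
    then show "?f k (t, x) \<le> ennreal (exp pi) * ennreal (?h t x)"
      by (subst ennreal_mult[symmetric]) (auto intro!: ennreal_leI)
  qed
  also have "\<dots> = ennreal (exp pi) * (\<integral>\<^sup>+t. \<integral>\<^sup>+x. ennreal (?h t x) \<partial>lborel \<partial>lborel)"
    by (subst nn_integral_cmult, measurable)+
  also have "\<dots> \<le> ennreal (exp pi) * (ennreal (smoothing_const DIM('a) / (1 / R)) * (\<integral>\<^sup>+\<xi>. ennreal ((cmod (\<Phi> \<xi>))\<^sup>2 / norm \<xi>) \<partial>lborel))"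
    by (intro mult_left_mono free_wave_weighted_smoothing \<Phi>) (use R in auto)
  also have "\<dots> = ?B"
    using R by (simp add: mult.assoc[symmetric] ennreal_mult[symmetric] smoothing_const_nonneg)
  finally show "(\<integral>\<^sup>+p. ?f k p \<partial>lborel) \<le> ?B" .
qed

section \<open>Test functions\<close>

lemma partial_eqI: "(\<phi> has_derivative D) (at x) \<Longrightarrow> partial b \<phi> x = D b"
  by (simp add: partial_def frechet_derivative_at[symmetric])

text \<open>Smoothness speaks about all iterated partial derivatives. A family of differentiable
  functions that is closed under differentiation avoids computing them.\<close>

lemma smooth_coinduct:
  fixes \<phi> :: "'a::euclidean_space \<Rightarrow> complex"
  assumes "\<phi> \<in> S" and "\<And>\<psi> x. \<psi> \<in> S \<Longrightarrow> \<psi> differentiable (at x)"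
    and "\<And>\<psi> b. \<psi> \<in> S \<Longrightarrow> b \<in> Basis \<Longrightarrow> partial b \<psi> \<in> S"
  shows "smooth \<phi>"
proof -
  have "set bs \<subseteq> Basis \<Longrightarrow> iter_partial bs \<phi> \<in> S" for bs
    using assms(1,3) by (induction bs) (auto simp: iter_partial_def)
  then show ?thesis using assms(2) by (auto simp: smooth_def)
qed

lemma smooth_differentiable: "smooth \<phi> \<Longrightarrow> \<phi> differentiable (at x)"
  unfolding smooth_def by (metis empty_subsetI foldr_Nil id_apply iter_partial_def list.set(1))

lemma smooth_partial:
  fixes \<phi> :: "'a::euclidean_space \<Rightarrow> complex"
  shows "smooth \<phi> \<Longrightarrow> b \<in> Basis \<Longrightarrow> smooth (partial b \<phi>)"
  unfolding smooth_def
proof (intro allI impI)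
  fix bs :: "'a list" and x :: 'a assume *: "\<forall>bs. set bs \<subseteq> Basis \<longrightarrow> (\<forall>x. iter_partial bs \<phi> differentiable at x)"
    and b: "b \<in> Basis" "set bs \<subseteq> Basis"
  have "iter_partial bs (partial b \<phi>) = iter_partial (bs @ [b]) \<phi>"
    by (simp add: iter_partial_def)
  then show "iter_partial bs (partial b \<phi>) differentiable at x" using * b by simp
qed

lemma smooth_has_derivative: "smooth \<phi> \<Longrightarrow> (\<phi> has_derivative frechet_derivative \<phi> (at x)) (at x)"
  using smooth_differentiable frechet_derivative_works by blast

text \<open>Derivatives of a product are sums of products, so products alone are not closed under
  differentiation; this closure is, by the Leibniz rule.\<close>

inductive_set sum_prod_closure :: "('a \<Rightarrow> complex) set \<Rightarrow> ('a \<Rightarrow> complex) set" for A where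
  base: "f \<in> A \<Longrightarrow> f \<in> sum_prod_closure A"
| add: "f \<in> sum_prod_closure A \<Longrightarrow> g \<in> sum_prod_closure A \<Longrightarrow> (\<lambda>x. f x + g x) \<in> sum_prod_closure A"
| mult: "f \<in> sum_prod_closure A \<Longrightarrow> g \<in> sum_prod_closure A \<Longrightarrow> (\<lambda>x. f x * g x) \<in> sum_prod_closure A"

lemma smooth_sum_prod_closure:
  fixes \<phi> :: "'a::euclidean_space \<Rightarrow> complex"
  assumes "\<phi> \<in> sum_prod_closure {\<phi>. smooth \<phi>}"
  shows "smooth \<phi>"
proof (rule smooth_coinduct[OF assms])
  fix \<psi> :: "'a \<Rightarrow> complex" assume \<psi>: "\<psi> \<in> sum_prod_closure {\<phi>. smooth \<phi>}"
  show diff: "\<psi> differentiable (at x)" if "\<psi> \<in> sum_prod_closure {\<phi>. smooth \<phi>}" for \<psi> :: "'a \<Rightarrow> complex" and x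
    using that by induction (auto intro: smooth_differentiable derivative_intros)
  fix b :: 'a assume b: "b \<in> Basis"
  from \<psi> show "partial b \<psi> \<in> sum_prod_closure {\<phi>. smooth \<phi>}"
  proof induction
    case (base f)
    then show ?case using b by (auto intro: sum_prod_closure.base smooth_partial)
  next
  case (add f g)
    have D: "(f has_derivative frechet_derivative f (at x)) (at x)" "(g has_derivative frechet_derivative g (at x)) (at x)" for x
      unfolding frechet_derivative_works[symmetric]
      using add.hyps by (auto intro: diff)
    have "partial b (\<lambda>x. f x + g x) = (\<lambda>x. partial b f x + partial b g x)"
      by (rule ext, subst partial_eqI[OF has_derivative_add[OF D]]) (simp only: partial_def)
    then show ?case using add.IH by (simp add: sum_prod_closure.add sum_prod_closure.mult)
  next
  case (mult f g)
    have D: "(f has_derivative frechet_derivative f (at x)) (at x)" "(g has_derivative frechet_derivative g (at x)) (at x)" for x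
      unfolding frechet_derivative_works[symmetric]
      using mult.hyps by (auto intro: diff)
    have "partial b (\<lambda>x. f x * g x) = (\<lambda>x. f x * partial b g x + partial b f x * g x)"
      by (rule ext, subst partial_eqI[OF has_derivative_mult[OF D]]) (simp only: partial_def)
    then show ?case using mult by (simp add: sum_prod_closure.add sum_prod_closure.mult)
  qed
qed

lemma smooth_add: "smooth f \<Longrightarrow> smooth g \<Longrightarrow> smooth (\<lambda>x. f x + g x)"
  by (intro smooth_sum_prod_closure sum_prod_closure.intros) auto

lemma smooth_mult: "smooth f \<Longrightarrow> smooth g \<Longrightarrow> smooth (\<lambda>x. f x * g x)"
  by (intro smooth_sum_prod_closure sum_prod_closure.intros) auto

lemma smooth_const: "smooth (\<lambda>x. c)"
  by (rule smooth_coinduct[where S = "range (\<lambda>c x. c)"])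
     (auto simp: fun_eq_iff intro!: range_eqI[where x = 0] partial_eqI[where D = "\<lambda>_. 0", THEN trans])

lemma smooth_prod: "finite I \<Longrightarrow> (\<And>i. i \<in> I \<Longrightarrow> smooth (f i)) \<Longrightarrow> smooth (\<lambda>x. \<Prod>i\<in>I. f i x)"
  by (induction I rule: finite_induct) (auto intro: smooth_const smooth_mult)

lemma smooth_inner: "smooth (\<lambda>x. of_real (x \<bullet> j))"
proof (rule smooth_coinduct[where S = "insert (\<lambda>x. of_real (x \<bullet> j)) (range (\<lambda>c x. c))"])
  fix \<psi> :: "'a \<Rightarrow> complex" assume "\<psi> \<in> insert (\<lambda>x. of_real (x \<bullet> j)) (range (\<lambda>c x. c))"
  then consider "\<psi> = (\<lambda>x. of_real (x \<bullet> j))" | c where "\<psi> = (\<lambda>x. c)" by auto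
  note cases = this
  have D: "((\<lambda>x. complex_of_real (x \<bullet> j)) has_derivative (\<lambda>h. of_real (h \<bullet> j))) (at x)" for x :: 'a
    by (auto intro!: derivative_eq_intros)
  have D0: "((\<lambda>x. c) has_derivative (\<lambda>h. 0 :: complex)) (at x)" for x :: 'a and c
    by (rule has_derivative_const)
  show "\<psi> differentiable (at x)" for x
    by (rule cases) (auto intro: differentiableI[OF D] differentiableI[OF D0])
  fix b :: 'a
  have "partial b (\<lambda>x. complex_of_real (x \<bullet> j)) = (\<lambda>x. of_real (b \<bullet> j))"
    and "partial b (\<lambda>x. c) = (\<lambda>x. 0)" for c
    using partial_eqI[OF D] partial_eqI[OF D0] by (simp_all add: fun_eq_iff)
  note P = this
  show "partial b \<psi> \<in> insert (\<lambda>x. of_real (x \<bullet> j)) (range (\<lambda>c x. c))"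
    by (rule cases) (auto simp: P)
qed simp

lemma cis_has_derivative:
  fixes y :: "'a::euclidean_space"
  shows "((\<lambda>x. cis (c * (y \<bullet> x))) has_derivative (\<lambda>h. (\<i> * of_real (c * (y \<bullet> h))) * cis (c * (y \<bullet> x)))) (at x)"
proof -
  have "((\<lambda>x. \<i> * complex_of_real (c * (y \<bullet> x))) has_derivative (\<lambda>h. \<i> * of_real (c * (y \<bullet> h)))) (at x)"
    by (auto intro!: derivative_eq_intros)
  from has_derivative_compose[OF this DERIV_exp[unfolded has_field_derivative_def]]
  show ?thesis unfolding cis_conv_exp by (simp add: mult.commute)
qed

lemma smooth_cis: "smooth (\<lambda>x. cis (c * (y \<bullet> x)))"
proof -
  have D: "((\<lambda>x. a * cis (c * (y \<bullet> x))) has_derivative (\<lambda>h. a * ((\<i> * of_real (c * (y \<bullet> h))) * cis (c * (y \<bullet> x))))) (at x)" for a x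
    by (intro has_derivative_mult_right cis_has_derivative)
  show ?thesis
  proof (rule smooth_coinduct[where S = "range (\<lambda>a x. a * cis (c * (y \<bullet> x)))"])
    show "(\<lambda>x. cis (c * (y \<bullet> x))) \<in> range (\<lambda>a x. a * cis (c * (y \<bullet> x)))"
      by (rule range_eqI[where x = 1]) simp
    fix \<psi> assume "\<psi> \<in> range (\<lambda>a x. a * cis (c * (y \<bullet> x)))"
    then obtain a where \<psi>: "\<psi> = (\<lambda>x. a * cis (c * (y \<bullet> x)))" by auto
    show "\<psi> differentiable (at x)" for x unfolding \<psi> using D by (rule differentiableI)
    show "partial b \<psi> \<in> range (\<lambda>a x. a * cis (c * (y \<bullet> x)))" for b
      unfolding \<psi>
      by (rule range_eqI[where x = "a * (\<i> * of_real (c * (y \<bullet> b)))"], rule ext)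
         (subst partial_eqI[OF D], simp only: mult.assoc)
  qed
qed

text \<open>The polynomial factor makes this family of functions closed under differentiation.\<close>

definition flat_fun :: "real \<Rightarrow> real poly \<Rightarrow> real \<Rightarrow> real" where
  "flat_fun c p x = (if x > 0 then poly p (1 / x) * exp (- c / x) else 0)"

lemma poly_exp_tendsto_0:
  fixes p :: "real poly" assumes "c > 0"
  shows "((\<lambda>y. poly p y * exp (- c * y)) \<longlongrightarrow> 0) at_top"
proof -
  have "((\<lambda>y. y ^ k * exp (- c * y)) \<longlongrightarrow> 0) at_top" for k
  proof -
    have "filterlim (\<lambda>y. c * y) at_top at_top"
      using assms by (intro filterlim_tendsto_pos_mult_at_top[OF tendsto_const] filterlim_ident) auto
    then have "((\<lambda>y. (c * y) ^ k / exp (c * y)) \<longlongrightarrow> 0) at_top"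
      by (rule filterlim_compose[OF tendsto_power_div_exp_0])
    then have "((\<lambda>y. (1 / c ^ k) * ((c * y) ^ k / exp (c * y))) \<longlongrightarrow> (1 / c ^ k) * 0) at_top"
      by (rule tendsto_mult_left)
    then show ?thesis using assms by (simp add: power_mult_distrib exp_minus field_simps)
  qed
  then have "((\<lambda>y. \<Sum>i\<le>degree p. coeff p i * (y ^ i * exp (- c * y))) \<longlongrightarrow> (\<Sum>i\<le>degree p. coeff p i * 0)) at_top"
    by (intro tendsto_sum tendsto_mult_left)
  then show ?thesis by (simp add: poly_altdef sum_distrib_right mult.assoc)
qed

text \<open>For x > 0 the chain rule in 1 / x turns p into X^2 (c p - p'). Only x = 0 needs an
  argument: the quotient vanishes on the left, and on the right it becomes a polynomial times a
  decaying exponential at infinity.\<close>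

lemma flat_fun_derivative:
  assumes c: "c > 0"
  shows "(flat_fun c p has_real_derivative flat_fun c ([:0, 0, 1:] * (smult c p - pderiv p)) x) (at x)"
proof -
  let ?q = "[:0, 0, 1:] * (smult c p - pderiv p)"
  consider "x > 0" | "x < 0" | "x = 0" by linarith
  then show ?thesis
  proof cases
    case 1
    have "((\<lambda>x. poly p (1 / x) * exp (- c / x)) has_real_derivative flat_fun c ?q x) (at x)"
      using 1
      by (auto intro!: derivative_eq_intros DERIV_chain2[OF poly_DERIV]
          simp: flat_fun_def power2_eq_square field_simps)
    then show ?thesis
      by (rule has_field_derivative_transform_within_open[where S = "{0<..}"])
         (use 1 in \<open>auto simp: flat_fun_def\<close>)
  next
    case 2
    have "((\<lambda>x. 0) has_real_derivative flat_fun c ?q x) (at x)"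
      using 2 by (simp add: flat_fun_def)
    then show ?thesis
      by (rule has_field_derivative_transform_within_open[where S = "{..<0}"])
         (use 2 in \<open>auto simp: flat_fun_def\<close>)
  next
    case 3
    have "((\<lambda>h. flat_fun c p h / h) \<longlongrightarrow> 0) (at_left 0)"
      by (rule tendsto_eventually) (auto simp: eventually_at_filter flat_fun_def)
    moreover have "((\<lambda>h. flat_fun c p h / h) \<longlongrightarrow> 0) (at_right 0)"
    proof -
      have "((\<lambda>y. flat_fun c p (inverse y) / inverse y) \<longlongrightarrow> 0) at_top"
      \<comment> \<open>Dividing by h = 1 / y multiplies p by the variable, hence
        \<open>pCons 0 p\<close>.\<close>
      proof (rule Lim_transform_eventually[OF poly_exp_tendsto_0[OF c, of "pCons 0 p"]])
        show "\<forall>\<^sub>F y in at_top. poly (pCons 0 p) y * exp (- c * y) = flat_fun c p (inverse y) / inverse y"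
          using eventually_gt_at_top[of 0] by eventually_elim (simp add: flat_fun_def field_simps)
      qed
      then show ?thesis by (simp add: filterlim_at_right_to_top)
    qed
    ultimately have "((\<lambda>h. flat_fun c p h / h) \<longlongrightarrow> 0) (at 0)"
      by (simp add: filterlim_split_at)
    then show ?thesis using 3 by (simp add: DERIV_def flat_fun_def)
  qed
qed

lemma smooth_flat_fun:
  assumes c: "c > 0"
  shows "smooth (\<lambda>x. of_real (flat_fun c p (x \<bullet> v + w)))"
proof (rule smooth_coinduct[where S = "range (\<lambda>p x. complex_of_real (flat_fun c p (x \<bullet> v + w)))"])
  fix \<psi> assume "\<psi> \<in> range (\<lambda>p x. complex_of_real (flat_fun c p (x \<bullet> v + w)))"
  then obtain p where \<psi>: "\<psi> = (\<lambda>x. complex_of_real (flat_fun c p (x \<bullet> v + w)))" by auto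
  let ?q = "[:0, 0, 1:] * (smult c p - pderiv p)"
  have D: "(\<psi> has_derivative (\<lambda>h. of_real ((h \<bullet> v) * flat_fun c ?q (x \<bullet> v + w)))) (at x)" for x
  proof -
    have "((\<lambda>x. x \<bullet> v + w) has_derivative (\<lambda>h. h \<bullet> v)) (at x)"
      by (auto intro!: derivative_eq_intros)
    from has_derivative_compose[OF this flat_fun_derivative[OF c, of p "x \<bullet> v + w", unfolded has_field_derivative_def]]
    show ?thesis unfolding \<psi> by (intro has_derivative_of_real) (simp add: mult.commute)
  qed
  then show "\<psi> differentiable (at x)" for x by (rule differentiableI)
  show "partial b \<psi> \<in> range (\<lambda>p x. complex_of_real (flat_fun c p (x \<bullet> v + w)))" for b
    by (rule range_eqI[where x = "smult (b \<bullet> v) ?q"], rule ext, subst partial_eqI[OF D])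
       (simp add: flat_fun_def mult.assoc)
qed auto

section \<open>Test functions and their integrals\<close>

lemma test_function_iff: "test_function \<phi> \<longleftrightarrow> smooth \<phi> \<and> (\<exists>R. \<forall>x. norm x > R \<longrightarrow> \<phi> x = 0)"
  unfolding test_function_def compact_closure bounded_iff
  by (auto simp: not_le[symmetric])

lemma test_function_add: "test_function \<phi> \<Longrightarrow> test_function \<psi> \<Longrightarrow> test_function (\<lambda>x. \<phi> x + \<psi> x)"
  unfolding test_function_iff
proof (elim conjE exE, intro conjI smooth_add)
  fix R R' assume "\<forall>x. R < norm x \<longrightarrow> \<phi> x = 0" "\<forall>x. R' < norm x \<longrightarrow> \<psi> x = 0"
  then show "\<exists>R. \<forall>x. R < norm x \<longrightarrow> \<phi> x + \<psi> x = 0" by (intro exI[of _ "max R R'"]) auto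
qed

lemma test_function_smooth_mult: "smooth f \<Longrightarrow> test_function \<phi> \<Longrightarrow> test_function (\<lambda>x. f x * \<phi> x)"
  unfolding test_function_iff by (auto intro: smooth_mult)

lemma test_function_cmult: "test_function \<phi> \<Longrightarrow> test_function (\<lambda>x. c * \<phi> x)"
  by (rule test_function_smooth_mult[OF smooth_const])

lemma test_function_partial:
  assumes "test_function \<phi>" "b \<in> Basis" shows "test_function (partial b \<phi>)"
proof -
  obtain R where R: "\<And>x. norm x > R \<Longrightarrow> \<phi> x = 0" and s: "smooth \<phi>"
    using assms by (auto simp: test_function_iff)
  have "partial b \<phi> x = 0" if "norm x > R" for x
  proof -
    have "open {x. norm x > R}" by (intro open_Collect_less continuous_intros)
    then have "(\<phi> has_derivative (\<lambda>_. 0)) (at x)"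
      by (rule has_derivative_transform_within_open[OF has_derivative_const]) (use that R in auto)
    then show ?thesis by (rule partial_eqI)
  qed
  then show ?thesis using s assms smooth_partial by (auto simp: test_function_iff)
qed

lemma test_function_continuous: "test_function \<phi> \<Longrightarrow> continuous_on A \<phi>"
  by (rule differentiable_imp_continuous_on)
     (auto simp: test_function_def smooth_differentiable intro!: differentiable_at_imp_differentiable_on)

lemma test_function_measurable: "test_function \<phi> \<Longrightarrow> \<phi> \<in> borel_measurable borel"
  by (rule borel_measurable_continuous_onI) (rule test_function_continuous)

lemma test_function_bounded:
  fixes \<phi> :: "'a::euclidean_space \<Rightarrow> complex"
  assumes "test_function \<phi>"
  obtains C R where "C \<ge> 0" "R > 0" "\<And>x. cmod (\<phi> x) \<le> C * indicator (cball 0 R) x"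
proof -
  obtain R0 where R0: "\<And>x. norm x > R0 \<Longrightarrow> \<phi> x = 0"
    using assms by (auto simp: test_function_iff)
  define R where "R = max R0 1"
  have "compact (\<phi> ` cball 0 R)"
    by (rule compact_continuous_image[OF test_function_continuous[OF assms]]) simp
  then obtain C where C: "\<And>x. x \<in> cball 0 R \<Longrightarrow> cmod (\<phi> x) \<le> C"
    by (meson bounded_iff compact_imp_bounded image_eqI)
  show ?thesis
  proof (rule that[of "max C 0" R])
    show "cmod (\<phi> x) \<le> max C 0 * indicator (cball 0 R) x" for x
      using C[of x] R0[of x] by (auto simp: R_def indicator_def)
  qed (auto simp: R_def)
qed

lemma integrable_indicator_cball: "integrable lborel (\<lambda>x::'a::euclidean_space. C * indicator (cball 0 R) x :: real)"
  by (intro integrable_mult_right integrable_real_indicator)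
     (use emeasure_compact_finite[OF compact_cball, of 0 R] in auto)

lemma test_function_integrable:
  fixes \<phi> :: "'a::euclidean_space \<Rightarrow> complex"
  assumes "test_function \<phi>" shows "integrable lborel \<phi>"
proof -
  obtain C R where "C \<ge> 0" "R > 0" "\<And>x. cmod (\<phi> x) \<le> C * indicator (cball 0 R) x"
    using test_function_bounded[OF assms] by blast
  then show ?thesis
    by (intro Bochner_Integration.integrable_bound[OF integrable_indicator_cball[of C R]])
       (auto simp: test_function_measurable[OF assms])
qed

text \<open>Difference quotients integrate to 0 by translation invariance, and dominated convergence
  carries this over to the derivative. This takes the place of integration by parts.\<close>

lemma integral_partial_eq_0:
  fixes \<phi> :: "'a::euclidean_space \<Rightarrow> complex"
  assumes \<phi>: "test_function \<phi>" and b: "b \<in> Basis"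
  shows "(LINT x|lborel. partial b \<phi> x) = 0"
proof -
  have s: "smooth \<phi>" using \<phi> by (simp add: test_function_def)
  have [measurable]: "\<phi> \<in> borel_measurable borel" by (rule test_function_measurable[OF \<phi>])
  have [measurable]: "partial b \<phi> \<in> borel_measurable borel"
    by (rule test_function_measurable[OF test_function_partial[OF \<phi> b]])
  obtain C R where C: "C \<ge> 0" and "R > 0" and CR: "\<And>x. cmod (partial b \<phi> x) \<le> C * indicator (cball 0 R) x"
    using test_function_bounded[OF test_function_partial[OF \<phi> b]] by blast
  obtain C' R' where R': "R' > 0" "\<And>x. cmod (\<phi> x) \<le> C' * indicator (cball 0 R') x"
    using test_function_bounded[OF \<phi>] by blast
  have C1: "cmod (partial b \<phi> x) \<le> C" for x
    using CR[of x] C by (cases "norm x \<le> R") auto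
  let ?q = "\<lambda>h x. (\<phi> (x + h *\<^sub>R b) - \<phi> x) / of_real h"
  have line: "((\<lambda>s. \<phi> (x + s *\<^sub>R b)) has_vector_derivative partial b \<phi> (x + s *\<^sub>R b)) (at s)" for x s
  proof -
    have "((\<lambda>s. x + s *\<^sub>R b) has_derivative (\<lambda>h. h *\<^sub>R b)) (at s)"
      by (auto intro!: derivative_eq_intros)
    from has_derivative_compose[OF this smooth_has_derivative[OF s]]
    have "((\<lambda>s. \<phi> (x + s *\<^sub>R b)) has_derivative (\<lambda>h. frechet_derivative \<phi> (at (x + s *\<^sub>R b)) (h *\<^sub>R b))) (at s)" .
    also have "(\<lambda>h. frechet_derivative \<phi> (at (x + s *\<^sub>R b)) (h *\<^sub>R b)) = (\<lambda>h. h *\<^sub>R partial b \<phi> (x + s *\<^sub>R b))"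
      by (simp add: partial_def linear_cmul[OF linear_frechet_derivative[OF smooth_differentiable[OF s]]])
    finally show ?thesis by (simp add: has_vector_derivative_def)
  qed
  \<comment> \<open>The mean value inequality bounds the quotient by C. Steps h <= 1 enlarge the
    support by at most 1, so one ball serves for all of them.\<close>
  have bd: "cmod (?q h x) \<le> C * indicator (cball 0 (R' + 1)) x" if h: "0 < h" "h \<le> 1" for h x
  proof (cases "norm x \<le> R' + 1")
    case True
    have "norm (\<phi> (x + h *\<^sub>R b) - \<phi> (x + 0 *\<^sub>R b)) \<le> C * norm (h - 0)"
    proof (rule differentiable_bound[where S = UNIV])
      show "((\<lambda>s. \<phi> (x + s *\<^sub>R b)) has_derivative (\<lambda>k. k *\<^sub>R partial b \<phi> (x + s *\<^sub>R b))) (at s within UNIV)" for s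
        using line by (simp add: has_vector_derivative_def)
      show "onorm (\<lambda>k. k *\<^sub>R partial b \<phi> (x + s *\<^sub>R b)) \<le> C" for s
        using C C1 by (intro onorm_bound) (auto simp: mult.commute[of C] intro!: mult_left_mono)
    qed auto
    then show ?thesis using True h by (simp add: norm_divide field_simps)
  next
    case False
    then have "norm x > R'" "norm (x + h *\<^sub>R b) > R'"
      using norm_triangle_ineq2[of x "- (h *\<^sub>R b)"] h b by auto
    then have "\<phi> x = 0" "\<phi> (x + h *\<^sub>R b) = 0" using R'(2)[of x] R'(2)[of "x + h *\<^sub>R b"] by auto
    then show ?thesis using False by simp
  qed
  have "(\<lambda>k. LINT x|lborel. ?q (1 / Suc k) x) \<longlonglongrightarrow> (LINT x|lborel. partial b \<phi> x)"
  proof (rule integral_dominated_convergence[OF _ _ integrable_indicator_cball[of C "R' + 1"]])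
    show "AE x in lborel. (\<lambda>k. ?q (1 / Suc k) x) \<longlonglongrightarrow> partial b \<phi> x"
    proof (rule AE_I2)
      fix x
      have "((\<lambda>h. (\<phi> (x + h *\<^sub>R b) - \<phi> x) /\<^sub>R h) \<longlongrightarrow> partial b \<phi> x) (at 0)"
      proof (subst LIM_zero_iff[symmetric], rule tendsto_norm_zero_cancel, rule Lim_transform_eventually)
        show "((\<lambda>h. norm (\<phi> (x + h *\<^sub>R b) - \<phi> x - h *\<^sub>R partial b \<phi> x) / norm h) \<longlongrightarrow> 0) (at 0)"
          using line[of x 0] by (simp add: has_vector_derivative_def has_derivative_at)
        show "\<forall>\<^sub>F h in at 0. norm (\<phi> (x + h *\<^sub>R b) - \<phi> x - h *\<^sub>R partial b \<phi> x) / norm h =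
           norm ((\<phi> (x + h *\<^sub>R b) - \<phi> x) /\<^sub>R h - partial b \<phi> x)"
          unfolding eventually_at_filter
        proof (intro always_eventually allI impI)
          fix h :: real assume h: "h \<noteq> 0"
          have "(\<phi> (x + h *\<^sub>R b) - \<phi> x) /\<^sub>R h - partial b \<phi> x = (\<phi> (x + h *\<^sub>R b) - \<phi> x - h *\<^sub>R partial b \<phi> x) /\<^sub>R h"
            using h by (simp add: scaleR_diff_right)
          then show "norm (\<phi> (x + h *\<^sub>R b) - \<phi> x - h *\<^sub>R partial b \<phi> x) / norm h =
             norm ((\<phi> (x + h *\<^sub>R b) - \<phi> x) /\<^sub>R h - partial b \<phi> x)"
            by (simp add: divide_inverse mult.commute)
        qed
      qed
      then have "((\<lambda>h. ?q h x) \<longlongrightarrow> partial b \<phi> x) (at 0)"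
        by (simp add: scaleR_conv_of_real divide_inverse mult.commute)
      moreover have "filterlim (\<lambda>k. 1 / Suc k) (at (0::real)) sequentially"
        unfolding filterlim_at using LIMSEQ_Suc[OF lim_1_over_n] by auto
      ultimately show "(\<lambda>k. ?q (1 / Suc k) x) \<longlonglongrightarrow> partial b \<phi> x"
        by (rule filterlim_compose)
    qed
    show "AE x in lborel. cmod (?q (1 / Suc k) x) \<le> C * indicator (cball 0 (R' + 1)) x" for k
      by (intro AE_I2 bd) auto
  qed measurable
  moreover have z: "(LINT x|lborel. ?q h x) = 0" for h
  proof -
    have "(LINT x|lborel. \<phi> x) = (LINT x|distr lborel borel ((+) (h *\<^sub>R b)). \<phi> x)"
      by (subst lborel_distr_plus) simp
    also have "\<dots> = (LINT x|lborel. \<phi> (x + h *\<^sub>R b))"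
      by (subst integral_distr) (auto simp: add.commute)
    finally have eq: "(LINT x|lborel. \<phi> (x + h *\<^sub>R b)) = (LINT x|lborel. \<phi> x)" ..
    have i: "integrable lborel \<phi>" by (rule test_function_integrable[OF \<phi>])
    have "integrable (distr lborel borel ((+) (h *\<^sub>R b))) \<phi>"
      by (subst lborel_distr_plus) (rule i)
    then have i2: "integrable lborel (\<lambda>x. \<phi> (x + h *\<^sub>R b))"
      by (subst (asm) integrable_distr_eq) (auto simp: add.commute)
    show ?thesis by (simp add: Bochner_Integration.integral_diff[OF i2 i] eq)
  qed
  ultimately have "(\<lambda>k::nat. 0) \<longlonglongrightarrow> (LINT x|lborel. partial b \<phi> x)" by (simp only: z)
  then show ?thesis by (simp add: LIMSEQ_const_iff)
qed

section \<open>Fourier transforms of test functions\<close>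

lemma test_function_modulate:
  assumes "test_function \<phi>" shows "test_function (\<lambda>\<xi>. cis (2 * pi * (x \<bullet> \<xi>)) * \<phi> \<xi>)"
  by (rule test_function_smooth_mult[OF smooth_cis assms])

text \<open>The derivative of the modulated function
  \<open>cis (2 * pi * (x \<bullet> \<xi>)) * \<phi> \<xi>\<close> integrates to 0; the product rule
  splits it into the two sides.\<close>

lemma inv_fourier_partial:
  fixes \<phi> :: "'a::euclidean_space \<Rightarrow> complex"
  assumes \<phi>: "test_function \<phi>" and b: "b \<in> Basis"
  shows "inv_fourier (partial b \<phi>) x = - (\<i> * of_real (2 * pi * (x \<bullet> b))) * inv_fourier \<phi> x"
proof -
  have s: "smooth \<phi>" using \<phi> by (simp add: test_function_def)
  let ?e = "\<lambda>\<xi>. cis (2 * pi * (x \<bullet> \<xi>))"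
  have "partial b (\<lambda>\<xi>. ?e \<xi> * \<phi> \<xi>) \<xi> = ?e \<xi> * partial b \<phi> \<xi> + (\<i> * of_real (2 * pi * (x \<bullet> b))) * (?e \<xi> * \<phi> \<xi>)" for \<xi>
    by (subst partial_eqI[OF has_derivative_mult[OF cis_has_derivative smooth_has_derivative[OF s]]])
       (simp only: partial_def mult.assoc)
  moreover have i1: "integrable lborel (\<lambda>\<xi>. ?e \<xi> * partial b \<phi> \<xi>)" and i2: "integrable lborel (\<lambda>\<xi>. ?e \<xi> * \<phi> \<xi>)"
    by (intro test_function_integrable test_function_modulate test_function_partial \<phi> b)+
  ultimately have "0 = (LINT \<xi>|lborel. ?e \<xi> * partial b \<phi> \<xi> + (\<i> * of_real (2 * pi * (x \<bullet> b))) * (?e \<xi> * \<phi> \<xi>))"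
    using integral_partial_eq_0[OF test_function_modulate[OF \<phi>, of x] b] by simp
  also have "\<dots> = inv_fourier (partial b \<phi>) x + (\<i> * of_real (2 * pi * (x \<bullet> b))) * inv_fourier \<phi> x"
    unfolding inv_fourier_def
    by (simp only: Bochner_Integration.integral_add[OF i1 integrable_mult_right[OF i2]] integral_mult_right_zero)
  finally show ?thesis by (simp add: eq_neg_iff_add_eq_0)
qed

lemma inv_fourier_bounded: "cmod (inv_fourier \<phi> x) \<le> (LINT \<xi>|lborel. cmod (\<phi> \<xi>))"
  unfolding inv_fourier_def by (rule integral_norm_bound[THEN order_trans]) (simp add: norm_mult)

lemma inv_fourier_partial2:
  fixes \<phi> :: "'a::euclidean_space \<Rightarrow> complex"
  assumes \<phi>: "test_function \<phi>" and b: "b \<in> Basis"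
  shows "(y \<bullet> b)\<^sup>2 * cmod (inv_fourier \<phi> y) = cmod (inv_fourier (partial b (partial b \<phi>)) y) / (4 * pi\<^sup>2)"
  using inv_fourier_partial[OF test_function_partial[OF \<phi> b] b] inv_fourier_partial[OF \<phi> b]
  by (simp add: norm_mult power2_eq_square)

text \<open>One coordinate at a time: a factor 1 + y_b^2 costs two derivatives along b. The
  induction keeps the test function general because it is applied to the second derivative as well.
  The product weight makes the inverse transform integrable by Fubini.\<close>

lemma inv_fourier_decay:
  fixes \<phi> :: "'a::euclidean_space \<Rightarrow> complex"
  assumes "test_function \<phi>" and "B \<subseteq> Basis"
  shows "\<exists>C\<ge>0. \<forall>y. (\<Prod>b\<in>B. 1 + (y \<bullet> b)\<^sup>2) * cmod (inv_fourier \<phi> y) \<le> C"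
proof -
  have "finite B" using assms(2) finite_Basis finite_subset by blast
  then show ?thesis
    using assms
  proof (induction B arbitrary: \<phi> rule: finite_induct)
    case empty
    have "0 \<le> (LINT \<xi>|lborel. cmod (\<phi> \<xi>))" by simp
    then show ?case using inv_fourier_bounded by (auto intro!: exI[of _ "LINT \<xi>|lborel. cmod (\<phi> \<xi>)"])
  next
    case (insert b B)
    let ?\<psi> = "partial b (partial b \<phi>)"
    have b: "b \<in> Basis" and B: "B \<subseteq> Basis" using insert by auto
    obtain C1 where C1: "C1 \<ge> 0" "\<And>y. (\<Prod>b\<in>B. 1 + (y \<bullet> b)\<^sup>2) * cmod (inv_fourier \<phi> y) \<le> C1"
      using insert.IH[OF insert.prems(1) B] by blast
    obtain C2 where C2: "C2 \<ge> 0" "\<And>y. (\<Prod>b\<in>B. 1 + (y \<bullet> b)\<^sup>2) * cmod (inv_fourier ?\<psi> y) \<le> C2"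
      using insert.IH[of ?\<psi>] B b insert.prems(1) test_function_partial by blast
    have "(\<Prod>b\<in>insert b B. 1 + (y \<bullet> b)\<^sup>2) * cmod (inv_fourier \<phi> y) \<le> C1 + C2 / (4 * pi\<^sup>2)" for y
    proof -
      have "(\<Prod>b\<in>insert b B. 1 + (y \<bullet> b)\<^sup>2) * cmod (inv_fourier \<phi> y) =
         (\<Prod>b\<in>B. 1 + (y \<bullet> b)\<^sup>2) * cmod (inv_fourier \<phi> y) + (\<Prod>b\<in>B. 1 + (y \<bullet> b)\<^sup>2) * ((y \<bullet> b)\<^sup>2 * cmod (inv_fourier \<phi> y))"
        using insert.hyps by (simp add: algebra_simps)
      also have "\<dots> = (\<Prod>b\<in>B. 1 + (y \<bullet> b)\<^sup>2) * cmod (inv_fourier \<phi> y) + (\<Prod>b\<in>B. 1 + (y \<bullet> b)\<^sup>2) * cmod (inv_fourier ?\<psi> y) / (4 * pi\<^sup>2)"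
        by (simp add: inv_fourier_partial2[OF insert.prems(1) b])
      also have "\<dots> \<le> C1 + C2 / (4 * pi\<^sup>2)"
        by (intro add_mono divide_right_mono C1 C2) auto
      finally show ?thesis .
    qed
    then show ?case using C1(1) C2(1) by (intro exI[of _ "C1 + C2 / (4 * pi\<^sup>2)"]) auto
  qed
qed

lemma integrable_inverse_1_plus_square_lborel: "integrable lborel (\<lambda>x::real. 1 / (1 + x\<^sup>2))"
  using integrable_inverse_1_plus_square by (simp add: set_integrable_def inverse_eq_divide)

lemma inv_fourier_integrable:
  fixes \<phi> :: "'a::euclidean_space \<Rightarrow> complex"
  assumes \<phi>: "test_function \<phi>"
  shows "integrable lborel (inv_fourier \<phi>)"
proof -
  obtain C where C: "\<And>y. (\<Prod>b\<in>Basis. 1 + (y \<bullet> b)\<^sup>2) * cmod (inv_fourier \<phi> y) \<le> C"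
    using inv_fourier_decay[OF \<phi>, of Basis] by blast
  have pos: "(\<Prod>b\<in>Basis. 1 + (y \<bullet> b)\<^sup>2) > 0" for y :: 'a
    by (intro prod_pos) (simp add: add_pos_nonneg)
  have i: "integrable lborel (\<lambda>y::'a. C * (\<Prod>b\<in>Basis. 1 / (1 + (y \<bullet> b)\<^sup>2)))"
    by (intro integrable_mult_right lborel_integrable_prod integrable_inverse_1_plus_square_lborel)
  have bd: "cmod (inv_fourier \<phi> y) \<le> C * (\<Prod>b\<in>Basis. 1 / (1 + (y \<bullet> b)\<^sup>2))" for y
    using C[of y] pos[of y] by (simp add: prod_dividef field_simps)
  show ?thesis
  proof (rule Bochner_Integration.integrable_bound[OF i])
    show "AE y in lborel. norm (inv_fourier \<phi> y) \<le> norm (C * (\<Prod>b\<in>Basis. 1 / (1 + (y \<bullet> b)\<^sup>2)))"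
      using bd by (intro AE_I2) (metis abs_ge_self order_trans real_norm_def)
  qed (use inv_fourier_measurable[OF test_function_measurable[OF \<phi>]] in simp)
qed

lemma integrable_power2_of_bounded:
  fixes f :: "'a \<Rightarrow> real"
  assumes f: "integrable M f" and "\<And>x. \<bar>f x\<bar> \<le> C"
  shows "integrable M (\<lambda>x. (f x)\<^sup>2)"
proof (rule Bochner_Integration.integrable_bound)
  show "integrable M (\<lambda>x. C * f x)" using f by simp
  have "\<bar>f x\<bar> * \<bar>f x\<bar> \<le> \<bar>C\<bar> * \<bar>f x\<bar>" for x
    using assms(2)[of x] by (intro mult_right_mono) auto
  then show "AE x in M. norm ((f x)\<^sup>2) \<le> norm (C * f x)"
    by (simp add: power2_eq_square abs_mult)
qed (use f in measurable)

lemma inv_fourier_square_integrable: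
  fixes \<phi> :: "'a::euclidean_space \<Rightarrow> complex"
  assumes \<phi>: "test_function \<phi>"
  shows "integrable lborel (\<lambda>y. (cmod (inv_fourier \<phi> y))\<^sup>2)"
  using inv_fourier_bounded[of \<phi>] inv_fourier_integrable[OF \<phi>]
  by (intro integrable_power2_of_bounded[where C = "LINT \<xi>|lborel. cmod (\<phi> \<xi>)"]) auto

text \<open>This moment controls the dispersive error, since \<open>cis s - 1\<close> is at most |s|
  and s will be of size |y|^2 / |t|.\<close>

lemma inv_fourier_second_moment:
  fixes \<phi> :: "'a::euclidean_space \<Rightarrow> complex"
  assumes \<phi>: "test_function \<phi>"
  shows "integrable lborel (\<lambda>y. ((norm y)\<^sup>2 * cmod (inv_fourier \<phi> y))\<^sup>2)"
proof -
  let ?\<psi> = "\<lambda>b. partial b (partial b \<phi>)"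
  have \<psi>: "test_function (?\<psi> b)" if "b \<in> Basis" for b
    using that \<phi> test_function_partial by blast
  have eq: "(norm y)\<^sup>2 * cmod (inv_fourier \<phi> y) = (\<Sum>b\<in>Basis. cmod (inv_fourier (?\<psi> b) y) / (4 * pi\<^sup>2))" for y
    unfolding norm_square_Basis sum_distrib_right
    by (intro sum.cong refl inv_fourier_partial2 \<phi>)
  show ?thesis
    unfolding eq
  proof (rule integrable_power2_of_bounded)
    show "integrable lborel (\<lambda>y. \<Sum>b\<in>Basis. cmod (inv_fourier (?\<psi> b) y) / (4 * pi\<^sup>2))"
      using \<psi> by (intro Bochner_Integration.integrable_sum integrable_divide integrable_norm inv_fourier_integrable) auto
    show "\<bar>\<Sum>b\<in>Basis. cmod (inv_fourier (?\<psi> b) y) / (4 * pi\<^sup>2)\<bar> \<le> (\<Sum>b\<in>Basis. (LINT \<xi>|lborel. cmod (?\<psi> b \<xi>)) / (4 * pi\<^sup>2))" for y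
      by (subst abs_of_nonneg) (auto intro!: sum_nonneg sum_mono divide_right_mono inv_fourier_bounded)
  qed
qed

text \<open>Follows from the zeroth and second moments by |y| <= 1 + |y|^4. It makes pairings of
  |\<xi>| F with transforms of test functions absolutely convergent.\<close>

lemma inv_fourier_weighted_integrable:
  fixes \<phi> :: "'a::euclidean_space \<Rightarrow> complex"
  assumes \<phi>: "test_function \<phi>"
  shows "integrable lborel (\<lambda>y. norm y * (cmod (inv_fourier \<phi> y))\<^sup>2)"
proof (rule Bochner_Integration.integrable_bound)
  show "integrable lborel (\<lambda>y. (cmod (inv_fourier \<phi> y))\<^sup>2 + ((norm y)\<^sup>2 * cmod (inv_fourier \<phi> y))\<^sup>2)"
    using inv_fourier_square_integrable[OF \<phi>] inv_fourier_second_moment[OF \<phi>] by simp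
  show "(\<lambda>y. norm y * (cmod (inv_fourier \<phi> y))\<^sup>2) \<in> borel_measurable lborel"
    using test_function_measurable[OF \<phi>] by simp
  show "AE y in lborel. norm (norm y * (cmod (inv_fourier \<phi> y))\<^sup>2) \<le>
    norm ((cmod (inv_fourier \<phi> y))\<^sup>2 + ((norm y)\<^sup>2 * cmod (inv_fourier \<phi> y))\<^sup>2)"
  proof (rule AE_I2)
    fix y :: 'a
    have "norm y \<le> 1 + (norm y)^4"
    proof (cases "norm y \<le> 1")
      case False
      then show ?thesis using power_increasing[of 1 4 "norm y"] by simp
    qed (simp add: add_increasing2)
    then have "norm y * (cmod (inv_fourier \<phi> y))\<^sup>2 \<le> (1 + (norm y)^4) * (cmod (inv_fourier \<phi> y))\<^sup>2"
      by (rule mult_right_mono) simp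
    then show "norm (norm y * (cmod (inv_fourier \<phi> y))\<^sup>2) \<le>
        norm ((cmod (inv_fourier \<phi> y))\<^sup>2 + ((norm y)\<^sup>2 * cmod (inv_fourier \<phi> y))\<^sup>2)"
      by (simp add: algebra_simps power_mult_distrib flip: power_mult)
  qed
qed

text \<open>Each coordinate carries two flat functions, one for each face, so the product is nonzero
  exactly on the open box. As c tends to 0 it tends to the indicator of the box.\<close>

definition bump :: "real \<Rightarrow> 'a::euclidean_space \<Rightarrow> 'a \<Rightarrow> 'a \<Rightarrow> complex" where
  "bump c l u x = (\<Prod>b\<in>Basis. of_real (flat_fun c 1 (x \<bullet> b - l \<bullet> b)) * of_real (flat_fun c 1 (u \<bullet> b - x \<bullet> b)))"

lemma flat_fun_1: "flat_fun c 1 x = (if x > 0 then exp (- c / x) else 0)"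
  by (simp add: flat_fun_def)

lemma bump_eq_0: "x \<notin> box l u \<Longrightarrow> bump c l u x = 0"
  unfolding bump_def
proof (rule prod_zero)
  assume "x \<notin> box l u"
  then show "\<exists>b\<in>Basis. complex_of_real (flat_fun c 1 (x \<bullet> b - l \<bullet> b)) * of_real (flat_fun c 1 (u \<bullet> b - x \<bullet> b)) = 0"
    by (auto simp: mem_box flat_fun_1)
qed simp

lemma test_function_bump:
  assumes c: "c > 0" shows "test_function (bump c l u)"
  unfolding test_function_iff
proof
  have "smooth (\<lambda>x. of_real (flat_fun c 1 (x \<bullet> v - a)))" for v :: 'a and a
    using smooth_flat_fun[OF c, of 1 v "- a"] by simp
  moreover have "smooth (\<lambda>x. of_real (flat_fun c 1 (a - x \<bullet> v)))" for v :: 'a and a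
    using smooth_flat_fun[OF c, of 1 "- v" a] by (simp add: algebra_simps)
  ultimately show "smooth (bump c l u)"
    unfolding bump_def[abs_def] by (intro smooth_prod smooth_mult) auto
  obtain R where R: "\<And>x. x \<in> box l u \<Longrightarrow> norm x \<le> R"
    using bounded_box[of l u] by (auto simp: bounded_iff)
  show "\<exists>R. \<forall>x. R < norm x \<longrightarrow> bump c l u x = 0"
    using R by (intro exI[of _ R]) (auto intro!: bump_eq_0 simp: not_le[symmetric])
qed

lemma bump_bounded:
  fixes x :: "'a::euclidean_space"
  assumes c: "c > 0" shows "cmod (bump c l u x) \<le> indicator (box l u) x"
proof (cases "x \<in> box l u")
  case True
  have "0 \<le> flat_fun c 1 s \<and> flat_fun c 1 s \<le> 1" for s using c by (simp add: flat_fun_1)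
  then have "cmod (bump c l u x) \<le> (\<Prod>b\<in>(Basis::'a set). 1)"
    unfolding bump_def prod_norm[symmetric]
    by (intro prod_mono) (auto simp: norm_mult intro!: mult_le_one)
  then show ?thesis using True by simp
qed (simp add: bump_eq_0)

lemma bump_tendsto:
  fixes x :: "'a::euclidean_space"
  shows "(\<lambda>k. bump (1 / Suc k) l u x) \<longlonglongrightarrow> indicator (box l u) x"
proof (cases "x \<in> box l u")
  case True
  have *: "(\<lambda>k. complex_of_real (flat_fun (1 / Suc k) 1 s)) \<longlonglongrightarrow> 1" if "s > 0" for s
  proof -
    have "(\<lambda>k. complex_of_real (exp (- (1 / real (Suc k)) / s))) \<longlonglongrightarrow> of_real (exp (- 0 / s))"
      by (intro tendsto_intros LIMSEQ_Suc lim_1_over_n) (use that in auto)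
    then show ?thesis using that by (simp add: flat_fun_1)
  qed
  have "(\<lambda>k. bump (1 / Suc k) l u x) \<longlonglongrightarrow> (\<Prod>b\<in>(Basis::'a set). 1 * 1)"
    unfolding bump_def using True by (intro tendsto_prod tendsto_mult *) (auto simp: mem_box)
  then show ?thesis using True by simp
qed (simp add: bump_eq_0)

section \<open>Density of test functions\<close>

text \<open>Open boxes are stable under intersection and generate the Borel sets, so Dynkin's
  theorem applies.\<close>

lemma borel_induct_box [consumes 1, case_names box empty compl union]:
  fixes A :: "'a::euclidean_space set"
  assumes "A \<in> sets borel" and "\<And>l u. P (box l u)" and "P {}"
    and "\<And>A. A \<in> sets borel \<Longrightarrow> P A \<Longrightarrow> P (UNIV - A)"
    and "\<And>A. disjoint_family A \<Longrightarrow> range A \<subseteq> sets borel \<Longrightarrow> (\<And>i. P (A i)) \<Longrightarrow> P (\<Union>i::nat. A i)"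
  shows "P A"
proof -
  let ?E = "range (\<lambda>(a, b). box a b :: 'a set)"
  have b: "sets borel = sigma_sets UNIV ?E" by (simp add: borel_eq_box)
  show ?thesis
  proof (rule sigma_sets_induct_disjoint[of ?E UNIV A])
    show "Int_stable ?E" by (auto simp: Int_stable_def box_Int_box)
    show "A \<in> sigma_sets UNIV ?E" using assms(1) b by simp
  qed (use assms(2-5) b in auto)
qed

definition big_box :: "nat \<Rightarrow> 'a::euclidean_space set" where
  "big_box n = box (- (real n *\<^sub>R One)) (real n *\<^sub>R One)"

lemma big_box_sets[measurable]: "big_box n \<in> sets borel"
  by (simp add: big_box_def)

lemma eventually_big_box: "eventually (\<lambda>n. x \<in> big_box n) sequentially"
proof -
  obtain N :: nat where N: "norm x < real N" using reals_Archimedean2 by blast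
  have "x \<in> big_box n" if "n \<ge> N" for n
  proof -
    have "\<bar>x \<bullet> b\<bar> < real n" if "b \<in> Basis" for b
      using Basis_le_norm[OF that, of x] N \<open>n \<ge> N\<close> by linarith
    then show ?thesis by (auto simp: big_box_def mem_box abs_less_iff minus_less_iff)
  qed
  then show ?thesis by (auto simp: eventually_sequentially)
qed

text \<open>The fundamental lemma of the calculus of variations. Bumps tend to indicators of boxes,
  so h integrates to 0 over every box, hence over every Borel set inside a bounded box.\<close>

lemma test_function_separating:
  fixes h :: "'a::euclidean_space \<Rightarrow> complex"
  assumes h: "locally_integrable h" and hm[measurable]: "h \<in> borel_measurable borel"
    and 0: "\<And>\<phi>. test_function \<phi> \<Longrightarrow> (LINT x|lborel. h x * \<phi> x) = 0"
  shows "AE x in lborel. h x = 0"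
proof -
  have ih: "integrable lborel (\<lambda>x. indicator (box l u) x *\<^sub>R h x)" for l u
  proof -
    have "set_integrable lborel (cbox l u) h" using h by (auto simp: locally_integrable_def)
    then have "set_integrable lborel (box l u) h"
      by (rule set_integrable_subset) (auto simp: box_subset_cbox)
    then show ?thesis by (simp add: set_integrable_def)
  qed
  have box0: "(LINT x|lborel. indicator (box l u) x *\<^sub>R h x) = 0" for l u
  proof -
    have [measurable]: "bump (1 / Suc k) l u \<in> borel_measurable borel" for k
      by (intro test_function_measurable test_function_bump) simp
    have "(\<lambda>k. LINT x|lborel. h x * bump (1 / Suc k) l u x) \<longlonglongrightarrow> (LINT x|lborel. indicator (box l u) x *\<^sub>R h x)"
    proof (rule integral_dominated_convergence[OF _ _ integrable_norm[OF ih]])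
      show "AE x in lborel. (\<lambda>k. h x * bump (1 / Suc k) l u x) \<longlonglongrightarrow> indicator (box l u) x *\<^sub>R h x"
      proof (rule AE_I2)
        fix x
        have "(\<lambda>k. h x * bump (1 / Suc k) l u x) \<longlonglongrightarrow> h x * indicator (box l u) x"
          by (intro tendsto_intros bump_tendsto)
        then show "(\<lambda>k. h x * bump (1 / Suc k) l u x) \<longlonglongrightarrow> indicator (box l u) x *\<^sub>R h x"
          by (cases "x \<in> box l u") auto
      qed
      fix k
      show "AE x in lborel. norm (h x * bump (1 / Suc k) l u x) \<le> norm (indicator (box l u) x *\<^sub>R h x)"
      proof (rule AE_I2)
        fix x
        have "cmod (h x) * cmod (bump (1 / Suc k) l u x) \<le> cmod (h x) * indicator (box l u) x"
          by (intro mult_left_mono bump_bounded) auto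
        then show "norm (h x * bump (1 / Suc k) l u x) \<le> norm (indicator (box l u) x *\<^sub>R h x)"
          by (simp add: norm_mult mult.commute)
      qed
    qed measurable
    then show ?thesis by (simp add: 0[OF test_function_bump] LIMSEQ_const_iff)
  qed
  \<comment> \<open>h is only locally integrable; cutting it off to a bounded box makes the
    integrals over complements and countable unions meaningful.\<close>
  have "AE x in lborel. indicator (big_box n) x *\<^sub>R h x = 0" for n
  proof (rule sigma_finite_measure.density_zero[OF sigma_finite_lborel])
    let ?g = "\<lambda>x. indicator (big_box n) x *\<^sub>R h x"
    show ig: "integrable lborel ?g" unfolding big_box_def by (rule ih)
    have iS: "set_integrable lborel A ?g" if "A \<in> sets borel" for A
      unfolding set_integrable_def by (rule integrable_mult_indicator[OF _ ig]) (use that in simp)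
    fix A :: "'a set" assume "A \<in> sets lborel"
    then have "A \<in> sets borel" by simp
    then show "set_lebesgue_integral lborel A ?g = 0"
    proof (induction rule: borel_induct_box)
      case (box l u)
      obtain l' u' where "box l u \<inter> big_box n = box l' u'"
        by (auto simp: big_box_def box_Int_box)
      then have "(\<lambda>x. indicator (box l u) x *\<^sub>R ?g x) = (\<lambda>x. indicator (box l' u') x *\<^sub>R h x)"
        by (auto simp: fun_eq_iff indicator_inter_arith[symmetric])
      then show ?case using box0 by (simp add: set_lebesgue_integral_def)
    next
      case empty
      show ?case by (simp add: set_lebesgue_integral_def)
    next
      case (compl A)
      have "(LINT x:UNIV|lborel. ?g x) = 0"
        using box0 by (simp add: set_lebesgue_integral_def big_box_def)
      moreover have "(LINT x:(UNIV - A) \<union> A|lborel. ?g x) = (LINT x:UNIV - A|lborel. ?g x) + (LINT x:A|lborel. ?g x)"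
        using compl by (intro set_integral_Un iS) auto
      ultimately show ?case using compl by (simp add: Un_absorb2)
    next
      case (union A)
      have "(LINT x:(\<Union>i. A i)|lborel. ?g x) = (\<Sum>i. (LINT x:(A i)|lborel. ?g x))"
        using union by (intro lebesgue_integral_countable_add iS) (auto simp: disjoint_family_on_def)
      then show ?case using union by simp
    qed
  qed
  then have "AE x in lborel. \<forall>n. indicator (big_box n) x *\<^sub>R h x = 0"
    unfolding AE_all_countable by blast
  then show ?thesis
  proof (rule AE_mp, intro AE_I2 impI)
    fix x assume *: "\<forall>n. indicator (big_box n) x *\<^sub>R h x = 0"
    obtain n where "x \<in> big_box n"
      using eventually_happens[OF eventually_big_box[of x]] by auto
    then show "h x = 0" using *[rule_format, of n] by simp
  qed
qed

text \<open>The squared distance in L^2 with weight |\<xi>|; being a square, it obeys the triangle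
  inequality only with factors 2. Its values in \<open>ennreal\<close> allow the comparison of
  functions before integrability is known.\<close>

definition dist2 :: "('a::euclidean_space \<Rightarrow> complex) \<Rightarrow> ('a \<Rightarrow> complex) \<Rightarrow> ennreal" where
  "dist2 F G = (\<integral>\<^sup>+\<xi>. ennreal (norm \<xi> * (cmod (F \<xi> - G \<xi>))\<^sup>2) \<partial>lborel)"

definition approximable :: "('a::euclidean_space \<Rightarrow> complex) \<Rightarrow> bool" where
  "approximable F \<longleftrightarrow> F \<in> borel_measurable borel \<and> (\<forall>e>0. \<exists>\<Phi>. test_function \<Phi> \<and> dist2 F \<Phi> \<le> ennreal e)"

lemma cmod_add_square_le: "(cmod (a + b))\<^sup>2 \<le> 2 * (cmod a)\<^sup>2 + 2 * (cmod b)\<^sup>2"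
proof -
  have "(cmod (a + b))\<^sup>2 \<le> (cmod a + cmod b)\<^sup>2"
    by (intro power_mono norm_triangle_ineq) auto
  also have "\<dots> \<le> 2 * (cmod a)\<^sup>2 + 2 * (cmod b)\<^sup>2"
    using sum_squares_bound[of "cmod a" "cmod b"] by (simp add: power2_sum)
  finally show ?thesis .
qed

lemma nn_integral_add_square_le:
  assumes [measurable]: "a \<in> borel_measurable M" "b \<in> borel_measurable M" "w \<in> borel_measurable M"
    and "\<And>x. 0 \<le> (w x :: real)" and le: "\<And>x. cmod (c x) \<le> cmod (a x + b x :: complex)"
  shows "(\<integral>\<^sup>+x. ennreal (w x * (cmod (c x))\<^sup>2) \<partial>M) \<le>
    2 * (\<integral>\<^sup>+x. ennreal (w x * (cmod (a x))\<^sup>2) \<partial>M) + 2 * (\<integral>\<^sup>+x. ennreal (w x * (cmod (b x))\<^sup>2) \<partial>M)"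
proof -
  have "(\<integral>\<^sup>+x. ennreal (w x * (cmod (c x))\<^sup>2) \<partial>M) \<le>
      (\<integral>\<^sup>+x. 2 * ennreal (w x * (cmod (a x))\<^sup>2) + 2 * ennreal (w x * (cmod (b x))\<^sup>2) \<partial>M)"
  proof (intro nn_integral_mono)
    fix x
    have "(cmod (c x))\<^sup>2 \<le> (cmod (a x + b x))\<^sup>2" by (intro power_mono le) auto
    also have "\<dots> \<le> 2 * (cmod (a x))\<^sup>2 + 2 * (cmod (b x))\<^sup>2" by (rule cmod_add_square_le)
    finally have "w x * (cmod (c x))\<^sup>2 \<le> w x * (2 * (cmod (a x))\<^sup>2 + 2 * (cmod (b x))\<^sup>2)"
      by (intro mult_left_mono assms)
    then have "w x * (cmod (c x))\<^sup>2 \<le> 2 * (w x * (cmod (a x))\<^sup>2) + 2 * (w x * (cmod (b x))\<^sup>2)"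
      by (simp add: algebra_simps)
    then have "ennreal (w x * (cmod (c x))\<^sup>2) \<le> ennreal (2 * (w x * (cmod (a x))\<^sup>2) + 2 * (w x * (cmod (b x))\<^sup>2))"
      by (rule ennreal_leI)
    also have "\<dots> = 2 * ennreal (w x * (cmod (a x))\<^sup>2) + 2 * ennreal (w x * (cmod (b x))\<^sup>2)"
      using assms(4)[of x] by (simp add: ennreal_mult)
    finally show "ennreal (w x * (cmod (c x))\<^sup>2) \<le> 2 * ennreal (w x * (cmod (a x))\<^sup>2) + 2 * ennreal (w x * (cmod (b x))\<^sup>2)" .
  qed
  also have "\<dots> = 2 * (\<integral>\<^sup>+x. ennreal (w x * (cmod (a x))\<^sup>2) \<partial>M) + 2 * (\<integral>\<^sup>+x. ennreal (w x * (cmod (b x))\<^sup>2) \<partial>M)"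
    by (simp add: nn_integral_add nn_integral_cmult)
  finally show ?thesis .
qed

lemma dist2_triangle:
  assumes [measurable]: "F \<in> borel_measurable borel" "G \<in> borel_measurable borel" "H \<in> borel_measurable borel"
  shows "dist2 F H \<le> 2 * dist2 F G + 2 * dist2 G H"
  unfolding dist2_def by (rule nn_integral_add_square_le) auto

lemma approximable_test_function: "test_function \<phi> \<Longrightarrow> approximable \<phi>"
  unfolding approximable_def
  by (auto intro!: test_function_measurable exI[of _ \<phi>] simp: dist2_def)

lemma approximable_limit:
  fixes F :: "'a::euclidean_space \<Rightarrow> complex"
  assumes F[measurable]: "F \<in> borel_measurable borel"
    and "\<And>e. e > 0 \<Longrightarrow> \<exists>G. approximable G \<and> dist2 F G \<le> ennreal e"
  shows "approximable F"
  unfolding approximable_def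
proof (intro conjI F allI impI)
  fix e :: real assume e: "e > 0"
  obtain G where G: "approximable G" "dist2 F G \<le> ennreal (e / 4)"
    \<comment> \<open>The quarters compensate the factors 2 in the triangle inequality for two
      terms.\<close>
    using assms(2)[of "e / 4"] e by auto
  obtain \<Phi> where \<Phi>: "test_function \<Phi>" "dist2 G \<Phi> \<le> ennreal (e / 4)"
    using G(1) e unfolding approximable_def by (metis divide_pos_pos zero_less_numeral)
  have "dist2 F \<Phi> \<le> 2 * dist2 F G + 2 * dist2 G \<Phi>"
    using G \<Phi> F by (intro dist2_triangle) (auto simp: approximable_def intro: test_function_measurable)
  also have "\<dots> \<le> 2 * ennreal (e / 4) + 2 * ennreal (e / 4)"
    by (intro add_mono mult_left_mono G \<Phi>) auto
  also have "\<dots> = ennreal e"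
    using e by (simp add: ennreal_mult[symmetric] ennreal_plus[symmetric] ennreal_numeral[symmetric] del: ennreal_plus ennreal_numeral)
  finally show "\<exists>\<Phi>. test_function \<Phi> \<and> dist2 F \<Phi> \<le> ennreal e" using \<Phi> by blast
qed

lemma approximable_dominated:
  fixes F :: "'a::euclidean_space \<Rightarrow> complex"
  assumes F[measurable]: "F \<in> borel_measurable borel" and G: "\<And>k. approximable (G k)"
    and lim: "\<And>\<xi>. (\<lambda>k. G k \<xi>) \<longlonglongrightarrow> F \<xi>"
    and bd: "\<And>k \<xi>. cmod (F \<xi> - G k \<xi>) \<le> cmod (D \<xi>)" and D[measurable]: "D \<in> borel_measurable borel"
    and fin: "(\<integral>\<^sup>+\<xi>. ennreal (norm \<xi> * (cmod (D \<xi>))\<^sup>2) \<partial>lborel) < \<infinity>"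
  shows "approximable F"
proof (rule approximable_limit[OF F])
  have [measurable]: "G k \<in> borel_measurable borel" for k using G by (simp add: approximable_def)
  have "(\<lambda>k. dist2 F (G k)) \<longlonglongrightarrow> (\<integral>\<^sup>+(\<xi>::'a). 0 \<partial>lborel)"
    unfolding dist2_def
  proof (rule nn_integral_dominated_convergence[OF _ _ _ _ fin])
    show "AE x in lborel. ennreal (norm x * (cmod (F x - G k x))\<^sup>2) \<le> ennreal (norm x * (cmod (D x))\<^sup>2)" for k
      by (intro AE_I2 ennreal_leI mult_left_mono power_mono bd) auto
    show "AE x in lborel. (\<lambda>k. ennreal (norm x * (cmod (F x - G k x))\<^sup>2)) \<longlonglongrightarrow> 0"
    proof (rule AE_I2)
      fix x
      have "(\<lambda>k. ennreal (norm x * (cmod (F x - G k x))\<^sup>2)) \<longlonglongrightarrow> ennreal (norm x * (cmod (F x - F x))\<^sup>2)"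
        by (intro tendsto_ennrealI tendsto_intros lim)
      then show "(\<lambda>k. ennreal (norm x * (cmod (F x - G k x))\<^sup>2)) \<longlonglongrightarrow> 0" by simp
    qed
  qed measurable
  then have lim0: "(\<lambda>k. dist2 F (G k)) \<longlonglongrightarrow> 0" by simp
  fix e :: real assume "e > 0"
  then have "eventually (\<lambda>k. dist2 F (G k) < ennreal e) sequentially"
    using lim0 by (intro order_tendstoD(2)) auto
  then obtain k where "dist2 F (G k) < ennreal e" using eventually_happens by fastforce
  then show "\<exists>G. approximable G \<and> dist2 F G \<le> ennreal e" using G by (auto intro: less_imp_le)
qed

lemma dist2_add:
  assumes [measurable]: "F \<in> borel_measurable borel" "G \<in> borel_measurable borel" "F' \<in> borel_measurable borel" "G' \<in> borel_measurable borel"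
  shows "dist2 (\<lambda>x. F x + G x) (\<lambda>x. F' x + G' x) \<le> 2 * dist2 F F' + 2 * dist2 G G'"
  unfolding dist2_def by (rule nn_integral_add_square_le) (auto simp: algebra_simps)

lemma approximable_add:
  assumes F: "approximable F" and G: "approximable G"
  shows "approximable (\<lambda>x. F x + G x)"
  unfolding approximable_def
proof (intro conjI allI impI)
  show "(\<lambda>x. F x + G x) \<in> borel_measurable borel"
    using F G by (auto simp: approximable_def intro: borel_measurable_add)
  fix e :: real assume e: "e > 0"
  then obtain \<Phi> \<Psi> where \<Phi>: "test_function \<Phi>" "dist2 F \<Phi> \<le> ennreal (e / 4)" and \<Psi>: "test_function \<Psi>" "dist2 G \<Psi> \<le> ennreal (e / 4)"
    using F G unfolding approximable_def by (meson divide_pos_pos zero_less_numeral)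
  have "dist2 (\<lambda>x. F x + G x) (\<lambda>x. \<Phi> x + \<Psi> x) \<le> 2 * dist2 F \<Phi> + 2 * dist2 G \<Psi>"
    using F G \<Phi> \<Psi> by (intro dist2_add) (auto simp: approximable_def intro: test_function_measurable)
  also have "\<dots> \<le> 2 * ennreal (e / 4) + 2 * ennreal (e / 4)"
    by (intro add_mono mult_left_mono \<Phi> \<Psi>) auto
  also have "\<dots> = ennreal e"
    using e by (simp add: ennreal_mult[symmetric] ennreal_plus[symmetric] ennreal_numeral[symmetric] del: ennreal_plus ennreal_numeral)
  finally show "\<exists>\<Phi>. test_function \<Phi> \<and> dist2 (\<lambda>x. F x + G x) \<Phi> \<le> ennreal e"
    using test_function_add[OF \<Phi>(1) \<Psi>(1)] by blast
qed

lemma approximable_cmult: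
  fixes F :: "'a::euclidean_space \<Rightarrow> complex"
  assumes F: "approximable F"
  shows "approximable (\<lambda>x. c * F x)"
proof (cases "c = 0")
  case True
  have "test_function (\<lambda>x::'a. 0)" by (simp add: test_function_iff smooth_const)
  then show ?thesis using True by (simp add: approximable_test_function)
next
  case False
  show ?thesis
    unfolding approximable_def
  proof (intro conjI allI impI)
    have [measurable]: "F \<in> borel_measurable borel" using F by (simp add: approximable_def)
    show "(\<lambda>x. c * F x) \<in> borel_measurable borel" by measurable
    fix e :: real assume e: "e > 0"
    then obtain \<Phi> where \<Phi>: "test_function \<Phi>" "dist2 F \<Phi> \<le> ennreal (e / (cmod c)\<^sup>2)"
      using F False unfolding approximable_def by (metis divide_pos_pos zero_less_norm_iff zero_less_power)
    have [measurable]: "\<Phi> \<in> borel_measurable borel" using \<Phi> by (simp add: test_function_measurable)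
    have "dist2 (\<lambda>x. c * F x) (\<lambda>x. c * \<Phi> x) = (\<integral>\<^sup>+\<xi>. ennreal ((cmod c)\<^sup>2) * ennreal (norm \<xi> * (cmod (F \<xi> - \<Phi> \<xi>))\<^sup>2) \<partial>lborel)"
      unfolding dist2_def right_diff_distrib[symmetric]
      by (intro nn_integral_cong) (simp add: norm_mult power_mult_distrib ennreal_mult[symmetric] mult_ac)
    also have "\<dots> = ennreal ((cmod c)\<^sup>2) * dist2 F \<Phi>"
      unfolding dist2_def by (rule nn_integral_cmult) measurable
    also have "\<dots> \<le> ennreal ((cmod c)\<^sup>2) * ennreal (e / (cmod c)\<^sup>2)"
      by (intro mult_left_mono \<Phi>) auto
    also have "\<dots> = ennreal e" using False e by (simp add: ennreal_mult[symmetric])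
    finally show "\<exists>\<Phi>. test_function \<Phi> \<and> dist2 (\<lambda>x. c * F x) \<Phi> \<le> ennreal e"
      using test_function_cmult[OF \<Phi>(1)] by blast
  qed
qed

lemma approximable_sum:
  fixes F :: "'i \<Rightarrow> 'a::euclidean_space \<Rightarrow> complex"
  assumes "finite I" "\<And>i. i \<in> I \<Longrightarrow> approximable (F i)"
  shows "approximable (\<lambda>x. \<Sum>i\<in>I. F i x)"
  using assms
proof (induction I rule: finite_induct)
  case empty
  show ?case using approximable_cmult[of "\<lambda>x. 0" 0]
    by (simp add: approximable_test_function test_function_iff smooth_const)
qed (auto intro: approximable_add)

lemma box_weight_finite:
  fixes l u :: "'a::euclidean_space"
  shows "(\<integral>\<^sup>+\<xi>. ennreal (norm \<xi> * (cmod (C * indicator (box l u) \<xi>))\<^sup>2) \<partial>lborel) < \<infinity>"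
proof -
  obtain R where R: "R > 0" "\<And>x. x \<in> box l u \<Longrightarrow> norm x \<le> R"
    using bounded_box[of l u] bounded_pos by metis
  have "(\<integral>\<^sup>+\<xi>. ennreal (norm \<xi> * (cmod (C * indicator (box l u) \<xi>))\<^sup>2) \<partial>lborel) \<le>
     (\<integral>\<^sup>+\<xi>. ennreal (R * (cmod C)\<^sup>2) * indicator (box l u) \<xi> \<partial>lborel)"
  proof (intro nn_integral_mono)
    fix \<xi> :: 'a
    show "ennreal (norm \<xi> * (cmod (C * indicator (box l u) \<xi>))\<^sup>2) \<le> ennreal (R * (cmod C)\<^sup>2) * indicator (box l u) \<xi>"
      using R(2)[of \<xi>] by (cases "\<xi> \<in> box l u") (auto intro!: ennreal_leI mult_right_mono)
  qed
  also have "\<dots> < \<infinity>"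
    using emeasure_lborel_box_finite[of l u]
    by (simp add: nn_integral_cmult_indicator ennreal_mult_less_top)
  finally show ?thesis .
qed

lemma approximable_box: "approximable (indicator (box l u))"
proof (rule approximable_dominated[where G = "\<lambda>k. bump (1 / Suc k) l u" and D = "\<lambda>x. 2 * indicator (box l u) x"])
  show "cmod (indicator (box l u) \<xi> - bump (1 / Suc k) l u \<xi>) \<le> cmod (2 * indicator (box l u) \<xi>)" for k \<xi>
    using norm_triangle_ineq4[of "indicator (box l u) \<xi>" "bump (1 / Suc k) l u \<xi>"] bump_bounded[of "1 / Suc k" l u \<xi>]
    by (cases "\<xi> \<in> box l u") (auto simp: bump_eq_0)
  show "approximable (bump (1 / Suc k) l u)" for k
    by (intro approximable_test_function test_function_bump) simp
  show "(\<integral>\<^sup>+\<xi>. ennreal (norm \<xi> * (cmod (2 * indicator (box l u) \<xi>))\<^sup>2) \<partial>lborel) < \<infinity>"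
    by (rule box_weight_finite)
qed (use bump_tendsto in \<open>auto simp: borel_measurable_indicator\<close>)

text \<open>The intersection with a bounded box keeps the weighted norms finite, which complements
  of boxes would not; complements are then taken relative to that box.\<close>

lemma approximable_indicator:
  fixes A :: "'a::euclidean_space set"
  assumes "A \<in> sets borel"
  shows "approximable (indicator (A \<inter> big_box n))"
  using assms
proof (induction rule: borel_induct_box)
  case (box l u)
  then show ?case by (simp add: big_box_def box_Int_box approximable_box)
next
  case empty
  show ?case using approximable_cmult[OF approximable_box, of 0] by simp
next
  case (compl A)
  have eq: "indicator ((UNIV - A) \<inter> big_box n) = (\<lambda>x. indicator (big_box n) x + (- 1) * indicator (A \<inter> big_box n) x :: complex)"
    by (auto simp: fun_eq_iff indicator_def)
  show ?case unfolding eq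
    by (intro approximable_add approximable_cmult compl) (simp add: big_box_def approximable_box)
next
  case (union A)
  have [measurable]: "A i \<in> sets borel" for i using union by auto
  have sum_eq: "(\<Sum>i<k. indicator (A i \<inter> big_box n) x :: complex) = indicator ((\<Union>i<k. A i) \<inter> big_box n) x" for k x
    using union(1)
    by (cases "x \<in> big_box n")
       (auto simp: indicator_UN_disjoint disjoint_family_on_def indicator_inter_arith)
  show ?case
  proof (rule approximable_dominated[where G = "\<lambda>k x. \<Sum>i<k. indicator (A i \<inter> big_box n) x" and D = "\<lambda>x. 1 * indicator (big_box n) x"])
    show "approximable (\<lambda>x. \<Sum>i<k. indicator (A i \<inter> big_box n) x)" for k
      using union by (intro approximable_sum) auto
    show "(\<integral>\<^sup>+\<xi>. ennreal (norm \<xi> * (cmod (1 * indicator (big_box n) \<xi>))\<^sup>2) \<partial>lborel) < \<infinity>"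
      unfolding big_box_def by (rule box_weight_finite)
    fix \<xi> :: 'a
    show "(\<lambda>k. \<Sum>i<k. indicator (A i \<inter> big_box n) \<xi> :: complex) \<longlonglongrightarrow> indicator ((\<Union>i. A i) \<inter> big_box n) \<xi>"
      unfolding sum_eq
    proof (rule tendsto_eventually)
      show "\<forall>\<^sub>F k in sequentially. indicator ((\<Union>i<k. A i) \<inter> big_box n) \<xi> = (indicator ((\<Union>i. A i) \<inter> big_box n) \<xi> :: complex)"
      proof (cases "\<xi> \<in> (\<Union>i. A i)")
        case True
        then obtain i where "\<xi> \<in> A i" by blast
        then show ?thesis
          by (intro eventually_sequentiallyI[of "Suc i"]) (auto simp: indicator_def)
      qed (auto simp: indicator_def)
    qed
    show "cmod (indicator ((\<Union>i. A i) \<inter> big_box n) \<xi> - (\<Sum>i<k. indicator (A i \<inter> big_box n) \<xi>)) \<le> cmod (1 * indicator (big_box n) \<xi>)" for k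
      unfolding sum_eq by (auto simp: indicator_def)
  qed measurable
qed

text \<open>Simple functions, cut off to growing boxes, are combinations of indicators already
  treated. They are bounded by 2 |F|, so 3 |F| dominates the differences.\<close>

theorem approximable_weighted_L2:
  fixes F :: "'a::euclidean_space \<Rightarrow> complex"
  assumes F[measurable]: "F \<in> borel_measurable borel"
    and fin: "(\<integral>\<^sup>+\<xi>. ennreal (norm \<xi> * (cmod (F \<xi>))\<^sup>2) \<partial>lborel) < \<infinity>"
  shows "approximable F"
proof -
  obtain s where s: "\<And>i. simple_function borel (s i)" "\<And>x. (\<lambda>i. s i x) \<longlonglongrightarrow> F x" "\<And>i x. cmod (s i x) \<le> 2 * cmod (F x)"
    using borel_measurable_implies_sequence_metric[OF F, of 0] by auto
  show ?thesis
  proof (rule approximable_dominated[where G = "\<lambda>k x. indicator (big_box k) x * s k x" and D = "\<lambda>x. 3 * F x"])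
    show "(\<integral>\<^sup>+\<xi>. ennreal (norm \<xi> * (cmod (3 * F \<xi>))\<^sup>2) \<partial>lborel) < \<infinity>"
    proof -
      have "(\<integral>\<^sup>+\<xi>. ennreal (norm \<xi> * (cmod (3 * F \<xi>))\<^sup>2) \<partial>lborel) = (\<integral>\<^sup>+\<xi>. 9 * ennreal (norm \<xi> * (cmod (F \<xi>))\<^sup>2) \<partial>lborel)"
        by (intro nn_integral_cong) (simp add: norm_mult power_mult_distrib ennreal_mult' mult_ac)
      also have "\<dots> = 9 * (\<integral>\<^sup>+\<xi>. ennreal (norm \<xi> * (cmod (F \<xi>))\<^sup>2) \<partial>lborel)"
        by (rule nn_integral_cmult) measurable
      finally show ?thesis using fin by (simp add: ennreal_mult_less_top)
    qed
    fix k
    have eq: "(\<lambda>x. indicator (big_box k) x * s k x) = (\<lambda>x. \<Sum>y\<in>range (s k). y * indicator (s k -` {y} \<inter> big_box k) x)"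
    proof
      fix x
      have fin: "finite (range (s k))" using simple_functionD(1)[OF s(1)[of k]] by simp
      have "(\<Sum>y\<in>range (s k). y * indicator (s k -` {y} \<inter> big_box k) x) = (\<Sum>y\<in>range (s k). if y = s k x then s k x * indicator (big_box k) x else 0)"
        by (intro sum.cong refl) (auto simp: indicator_def)
      then show "indicator (big_box k) x * s k x = (\<Sum>y\<in>range (s k). y * indicator (s k -` {y} \<inter> big_box k) x)"
        using fin by (simp add: mult.commute)
    qed
    show "approximable (\<lambda>x. indicator (big_box k) x * s k x)"
      unfolding eq
      using simple_functionD[OF s(1)[of k]]
      by (intro approximable_sum approximable_cmult approximable_indicator) auto
    fix \<xi>
    have "cmod (indicator (big_box k) \<xi> * s k \<xi>) \<le> cmod (s k \<xi>)"
      by (cases "\<xi> \<in> big_box k") auto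
    then show "cmod (F \<xi> - indicator (big_box k) \<xi> * s k \<xi>) \<le> cmod (3 * F \<xi>)"
      using norm_triangle_ineq4[of "F \<xi>" "indicator (big_box k) \<xi> * s k \<xi>"] s(3)[of k \<xi>] by (simp add: norm_mult)
  next
    fix \<xi>
    show "(\<lambda>k. indicator (big_box k) \<xi> * s k \<xi>) \<longlonglongrightarrow> F \<xi>"
      by (rule Lim_transform_eventually[OF s(2)], rule eventually_mono[OF eventually_big_box[of \<xi>]]) simp
  qed measurable
qed

section \<open>Dispersive asymptotics of free waves\<close>

lemma
  fixes f :: "'a::euclidean_space \<Rightarrow> complex"
  assumes [measurable]: "f \<in> borel_measurable borel" and c: "c \<noteq> 0"
  shows lborel_integral_affine: "(LINT x|lborel. f x) = \<bar>c\<bar> ^ DIM('a) *\<^sub>R (LINT x|lborel. f (z + c *\<^sub>R x))"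
  by (subst lborel_affine[OF c, of z])
     (simp add: integral_density integral_distr)

lemma inv_fourier_compose_measurable[measurable (raw)]:
  assumes "\<Phi> \<in> borel_measurable borel" "g \<in> borel_measurable M"
  shows "(\<lambda>x. inv_fourier \<Phi> (g x)) \<in> borel_measurable M"
  by (rule measurable_compose[OF assms(2) inv_fourier_measurable[OF assms(1)]])

text \<open>Fubini and the transform of the complex Gaussian. The parameter a serves two limits: a
  to 0 along the reals gives Fourier inversion, and a to - i s gives the transform of a
  chirp.\<close>

lemma regularized_fourier_inversion:
  fixes \<Phi> :: "'a::euclidean_space \<Rightarrow> complex"
  assumes \<Phi>: "integrable lborel \<Phi>" and a: "Re a > 0"
  shows "(LINT y|lborel. exp (- (of_real pi * a * of_real ((norm y)\<^sup>2))) * cis (- (2 * pi * (y \<bullet> z))) * inv_fourier \<Phi> y) =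
    (1 / csqrt a) ^ DIM('a) * (LINT \<xi>|lborel. exp (- (of_real (pi * (norm (\<xi> - z))\<^sup>2) / a)) * \<Phi> \<xi>)"
proof -
  have [measurable]: "\<Phi> \<in> borel_measurable borel" using \<Phi> by auto
  let ?g = "\<lambda>y::'a. exp (- (of_real pi * a * of_real ((norm y)\<^sup>2)))"
  let ?k = "\<lambda>\<xi> y. exp (- (of_real pi * a * of_real ((norm y)\<^sup>2)) + \<i> * of_real (2 * pi * (y \<bullet> (\<xi> - z))))"
  have "(LINT y|lborel. ?g y * cis (- (2 * pi * (y \<bullet> z))) * inv_fourier \<Phi> y) =
    (LINT y|lborel. LINT \<xi>|lborel. ?k \<xi> y * \<Phi> \<xi>)"
  proof (intro Bochner_Integration.integral_cong refl)
    fix y :: 'a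
    have "?g y * cis (- (2 * pi * (y \<bullet> z))) * inv_fourier \<Phi> y =
      (LINT \<xi>|lborel. (?g y * cis (- (2 * pi * (y \<bullet> z)))) * (cis (2 * pi * (y \<bullet> \<xi>)) * \<Phi> \<xi>))"
      unfolding inv_fourier_def by (rule integral_mult_right_zero[symmetric])
    also have "\<dots> = (LINT \<xi>|lborel. ?k \<xi> y * \<Phi> \<xi>)"
    proof (intro Bochner_Integration.integral_cong refl)
      fix \<xi>
      have "cis (- (2 * pi * (y \<bullet> z))) * cis (2 * pi * (y \<bullet> \<xi>)) = cis (2 * pi * (y \<bullet> (\<xi> - z)))"
        by (simp add: cis_mult inner_diff_right algebra_simps)
      also have "\<dots> = exp (\<i> * of_real (2 * pi * (y \<bullet> (\<xi> - z))))" by (rule cis_conv_exp)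
      finally show "(?g y * cis (- (2 * pi * (y \<bullet> z)))) * (cis (2 * pi * (y \<bullet> \<xi>)) * \<Phi> \<xi>) = ?k \<xi> y * \<Phi> \<xi>"
        unfolding exp_add by (metis mult.assoc)
    qed
    finally show "?g y * cis (- (2 * pi * (y \<bullet> z))) * inv_fourier \<Phi> y = (LINT \<xi>|lborel. ?k \<xi> y * \<Phi> \<xi>)" .
  qed
  also have "\<dots> = (LINT \<xi>|lborel. LINT y|lborel. ?k \<xi> y * \<Phi> \<xi>)"
  proof (rule swap_lebesgue_integrals)
    show "(\<lambda>(y, \<xi>). ?k \<xi> y * \<Phi> \<xi>) \<in> borel_measurable borel"
      unfolding borel_prod[symmetric] by measurable
    show "norm (?k \<xi> y * \<Phi> \<xi>) \<le> cmod (?k 0 y) * cmod (\<Phi> \<xi>)" for y \<xi>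
      by (simp add: norm_mult)
    show "integrable lborel (\<lambda>y. cmod (?k 0 y))"
      by (intro integrable_norm gaussian_fourier_integrable a)
    show "integrable lborel (\<lambda>\<xi>. cmod (\<Phi> \<xi>))" using \<Phi> by simp
  qed
  also have "\<dots> = (LINT \<xi>|lborel. (1 / csqrt a) ^ DIM('a) * (exp (- (of_real (pi * (norm (\<xi> - z))\<^sup>2) / a)) * \<Phi> \<xi>))"
    by (simp only: integral_mult_left_zero gaussian_fourier[OF a]) (simp add: power_divide)
  also have "\<dots> = (1 / csqrt a) ^ DIM('a) * (LINT \<xi>|lborel. exp (- (of_real (pi * (norm (\<xi> - z))\<^sup>2) / a)) * \<Phi> \<xi>)"
    by (rule integral_mult_right_zero)
  finally show ?thesis .
qed

lemma regularized_fourier_limit: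
  fixes f :: "'a::euclidean_space \<Rightarrow> complex"
  assumes f: "integrable lborel f"
  shows "(\<lambda>k. LINT y|lborel. exp (- (of_real pi * (of_real (1 / Suc k) - \<i> * of_real s) * of_real ((norm y)\<^sup>2))) * cis (- (2 * pi * (y \<bullet> z))) * f y)
    \<longlonglongrightarrow> (LINT y|lborel. cis (- (2 * pi * (y \<bullet> z))) * cis (pi * s * (norm y)\<^sup>2) * f y)"
proof (rule integral_dominated_convergence[OF _ _ integrable_norm[OF f]])
  have [measurable]: "f \<in> borel_measurable borel" using f by auto
  show "(\<lambda>y. cis (- (2 * pi * (y \<bullet> z))) * cis (pi * s * (norm y)\<^sup>2) * f y) \<in> borel_measurable lborel"
    by measurable
  show "(\<lambda>y. exp (- (of_real pi * (of_real (1 / Suc k) - \<i> * of_real s) * of_real ((norm y)\<^sup>2))) * cis (- (2 * pi * (y \<bullet> z))) * f y) \<in> borel_measurable lborel" for k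
    by measurable
  show "AE y in lborel. (\<lambda>k. exp (- (of_real pi * (of_real (1 / Suc k) - \<i> * of_real s) * of_real ((norm y)\<^sup>2))) * cis (- (2 * pi * (y \<bullet> z))) * f y)
     \<longlonglongrightarrow> cis (- (2 * pi * (y \<bullet> z))) * cis (pi * s * (norm y)\<^sup>2) * f y"
  proof (rule AE_I2)
    fix y :: 'a
    have "(\<lambda>k. exp (- (of_real pi * (of_real (1 / Suc k) - \<i> * of_real s) * of_real ((norm y)\<^sup>2))) * cis (- (2 * pi * (y \<bullet> z))) * f y)
       \<longlonglongrightarrow> exp (- (of_real pi * (of_real 0 - \<i> * of_real s) * of_real ((norm y)\<^sup>2))) * cis (- (2 * pi * (y \<bullet> z))) * f y"
      by (intro tendsto_intros LIMSEQ_Suc lim_1_over_n)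
    then show "(\<lambda>k. exp (- (of_real pi * (of_real (1 / Suc k) - \<i> * of_real s) * of_real ((norm y)\<^sup>2))) * cis (- (2 * pi * (y \<bullet> z))) * f y)
       \<longlonglongrightarrow> cis (- (2 * pi * (y \<bullet> z))) * cis (pi * s * (norm y)\<^sup>2) * f y"
      by (simp add: cis_conv_exp mult_ac)
  qed
  show "AE y in lborel. norm (exp (- (of_real pi * (of_real (1 / Suc k) - \<i> * of_real s) * of_real ((norm y)\<^sup>2))) * cis (- (2 * pi * (y \<bullet> z))) * f y) \<le> norm (f y)" for k
    by (intro AE_I2) (auto simp: norm_mult intro!: mult_left_le_one_le)
qed

text \<open>For real a the substitution \<xi> = z + sqrt a w turns the right-hand side of the
  regularized formula into an average of \<Phi> near z against a fixed Gaussian of mass 1;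
  continuity of \<Phi> finishes.\<close>

lemma fourier_inversion_test_function:
  fixes \<Phi> :: "'a::euclidean_space \<Rightarrow> complex"
  assumes \<Phi>: "test_function \<Phi>"
  shows "(LINT y|lborel. cis (- (2 * pi * (y \<bullet> z))) * inv_fourier \<Phi> y) = \<Phi> z"
proof -
  have [measurable]: "\<Phi> \<in> borel_measurable borel" by (rule test_function_measurable[OF \<Phi>])
  let ?r = "\<lambda>k. sqrt (1 / real (Suc k))"
  obtain C R where C: "C \<ge> 0" and CR: "\<And>x. cmod (\<Phi> x) \<le> C * indicator (cball 0 R) x"
    using test_function_bounded[OF \<Phi>] by blast
  have C1: "cmod (\<Phi> x) \<le> C" for x
    using CR[of x] C by (cases "norm x \<le> R") auto
  have 1: "(LINT y|lborel. exp (- (of_real pi * (of_real (1 / Suc k) - \<i> * of_real 0) * of_real ((norm y)\<^sup>2))) * cis (- (2 * pi * (y \<bullet> z))) * inv_fourier \<Phi> y)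
     = (LINT w|lborel. of_real (exp (- (pi * (norm w)\<^sup>2))) * \<Phi> (z + ?r k *\<^sub>R w))" for k
  proof -
    have "(LINT \<xi>|lborel. exp (- (of_real (pi * (norm (\<xi> - z))\<^sup>2) / of_real (1 / Suc k))) * \<Phi> \<xi>) =
      ?r k ^ DIM('a) *\<^sub>R (LINT w|lborel. exp (- (of_real (pi * (norm (z + ?r k *\<^sub>R w - z))\<^sup>2) / of_real (1 / Suc k))) * \<Phi> (z + ?r k *\<^sub>R w))"
      by (subst lborel_integral_affine[of _ "?r k" z]) auto
    also have "(\<lambda>w. exp (- (of_real (pi * (norm (z + ?r k *\<^sub>R w - z))\<^sup>2) / of_real (1 / Suc k))) * \<Phi> (z + ?r k *\<^sub>R w)) =
       (\<lambda>w. of_real (exp (- (pi * (norm w)\<^sup>2))) * \<Phi> (z + ?r k *\<^sub>R w))"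
    proof
      fix w :: 'a
      have "pi * (norm (z + ?r k *\<^sub>R w - z))\<^sup>2 / (1 / Suc k) = pi * (norm w)\<^sup>2"
        by (simp add: power_mult_distrib)
      then have "- (complex_of_real (pi * (norm (z + ?r k *\<^sub>R w - z))\<^sup>2) / of_real (1 / Suc k)) = of_real (- (pi * (norm w)\<^sup>2))"
        by (simp only: of_real_divide[symmetric] of_real_minus)
      then show "exp (- (of_real (pi * (norm (z + ?r k *\<^sub>R w - z))\<^sup>2) / of_real (1 / Suc k))) * \<Phi> (z + ?r k *\<^sub>R w) =
         of_real (exp (- (pi * (norm w)\<^sup>2))) * \<Phi> (z + ?r k *\<^sub>R w)"
        by (simp only: exp_of_real)
    qed
    finally have e: "(LINT \<xi>|lborel. exp (- (of_real (pi * (norm (\<xi> - z))\<^sup>2) / of_real (1 / Suc k))) * \<Phi> \<xi>) =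
      ?r k ^ DIM('a) *\<^sub>R (LINT w|lborel. of_real (exp (- (pi * (norm w)\<^sup>2))) * \<Phi> (z + ?r k *\<^sub>R w))" .
    have r: "?r k > 0" by simp
    have cs: "csqrt (of_real (1 / Suc k)) = of_real (?r k)" by (rule csqrt_of_real) simp
    have "(1 / csqrt (of_real (1 / Suc k))) ^ DIM('a) * of_real (?r k ^ DIM('a)) = 1"
      unfolding cs using r by (simp add: power_divide)
    then show ?thesis
      using regularized_fourier_inversion[OF test_function_integrable[OF \<Phi>], of "of_real (1 / Suc k)" z]
      unfolding e by (simp only: scaleR_conv_of_real mult.assoc[symmetric] of_real_0 mult_zero_right diff_zero mult_1) simp
  qed
  have "(\<lambda>k. LINT w|lborel. of_real (exp (- (pi * (norm w)\<^sup>2))) * \<Phi> (z + ?r k *\<^sub>R w))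
     \<longlonglongrightarrow> (LINT w|lborel. of_real (exp (- (pi * (norm (w::'a))\<^sup>2))) * \<Phi> z)"
  proof (rule integral_dominated_convergence[where w = "\<lambda>w. C * exp (- (pi * (norm w)\<^sup>2))"])
    show "integrable lborel (\<lambda>w::'a. C * exp (- (pi * (norm w)\<^sup>2)))"
      by (intro integrable_mult_right integrable_gaussian_weight)
    show "AE w in lborel. (\<lambda>k. of_real (exp (- (pi * (norm w)\<^sup>2))) * \<Phi> (z + ?r k *\<^sub>R w)) \<longlonglongrightarrow> of_real (exp (- (pi * (norm w)\<^sup>2))) * \<Phi> z"
    proof (rule AE_I2, rule tendsto_mult_left)
      fix w :: 'a
      have "isCont \<Phi> z"
        using test_function_continuous[OF \<Phi>, of UNIV] by (simp add: continuous_on_eq_continuous_at)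
      moreover have "(\<lambda>k. z + ?r k *\<^sub>R w) \<longlonglongrightarrow> z + sqrt 0 *\<^sub>R w"
        by (intro tendsto_intros LIMSEQ_Suc lim_1_over_n)
      ultimately show "(\<lambda>k. \<Phi> (z + ?r k *\<^sub>R w)) \<longlonglongrightarrow> \<Phi> z"
        by (intro isCont_tendsto_compose[of z \<Phi>]) auto
    qed
    show "AE w in lborel. norm (of_real (exp (- (pi * (norm w)\<^sup>2))) * \<Phi> (z + ?r k *\<^sub>R w)) \<le> C * exp (- (pi * (norm w)\<^sup>2))" for k
      using C1 by (intro AE_I2) (simp add: norm_mult mult.commute mult_right_mono)
  qed measurable
  also have "(LINT w|lborel. of_real (exp (- (pi * (norm (w::'a))\<^sup>2))) * \<Phi> z) = \<Phi> z"
    using gaussian_cis[of "0::'a"] by simp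
  finally have "(\<lambda>k. LINT y|lborel. exp (- (of_real pi * (of_real (1 / Suc k) - \<i> * of_real 0) * of_real ((norm y)\<^sup>2))) * cis (- (2 * pi * (y \<bullet> z))) * inv_fourier \<Phi> y)
     \<longlonglongrightarrow> \<Phi> z" unfolding 1 .
  from LIMSEQ_unique[OF regularized_fourier_limit[OF inv_fourier_integrable[OF \<Phi>], of 0 z] this]
  show ?thesis by simp
qed

text \<open>The boundary case Re a = 0 of the regularized formula. The limit - i s is off the cut of
  \<open>csqrt\<close>, so the root is continuous there, and \<Phi> itself dominates the oscillatory
  integrals.\<close>

lemma chirp_convolution:
  fixes \<Phi> :: "'a::euclidean_space \<Rightarrow> complex"
  assumes \<Phi>: "test_function \<Phi>" and s: "s \<noteq> 0"
  shows "(LINT y|lborel. cis (- (2 * pi * (y \<bullet> z))) * cis (pi * s * (norm y)\<^sup>2) * inv_fourier \<Phi> y) =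
    (1 / csqrt (- (\<i> * of_real s))) ^ DIM('a) * (LINT \<xi>|lborel. cis (- (pi / s * (norm (\<xi> - z))\<^sup>2)) * \<Phi> \<xi>)"
proof -
  have [measurable]: "\<Phi> \<in> borel_measurable borel" by (rule test_function_measurable[OF \<Phi>])
  let ?a = "\<lambda>k. complex_of_real (1 / Suc k) - \<i> * of_real s"
  let ?c = "- (\<i> * complex_of_real s)"
  have a0: "?c \<noteq> 0" using s by simp
  have "(\<lambda>k. ?a k) \<longlonglongrightarrow> complex_of_real 0 - \<i> * of_real s"
    by (intro tendsto_intros LIMSEQ_Suc lim_1_over_n)
  then have alim: "?a \<longlonglongrightarrow> ?c" by simp
  have Re_a: "Re (?a k) > 0" for k by simp
  have "?c \<notin> \<real>\<^sub>\<le>\<^sub>0" using s by (auto simp: complex_nonpos_Reals_iff)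
  then have "isCont csqrt ?c" by (rule continuous_at_csqrt)
  then have cs: "(\<lambda>k. csqrt (?a k)) \<longlonglongrightarrow> csqrt ?c" using alim by (rule isCont_tendsto_compose)
  have "(\<lambda>k. LINT \<xi>|lborel. exp (- (of_real (pi * (norm (\<xi> - z))\<^sup>2) / ?a k)) * \<Phi> \<xi>)
     \<longlonglongrightarrow> (LINT \<xi>|lborel. exp (- (of_real (pi * (norm (\<xi> - z))\<^sup>2) / ?c)) * \<Phi> \<xi>)"
  proof (rule integral_dominated_convergence[OF _ _ integrable_norm[OF test_function_integrable[OF \<Phi>]]])
    show "AE \<xi> in lborel. (\<lambda>k. exp (- (of_real (pi * (norm (\<xi> - z))\<^sup>2) / ?a k)) * \<Phi> \<xi>) \<longlonglongrightarrow> exp (- (of_real (pi * (norm (\<xi> - z))\<^sup>2) / ?c)) * \<Phi> \<xi>"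
      by (intro AE_I2 tendsto_intros alim a0)
    show "AE \<xi> in lborel. norm (exp (- (of_real (pi * (norm (\<xi> - z))\<^sup>2) / ?a k)) * \<Phi> \<xi>) \<le> norm (\<Phi> \<xi>)" for k
    proof (rule AE_I2)
      fix \<xi>
      have "Re (of_real (pi * (norm (\<xi> - z))\<^sup>2) / ?a k) \<ge> 0"
        using Re_a[of k] unfolding Re_divide_of_real by (simp add: Re_divide)
      then show "norm (exp (- (of_real (pi * (norm (\<xi> - z))\<^sup>2) / ?a k)) * \<Phi> \<xi>) \<le> norm (\<Phi> \<xi>)"
        by (auto simp: norm_mult intro!: mult_left_le_one_le)
    qed
  qed measurable
  then have "(\<lambda>k. (1 / csqrt (?a k)) ^ DIM('a) * (LINT \<xi>|lborel. exp (- (of_real (pi * (norm (\<xi> - z))\<^sup>2) / ?a k)) * \<Phi> \<xi>))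
     \<longlonglongrightarrow> (1 / csqrt ?c) ^ DIM('a) * (LINT \<xi>|lborel. exp (- (of_real (pi * (norm (\<xi> - z))\<^sup>2) / ?c)) * \<Phi> \<xi>)"
    using s by (intro tendsto_intros cs) auto
  moreover have "(\<lambda>k. (1 / csqrt (?a k)) ^ DIM('a) * (LINT \<xi>|lborel. exp (- (of_real (pi * (norm (\<xi> - z))\<^sup>2) / ?a k)) * \<Phi> \<xi>))
     \<longlonglongrightarrow> (LINT y|lborel. cis (- (2 * pi * (y \<bullet> z))) * cis (pi * s * (norm y)\<^sup>2) * inv_fourier \<Phi> y)"
    unfolding regularized_fourier_inversion[OF test_function_integrable[OF \<Phi>] Re_a, symmetric]
    by (rule regularized_fourier_limit[OF inv_fourier_integrable[OF \<Phi>]])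
  ultimately have "(LINT y|lborel. cis (- (2 * pi * (y \<bullet> z))) * cis (pi * s * (norm y)\<^sup>2) * inv_fourier \<Phi> y) =
     (1 / csqrt ?c) ^ DIM('a) * (LINT \<xi>|lborel. exp (- (of_real (pi * (norm (\<xi> - z))\<^sup>2) / ?c)) * \<Phi> \<xi>)"
    using LIMSEQ_unique by blast
  moreover have "exp (- (of_real (pi * (norm (\<xi> - z))\<^sup>2) / ?c)) = cis (- (pi / s * (norm (\<xi> - z))\<^sup>2))" for \<xi>
    using s by (simp add: cis_conv_exp divide_inverse mult_ac)
  ultimately show ?thesis by simp
qed

text \<open>The prefactor (4 pi i t)^(-n/2) exp (i |x|^2 / 4t) of the free Schroedinger kernel;
  \<open>csqrt\<close> fixes the phase of the root for both signs of t.\<close>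

definition dispersive_phase :: "real \<Rightarrow> 'a::euclidean_space \<Rightarrow> complex" where
  "dispersive_phase t x = cis ((norm x)\<^sup>2 / (4 * t)) * csqrt (- (\<i> * of_real (1 / (4 * pi * t)))) ^ DIM('a)"

lemma norm_cis_minus_one_le: "cmod (cis s - 1) \<le> \<bar>s\<bar>" "cmod (cis s - 1) \<le> 2"
proof -
  show "cmod (cis s - 1) \<le> 2"
    using norm_triangle_ineq4[of "cis s" 1] by simp
  show "cmod (cis s - 1) \<le> \<bar>s\<bar>"
    unfolding cis_conv_exp using iexp_approx1[of s 0] by simp
qed


text \<open>Completing the square: with s = 1 / (4 pi t) and z = s x the phase is |x|^2 / 4t - (pi /
  s) |\<xi> - z|^2. The remaining chirp integral is read off from
  \<open>chirp_convolution\<close>.\<close>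

lemma free_wave_dispersion:
  fixes \<Phi> :: "'a::euclidean_space \<Rightarrow> complex"
  assumes \<Phi>: "test_function \<Phi>" and t: "t \<noteq> 0"
  shows "free_wave \<Phi> t x = dispersive_phase t x *
    (LINT y|lborel. cis (- (2 * pi * (y \<bullet> ((1 / (4 * pi * t)) *\<^sub>R x)))) * cis (pi * (1 / (4 * pi * t)) * (norm y)\<^sup>2) * inv_fourier \<Phi> y)"
proof -
  let ?s = "1 / (4 * pi * t)"
  let ?z = "?s *\<^sub>R x"
  have s: "?s \<noteq> 0" using t by simp
  have "free_wave \<Phi> t x = (LINT \<xi>|lborel. cis ((norm x)\<^sup>2 / (4 * t)) * (cis (- (pi / ?s * (norm (\<xi> - ?z))\<^sup>2)) * \<Phi> \<xi>))"
    unfolding free_wave_def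
  proof (intro Bochner_Integration.integral_cong refl)
    fix \<xi>
    have "(norm (\<xi> - ?z))\<^sup>2 = (norm \<xi>)\<^sup>2 - 2 * ?s * (x \<bullet> \<xi>) + ?s\<^sup>2 * (norm x)\<^sup>2"
      unfolding power2_norm_eq_inner
      by (simp add: inner_diff_left inner_diff_right inner_commute power2_eq_square algebra_simps)
    then have "(norm x)\<^sup>2 / (4 * t) + - (pi / ?s * (norm (\<xi> - ?z))\<^sup>2) = 2 * pi * (x \<bullet> \<xi>) - 4 * pi\<^sup>2 * t * (norm \<xi>)\<^sup>2"
      using t by (simp add: power2_eq_square field_simps)
    then have "cis (2 * pi * (x \<bullet> \<xi>) - 4 * pi\<^sup>2 * t * (norm \<xi>)\<^sup>2) = cis ((norm x)\<^sup>2 / (4 * t)) * cis (- (pi / ?s * (norm (\<xi> - ?z))\<^sup>2))"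
      by (simp only: cis_mult)
    then show "cis (2 * pi * (x \<bullet> \<xi>) - 4 * pi\<^sup>2 * t * (norm \<xi>)\<^sup>2) * \<Phi> \<xi> =
      cis ((norm x)\<^sup>2 / (4 * t)) * (cis (- (pi / ?s * (norm (\<xi> - ?z))\<^sup>2)) * \<Phi> \<xi>)"
      by (simp only: mult.assoc)
  qed
  also have "\<dots> = cis ((norm x)\<^sup>2 / (4 * t)) * (LINT \<xi>|lborel. cis (- (pi / ?s * (norm (\<xi> - ?z))\<^sup>2)) * \<Phi> \<xi>)"
    by (rule integral_mult_right_zero)
  also have "(LINT \<xi>|lborel. cis (- (pi / ?s * (norm (\<xi> - ?z))\<^sup>2)) * \<Phi> \<xi>) =
    csqrt (- (\<i> * of_real ?s)) ^ DIM('a) * (LINT y|lborel. cis (- (2 * pi * (y \<bullet> ?z))) * cis (pi * ?s * (norm y)\<^sup>2) * inv_fourier \<Phi> y)"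
  proof -
    have "csqrt (- (\<i> * of_real ?s)) \<noteq> 0" using s by simp
    then have "csqrt (- (\<i> * of_real ?s)) ^ DIM('a) * (1 / csqrt (- (\<i> * of_real ?s))) ^ DIM('a) = 1"
      by (simp add: power_divide)
    then show ?thesis
      unfolding chirp_convolution[OF \<Phi> s, of ?z] by (simp only: mult.assoc[symmetric] mult_1)
  qed
  finally show ?thesis by (simp only: dispersive_phase_def mult.assoc)
qed

lemma norm_dispersive_phase:
  assumes "t \<noteq> 0"
  shows "(cmod (dispersive_phase t (x :: 'a::euclidean_space)))\<^sup>2 = (1 / (4 * pi * \<bar>t\<bar>)) ^ DIM('a)"
proof -
  have "cmod (- (\<i> * complex_of_real (1 / (4 * pi * t)))) = 1 / (4 * pi * \<bar>t\<bar>)"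
    by (simp add: norm_mult norm_divide abs_mult)
  then have "cmod (dispersive_phase t x) = sqrt (1 / (4 * pi * \<bar>t\<bar>)) ^ DIM('a)"
    by (simp only: dispersive_phase_def norm_mult norm_cis norm_power norm_csqrt mult_1)
  then have "(cmod (dispersive_phase t x))\<^sup>2 = ((sqrt (1 / (4 * pi * \<bar>t\<bar>)))\<^sup>2) ^ DIM('a)"
    by (simp only: power_mult[symmetric] mult.commute)
  also have "(sqrt (1 / (4 * pi * \<bar>t\<bar>)))\<^sup>2 = 1 / (4 * pi * \<bar>t\<bar>)"
    by (intro real_sqrt_pow2) simp
  finally show ?thesis .
qed

text \<open>In the rescaled variable \<open>z = x / (4 pi t)\<close> the wave differs from its asymptotic profile by the
  Fourier transform of \<open>(exp (i |y|^2 / 4t) - 1) f(y)\<close>, where \<open>f\<close> is the initial datum.\<close>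

lemma free_wave_asymptotics:
  fixes \<Phi> :: "'a::euclidean_space \<Rightarrow> complex"
  assumes \<Phi>: "test_function \<Phi>"
  shows "\<exists>C\<ge>0. \<forall>t. t \<noteq> 0 \<longrightarrow>
    (\<integral>\<^sup>+x. ennreal ((cmod (free_wave \<Phi> t x - dispersive_phase t x * \<Phi> ((1 / (4 * pi * t)) *\<^sub>R x)))\<^sup>2) \<partial>lborel) \<le> ennreal (C / (1 + t\<^sup>2))"
proof -
  have [measurable]: "\<Phi> \<in> borel_measurable borel" by (rule test_function_measurable[OF \<Phi>])
  let ?f = "inv_fourier \<Phi>"
  note f = inv_fourier_integrable[OF \<Phi>]
  define K0 where "K0 = (LINT y|lborel. (cmod (?f y))\<^sup>2)"
  define K2 where "K2 = (LINT y|lborel. ((norm y)\<^sup>2 * cmod (?f y))\<^sup>2)"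
  have K: "K0 \<ge> 0" "K2 \<ge> 0" by (simp_all add: K0_def K2_def)
  \<comment> \<open>From |cis s - 1| <= 2 comes 4 |f|^2, and from |cis s - 1| <= |s| comes, after
    multiplication by t^2, the second moment. Their sum bounds (1 + t^2) times the error.\<close>
  define C where "C = 4 * K0 + K2"
  show ?thesis
  proof (intro exI[of _ C] conjI allI impI)
    show "C \<ge> 0" using K by (simp add: C_def)
    fix t :: real assume t: "t \<noteq> 0"
    let ?s = "1 / (4 * pi * t)"
    let ?g = "\<lambda>y. (cis (pi * ?s * (norm y)\<^sup>2) - 1) * ?f y"
    have ig: "integrable lborel ?g"
    proof (rule Bochner_Integration.integrable_bound)
      show "integrable lborel (\<lambda>y. 2 * norm (?f y))" using f by simp
      show "AE y in lborel. norm (?g y) \<le> norm (2 * norm (?f y))"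
        by (intro AE_I2) (simp add: norm_mult mult_right_mono norm_cis_minus_one_le)
    qed measurable
    have [measurable]: "?g \<in> borel_measurable borel" by measurable
    have diff: "free_wave \<Phi> t x - dispersive_phase t x * \<Phi> (?s *\<^sub>R x) = dispersive_phase t x * inv_fourier ?g (- (?s *\<^sub>R x))" for x
    proof -
      let ?z = "?s *\<^sub>R x"
      have comm: "- z \<bullet> y = - (y \<bullet> z)" for y z :: 'a by (simp add: inner_commute)
      have i1: "integrable lborel (\<lambda>y. cis (- (2 * pi * (y \<bullet> ?z))) * cis (pi * ?s * (norm y)\<^sup>2) * ?f y)"
        by (rule Bochner_Integration.integrable_bound[OF f]) (measurable, simp add: norm_mult)
      have i2: "integrable lborel (\<lambda>y. cis (- (2 * pi * (y \<bullet> ?z))) * ?f y)"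
        by (rule Bochner_Integration.integrable_bound[OF f]) (measurable, simp add: norm_mult)
      have "free_wave \<Phi> t x - dispersive_phase t x * \<Phi> ?z = dispersive_phase t x *
         ((LINT y|lborel. cis (- (2 * pi * (y \<bullet> ?z))) * cis (pi * ?s * (norm y)\<^sup>2) * ?f y) -
          (LINT y|lborel. cis (- (2 * pi * (y \<bullet> ?z))) * ?f y))"
        unfolding free_wave_dispersion[OF \<Phi> t] fourier_inversion_test_function[OF \<Phi>] by (simp only: right_diff_distrib)
      also have "(LINT y|lborel. cis (- (2 * pi * (y \<bullet> ?z))) * cis (pi * ?s * (norm y)\<^sup>2) * ?f y) -
          (LINT y|lborel. cis (- (2 * pi * (y \<bullet> ?z))) * ?f y) = inv_fourier ?g (- ?z)"
        unfolding inv_fourier_def[of ?g] Bochner_Integration.integral_diff[OF i1 i2, symmetric]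
        by (intro Bochner_Integration.integral_cong refl)
           (simp only: comm mult_minus_right left_diff_distrib right_diff_distrib mult.assoc mult_1)
      finally show ?thesis .
    qed
    have "(\<integral>\<^sup>+x. ennreal ((cmod (free_wave \<Phi> t x - dispersive_phase t x * \<Phi> (?s *\<^sub>R x)))\<^sup>2) \<partial>lborel) =
       (\<integral>\<^sup>+x. ennreal ((1 / (4 * pi * \<bar>t\<bar>)) ^ DIM('a)) * ennreal ((cmod (inv_fourier ?g ((- ?s) *\<^sub>R x)))\<^sup>2) \<partial>lborel)"
      unfolding diff norm_mult power_mult_distrib norm_dispersive_phase[OF t] scaleR_minus_left
      by (intro nn_integral_cong ennreal_mult) auto
    also have "\<dots> = ennreal ((1 / (4 * pi * \<bar>t\<bar>)) ^ DIM('a)) * (\<integral>\<^sup>+x. ennreal ((cmod (inv_fourier ?g ((- ?s) *\<^sub>R x)))\<^sup>2) \<partial>lborel)"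
      by (rule nn_integral_cmult) measurable
    also have "(1 / (4 * pi * \<bar>t\<bar>)) = \<bar>- ?s\<bar>" by (simp add: abs_mult)
    \<comment> \<open>The squared modulus of the dispersive prefactor is exactly the Jacobian of z =
      - s x, so the powers of t disappear.\<close>
    also have "ennreal (\<bar>- ?s\<bar> ^ DIM('a)) * (\<integral>\<^sup>+x. ennreal ((cmod (inv_fourier ?g ((- ?s) *\<^sub>R x)))\<^sup>2) \<partial>lborel) =
       (\<integral>\<^sup>+z. ennreal ((cmod (inv_fourier ?g z))\<^sup>2) \<partial>lborel)"
      by (rule nn_integral_lborel_scale[symmetric]) (measurable, use t in simp)
    also have "\<dots> \<le> (\<integral>\<^sup>+y. ennreal ((cmod (?g y))\<^sup>2) \<partial>lborel)"
      by (rule inv_fourier_bessel[OF ig])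
    also have "\<dots> \<le> (\<integral>\<^sup>+y. ennreal ((4 * (cmod (?f y))\<^sup>2 + ((norm y)\<^sup>2 * cmod (?f y))\<^sup>2) / (1 + t\<^sup>2)) \<partial>lborel)"
    proof (intro nn_integral_mono ennreal_leI)
      fix y :: 'a
      let ?u = "cis (pi * ?s * (norm y)\<^sup>2) - 1"
      have 1: "(cmod ?u)\<^sup>2 \<le> 4"
        using power_mono[OF norm_cis_minus_one_le(2)[of "pi * ?s * (norm y)\<^sup>2"], of 2] by simp
      have eq: "pi * ?s * (norm y)\<^sup>2 = (norm y)\<^sup>2 / (4 * t)" using t by (simp add: field_simps)
      have "(cmod ?u)\<^sup>2 \<le> \<bar>(norm y)\<^sup>2 / (4 * t)\<bar>\<^sup>2"
        unfolding eq by (intro power_mono norm_cis_minus_one_le) auto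
      then have "(cmod ?u)\<^sup>2 \<le> ((norm y)\<^sup>2)\<^sup>2 / (16 * t\<^sup>2)"
        by (simp add: power_divide power_mult_distrib)
      then have "t\<^sup>2 * (cmod ?u)\<^sup>2 \<le> ((norm y)\<^sup>2)\<^sup>2 / 16" using t by (simp add: field_simps)
      then have 2: "t\<^sup>2 * (cmod ?u)\<^sup>2 \<le> ((norm y)\<^sup>2)\<^sup>2" by (rule order_trans) simp
      from 1 2 have "(1 + t\<^sup>2) * (cmod ?u)\<^sup>2 \<le> 4 + ((norm y)\<^sup>2)\<^sup>2" by (simp add: algebra_simps)
      then have "(1 + t\<^sup>2) * (cmod ?u)\<^sup>2 * (cmod (?f y))\<^sup>2 \<le> (4 + ((norm y)\<^sup>2)\<^sup>2) * (cmod (?f y))\<^sup>2"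
        by (rule mult_right_mono) simp
      moreover have "1 + t\<^sup>2 > 0" by (simp add: add_pos_nonneg)
      ultimately show "(cmod (?g y))\<^sup>2 \<le> (4 * (cmod (?f y))\<^sup>2 + ((norm y)\<^sup>2 * cmod (?f y))\<^sup>2) / (1 + t\<^sup>2)"
        by (simp only: norm_mult power_mult_distrib pos_le_divide_eq) (simp add: mult_ac distrib_left distrib_right)
    qed
    also have "\<dots> = ennreal (LINT y|lborel. (4 * (cmod (?f y))\<^sup>2 + ((norm y)\<^sup>2 * cmod (?f y))\<^sup>2) / (1 + t\<^sup>2))"
      using inv_fourier_square_integrable[OF \<Phi>] inv_fourier_second_moment[OF \<Phi>]
      by (intro nn_integral_eq_integral) auto
    also have "(LINT y|lborel. (4 * (cmod (?f y))\<^sup>2 + ((norm y)\<^sup>2 * cmod (?f y))\<^sup>2) / (1 + t\<^sup>2)) = C / (1 + t\<^sup>2)"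
      using inv_fourier_square_integrable[OF \<Phi>] inv_fourier_second_moment[OF \<Phi>]
      by (simp add: C_def K0_def K2_def)
    finally show "(\<integral>\<^sup>+x. ennreal ((cmod (free_wave \<Phi> t x - dispersive_phase t x * \<Phi> (?s *\<^sub>R x)))\<^sup>2) \<partial>lborel) \<le> ennreal (C / (1 + t\<^sup>2))" .
  qed
qed

section \<open>The radial derivative of smooth waves\<close>

text \<open>The best choice is k = sqrt c / sqrt b; the small e keeps both roots positive. In this
  form the triangle inequality can be carried through integrals as a family of linear inequalities,
  and k is optimized only at the end.\<close>

lemma sqrt_le_of_weighted:
  fixes a b c :: real
  assumes "a \<ge> 0" "b \<ge> 0" "c \<ge> 0" and le: "\<And>k. k > 0 \<Longrightarrow> a \<le> (1 + k) * b + (1 + 1 / k) * c"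
  shows "sqrt a \<le> sqrt b + sqrt c"
proof -
  have "sqrt a \<le> sqrt (b + e) + sqrt (c + e)" if e: "e > 0" for e
  proof -
    let ?x = "sqrt (b + e)" and ?y = "sqrt (c + e)"
    have pos: "?x > 0" "?y > 0" using assms e by auto
    have "a \<le> (1 + ?y / ?x) * b + (1 + 1 / (?y / ?x)) * c"
      using pos by (intro le) simp
    also have "\<dots> \<le> (1 + ?y / ?x) * ?x\<^sup>2 + (1 + 1 / (?y / ?x)) * ?y\<^sup>2"
      using pos assms e by (intro add_mono mult_left_mono) auto
    also have "\<dots> = (?x + ?y)\<^sup>2"
      using pos by (simp add: power2_eq_square field_simps)
    finally show ?thesis using pos by (intro real_le_lsqrt) auto
  qed
  then have le: "sqrt a \<le> sqrt (b + 1 / Suc n) + sqrt (c + 1 / Suc n)" for n :: nat by simp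
  have "(\<lambda>n. sqrt (b + 1 / Suc n) + sqrt (c + 1 / Suc n)) \<longlonglongrightarrow> sqrt (b + 0) + sqrt (c + 0)"
    by (intro tendsto_intros LIMSEQ_Suc lim_1_over_n)
  then have "(\<lambda>n. sqrt (b + 1 / Suc n) + sqrt (c + 1 / Suc n)) \<longlonglongrightarrow> sqrt b + sqrt c" by simp
  then show ?thesis
    by (rule LIMSEQ_le_const) (use le in auto)
qed

lemma nn_integral_weighted_triangle:
  fixes u v :: "'a \<Rightarrow> complex"
  assumes [measurable]: "u \<in> borel_measurable M" "v \<in> borel_measurable M" "A \<in> sets M" and k: "k > 0"
  shows "(\<integral>\<^sup>+x\<in>A. ennreal ((cmod (u x))\<^sup>2) \<partial>M) \<le>
    ennreal (1 + k) * (\<integral>\<^sup>+x\<in>A. ennreal ((cmod (v x))\<^sup>2) \<partial>M) + ennreal (1 + 1 / k) * (\<integral>\<^sup>+x\<in>A. ennreal ((cmod (u x - v x))\<^sup>2) \<partial>M)"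
proof -
  have "(\<integral>\<^sup>+x\<in>A. ennreal ((cmod (u x))\<^sup>2) \<partial>M) \<le>
    (\<integral>\<^sup>+x. ennreal (1 + k) * (ennreal ((cmod (v x))\<^sup>2) * indicator A x) + ennreal (1 + 1 / k) * (ennreal ((cmod (u x - v x))\<^sup>2) * indicator A x) \<partial>M)"
  proof (intro nn_integral_mono)
    fix x
    let ?p = "cmod (v x)" and ?q = "cmod (u x - v x)"
    have "(cmod (u x))\<^sup>2 \<le> (?p + ?q)\<^sup>2"
      using norm_triangle_ineq[of "v x" "u x - v x"] by (intro power_mono) auto
    also have "2 * ?p * ?q \<le> k * ?p\<^sup>2 + ?q\<^sup>2 / k"
    proof -
      have "0 \<le> (k * ?p - ?q)\<^sup>2 / k" using k by simp
      then show ?thesis using k by (simp add: power2_eq_square field_simps)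
    qed
    then have "(?p + ?q)\<^sup>2 \<le> (1 + k) * ?p\<^sup>2 + (1 + 1 / k) * ?q\<^sup>2"
      by (simp add: power2_sum algebra_simps)
    finally have "ennreal ((cmod (u x))\<^sup>2) \<le> ennreal ((1 + k) * ?p\<^sup>2 + (1 + 1 / k) * ?q\<^sup>2)"
      by (rule ennreal_leI)
    also have "\<dots> = ennreal (1 + k) * ennreal (?p\<^sup>2) + ennreal (1 + 1 / k) * ennreal (?q\<^sup>2)"
      using k by (subst ennreal_plus) (auto simp: ennreal_mult simp del: ennreal_plus)
    finally show "ennreal ((cmod (u x))\<^sup>2) * indicator A x \<le>
      ennreal (1 + k) * (ennreal (?p\<^sup>2) * indicator A x) + ennreal (1 + 1 / k) * (ennreal (?q\<^sup>2) * indicator A x)"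
      by (cases "x \<in> A") auto
  qed
  also have "\<dots> = ennreal (1 + k) * (\<integral>\<^sup>+x\<in>A. ennreal ((cmod (v x))\<^sup>2) \<partial>M) + ennreal (1 + 1 / k) * (\<integral>\<^sup>+x\<in>A. ennreal ((cmod (u x - v x))\<^sup>2) \<partial>M)"
    by (simp add: nn_integral_add nn_integral_cmult)
  finally show ?thesis .
qed

text \<open>The reverse triangle inequality in L^2 over A. Only v and the difference are assumed to
  be square integrable; finiteness for u is part of the conclusion.\<close>

lemma sqrt_integral_triangle:
  fixes u v :: "'a \<Rightarrow> complex"
  assumes m: "u \<in> borel_measurable M" "v \<in> borel_measurable M" "A \<in> sets M"
    and v: "(\<integral>\<^sup>+x\<in>A. ennreal ((cmod (v x))\<^sup>2) \<partial>M) < \<infinity>"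
    and d: "(\<integral>\<^sup>+x\<in>A. ennreal ((cmod (u x - v x))\<^sup>2) \<partial>M) \<le> ennreal c" and c: "c \<ge> 0"
  shows "(\<integral>\<^sup>+x\<in>A. ennreal ((cmod (u x))\<^sup>2) \<partial>M) < \<infinity>"
    and "\<bar>sqrt (enn2real (\<integral>\<^sup>+x\<in>A. ennreal ((cmod (u x))\<^sup>2) \<partial>M)) - sqrt (enn2real (\<integral>\<^sup>+x\<in>A. ennreal ((cmod (v x))\<^sup>2) \<partial>M))\<bar> \<le> sqrt c"
proof -
  let ?u = "\<integral>\<^sup>+x\<in>A. ennreal ((cmod (u x))\<^sup>2) \<partial>M" and ?v = "\<integral>\<^sup>+x\<in>A. ennreal ((cmod (v x))\<^sup>2) \<partial>M"
  let ?d = "\<integral>\<^sup>+x\<in>A. ennreal ((cmod (u x - v x))\<^sup>2) \<partial>M"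
  have d': "(\<integral>\<^sup>+x\<in>A. ennreal ((cmod (v x - u x))\<^sup>2) \<partial>M) \<le> ennreal c"
    using d by (simp add: norm_minus_commute)
  have *: "p \<le> ennreal (1 + k) * q + ennreal ((1 + 1 / k) * c)"
    if "p \<le> ennreal (1 + k) * q + ennreal (1 + 1 / k) * r" "r \<le> ennreal c" "k > 0" for p q r k
  proof -
    have "ennreal (1 + 1 / k) * r \<le> ennreal ((1 + 1 / k) * c)"
      using that c by (subst ennreal_mult) (auto intro!: mult_left_mono)
    then show ?thesis using that(1) by (meson add_left_mono order_trans)
  qed
  have le1: "?u \<le> ennreal (1 + k) * ?v + ennreal ((1 + 1 / k) * c)" if "k > 0" for k
    by (rule *[OF nn_integral_weighted_triangle[OF m that] d that])
  have le2: "?v \<le> ennreal (1 + k) * ?u + ennreal ((1 + 1 / k) * c)" if "k > 0" for k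
    by (rule *[OF nn_integral_weighted_triangle[OF m(2,1,3) that] d' that])
  have "?u \<le> ennreal (1 + 1) * ?v + ennreal ((1 + 1 / 1) * c)" by (rule le1) simp
  also have "\<dots> < \<infinity>" using v by (simp add: ennreal_mult_less_top)
  finally show u: "?u < \<infinity>" .
  have **: "enn2real p \<le> (1 + k) * enn2real q + (1 + 1 / k) * c"
    if "p \<le> ennreal (1 + k) * q + ennreal ((1 + 1 / k) * c)" "q < \<infinity>" "k > 0" for p q k
  proof -
    have "ennreal (1 + k) * q + ennreal ((1 + 1 / k) * c) = ennreal ((1 + k) * enn2real q + (1 + 1 / k) * c)"
      using that c by (cases q rule: ennreal_cases) (auto simp: ennreal_mult)
    then have "p \<le> ennreal ((1 + k) * enn2real q + (1 + 1 / k) * c)" using that by simp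
    then show ?thesis using c that by (intro enn2real_leI) auto
  qed
  have "sqrt (enn2real ?u) \<le> sqrt (enn2real ?v) + sqrt c"
    by (rule sqrt_le_of_weighted) (use **[OF le1 v] c in auto)
  moreover have "sqrt (enn2real ?v) \<le> sqrt (enn2real ?u) + sqrt c"
    by (rule sqrt_le_of_weighted) (use **[OF le2 u] c in auto)
  ultimately show "\<bar>sqrt (enn2real ?u) - sqrt (enn2real ?v)\<bar> \<le> sqrt c" by linarith
qed

text \<open>The Fourier multiplier of the derivative along b:
  \<open>free_wave (deriv_symbol b F)\<close> stands for that derivative of the wave of F, without
  differentiating an integral.\<close>

definition deriv_symbol :: "'a::euclidean_space \<Rightarrow> ('a \<Rightarrow> complex) \<Rightarrow> 'a \<Rightarrow> complex" where
  "deriv_symbol b F \<xi> = \<i> * of_real (2 * pi * (\<xi> \<bullet> b)) * F \<xi>"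

lemma deriv_symbol_measurable[measurable (raw)]:
  assumes [measurable]: "F \<in> borel_measurable borel"
  shows "deriv_symbol b F \<in> borel_measurable borel"
  unfolding deriv_symbol_def[abs_def] by measurable

lemma deriv_symbol_compose_measurable[measurable (raw)]:
  assumes "F \<in> borel_measurable borel" "g \<in> borel_measurable M"
  shows "(\<lambda>x. deriv_symbol b F (g x)) \<in> borel_measurable M"
  by (rule measurable_compose[OF assms(2) deriv_symbol_measurable[OF assms(1)]])

lemma test_function_deriv_symbol:
  assumes "test_function F" shows "test_function (deriv_symbol b F)"
proof -
  have "test_function (\<lambda>\<xi>. (\<i> * of_real (2 * pi)) * (of_real (\<xi> \<bullet> b) * F \<xi>))"
    by (intro test_function_cmult test_function_smooth_mult[OF smooth_inner] assms)
  then show ?thesis by (simp add: deriv_symbol_def[abs_def] mult_ac)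
qed

lemma sum_deriv_symbol: "(\<Sum>b\<in>Basis. (cmod (deriv_symbol b F \<xi>))\<^sup>2) = 4 * pi\<^sup>2 * (norm \<xi>)\<^sup>2 * (cmod (F \<xi>))\<^sup>2"
  by (simp add: deriv_symbol_def norm_mult power_mult_distrib norm_square_Basis sum_distrib_left sum_distrib_right mult_ac)

text \<open>The factor 4 pi^2 is that of the squared symbol of the gradient, 4 pi^2
  |\<xi>|^2.\<close>

definition smoothing_bound :: "nat \<Rightarrow> real" where
  "smoothing_bound n = 4 * pi\<^sup>2 * exp pi * smoothing_const n"

lemma smoothing_bound_nonneg: "smoothing_bound n \<ge> 0"
  by (simp add: smoothing_bound_def smoothing_const_nonneg)

lemma cylinder_sets[measurable]: "UNIV \<times> ball 0 R \<in> sets (borel :: (real \<times> 'a::euclidean_space) measure)"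
  by (simp add: borel_prod[symmetric])

lemma fst_snd_measurable[measurable]:
  "fst \<in> borel_measurable (borel :: ('a::euclidean_space \<times> 'b::euclidean_space) measure)"
  "snd \<in> borel_measurable (borel :: ('a::euclidean_space \<times> 'b::euclidean_space) measure)"
  by (simp_all add: borel_prod[symmetric])

text \<open>Local smoothing for each component: summed over the axes, |2 pi \<xi>|^2 / |\<xi>|
  leaves the weight |\<xi>| of the Sobolev norm.\<close>

lemma gradient_local_smoothing:
  fixes F :: "'a::euclidean_space \<Rightarrow> complex"
  assumes F[measurable]: "F \<in> borel_measurable borel" and iF: "\<And>b. b \<in> Basis \<Longrightarrow> integrable lborel (deriv_symbol b F)" and R: "R > 0"
  shows "(\<integral>\<^sup>+p\<in>UNIV \<times> ball 0 R. ennreal (\<Sum>b\<in>Basis. (cmod (free_wave (deriv_symbol b F) (fst p) (snd p)))\<^sup>2) \<partial>lborel)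
    \<le> ennreal (smoothing_bound DIM('a) * R) * (\<integral>\<^sup>+\<xi>. ennreal (norm \<xi> * (cmod (F \<xi>))\<^sup>2) \<partial>lborel)"
proof -
  let ?K = "exp pi * smoothing_const DIM('a) * R"
  have "(\<integral>\<^sup>+p\<in>UNIV \<times> ball 0 R. ennreal (\<Sum>b\<in>Basis. (cmod (free_wave (deriv_symbol b F) (fst p) (snd p)))\<^sup>2) \<partial>lborel) =
     (\<Sum>b\<in>Basis. \<integral>\<^sup>+p\<in>UNIV \<times> ball 0 R. ennreal ((cmod (free_wave (deriv_symbol b F) (fst p) (snd p)))\<^sup>2) \<partial>lborel)"
  proof -
    have pt: "ennreal (\<Sum>b\<in>Basis. (g b)\<^sup>2) * i = (\<Sum>b\<in>Basis. ennreal ((g b)\<^sup>2) * i)" for g :: "'a \<Rightarrow> real" and i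
      by (simp only: sum_distrib_right[symmetric]) (simp add: sum_ennreal)
    show ?thesis unfolding pt by (rule nn_integral_sum) measurable
  qed
  also have "\<dots> \<le> (\<Sum>b\<in>(Basis::'a set). ennreal ?K * (\<integral>\<^sup>+\<xi>. ennreal ((cmod (deriv_symbol b F \<xi>))\<^sup>2 / norm \<xi>) \<partial>lborel))"
    by (intro sum_mono free_wave_local_smoothing iF R)
  also have "\<dots> = ennreal ?K * (\<integral>\<^sup>+\<xi>. (\<Sum>b\<in>Basis. ennreal ((cmod (deriv_symbol b F \<xi>))\<^sup>2 / norm \<xi>)) \<partial>lborel)"
    by (subst nn_integral_sum) (measurable, simp add: sum_distrib_left)
  also have "(\<lambda>\<xi>. (\<Sum>b\<in>Basis. ennreal ((cmod (deriv_symbol b F \<xi>))\<^sup>2 / norm \<xi>))) = (\<lambda>\<xi>. ennreal (4 * pi\<^sup>2) * ennreal (norm \<xi> * (cmod (F \<xi>))\<^sup>2))"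
  proof
    fix \<xi> :: 'a
    have "(\<Sum>b\<in>Basis. ennreal ((cmod (deriv_symbol b F \<xi>))\<^sup>2 / norm \<xi>)) = ennreal ((\<Sum>b\<in>Basis. (cmod (deriv_symbol b F \<xi>))\<^sup>2) / norm \<xi>)"
      by (subst sum_ennreal) (auto simp: sum_divide_distrib)
    also have "(\<Sum>b\<in>Basis. (cmod (deriv_symbol b F \<xi>))\<^sup>2) / norm \<xi> = 4 * pi\<^sup>2 * (norm \<xi> * (cmod (F \<xi>))\<^sup>2)"
      unfolding sum_deriv_symbol by (cases "\<xi> = 0") (auto simp: power2_eq_square)
    finally show "(\<Sum>b\<in>Basis. ennreal ((cmod (deriv_symbol b F \<xi>))\<^sup>2 / norm \<xi>)) = ennreal (4 * pi\<^sup>2) * ennreal (norm \<xi> * (cmod (F \<xi>))\<^sup>2)"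
      by (simp add: ennreal_mult)
  qed
  also have "ennreal ?K * (\<integral>\<^sup>+\<xi>. ennreal (4 * pi\<^sup>2) * ennreal (norm \<xi> * (cmod (F \<xi>))\<^sup>2) \<partial>lborel) =
      ennreal (smoothing_bound DIM('a) * R) * (\<integral>\<^sup>+\<xi>. ennreal (norm \<xi> * (cmod (F \<xi>))\<^sup>2) \<partial>lborel)"
  proof -
    have K: "ennreal ?K * ennreal (4 * pi\<^sup>2) = ennreal (smoothing_bound DIM('a) * R)"
      by (subst ennreal_mult[symmetric]) (use R in \<open>auto simp: smoothing_bound_def smoothing_const_nonneg mult_ac\<close>)
    have c: "(\<integral>\<^sup>+\<xi>. ennreal (4 * pi\<^sup>2) * ennreal (norm \<xi> * (cmod (F \<xi>))\<^sup>2) \<partial>lborel) =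
       ennreal (4 * pi\<^sup>2) * (\<integral>\<^sup>+\<xi>. ennreal (norm \<xi> * (cmod (F \<xi>))\<^sup>2) \<partial>lborel)"
      by (rule nn_integral_cmult) measurable
    show ?thesis unfolding c K[symmetric] by (rule mult.assoc[symmetric])
  qed
  finally show ?thesis .
qed

text \<open>Counterpart of \<open>radial_component\<close> for components indexed by basis vectors,
  in any Euclidean space. At x = 0 it is 0 by the convention for division.\<close>

definition radial_sum :: "'a::euclidean_space \<Rightarrow> ('a \<Rightarrow> complex) \<Rightarrow> complex" where
  "radial_sum x e = (\<Sum>b\<in>Basis. of_real ((x \<bullet> b) / norm x) * e b)"

lemma radial_sum_diff: "radial_sum x (\<lambda>b. e b - e' b) = radial_sum x e - radial_sum x e'"
  by (simp add: radial_sum_def right_diff_distrib sum_subtractf)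

lemma radial_sum_le: "(cmod (radial_sum x e))\<^sup>2 \<le> (\<Sum>b\<in>Basis. (cmod (e b))\<^sup>2)"
proof -
  have "cmod (radial_sum x e) \<le> (\<Sum>b\<in>Basis. \<bar>(x \<bullet> b) / norm x\<bar> * cmod (e b))"
    unfolding radial_sum_def by (rule norm_sum[THEN order_trans]) (simp add: norm_mult norm_divide)
  then have "(cmod (radial_sum x e))\<^sup>2 \<le> (\<Sum>b\<in>Basis. \<bar>(x \<bullet> b) / norm x\<bar> * cmod (e b))\<^sup>2"
    by (intro power_mono) auto
  also have "\<dots> \<le> (\<Sum>b\<in>Basis. \<bar>(x \<bullet> b) / norm x\<bar>\<^sup>2) * (\<Sum>b\<in>Basis. (cmod (e b))\<^sup>2)"
    by (rule Cauchy_Schwarz_ineq_sum)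
  also have "(\<Sum>b\<in>Basis. \<bar>(x \<bullet> b) / norm x\<bar>\<^sup>2) = (norm x)\<^sup>2 / (norm x)\<^sup>2"
    by (simp only: power2_abs power_divide sum_divide_distrib[symmetric] norm_square_Basis)
  also have "(norm x)\<^sup>2 / (norm x)\<^sup>2 * (\<Sum>b\<in>Basis. (cmod (e b))\<^sup>2) \<le> 1 * (\<Sum>b\<in>Basis. (cmod (e b))\<^sup>2)"
    by (intro mult_right_mono sum_nonneg) auto
  finally show ?thesis by simp
qed

definition radial_wave :: "('a::euclidean_space \<Rightarrow> complex) \<Rightarrow> real \<times> 'a \<Rightarrow> complex" where
  "radial_wave F p = radial_sum (snd p) (\<lambda>b. free_wave (deriv_symbol b F) (fst p) (snd p))"

lemma radial_wave_measurable[measurable (raw)]: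
  assumes [measurable]: "F \<in> borel_measurable borel"
  shows "radial_wave F \<in> borel_measurable borel"
  unfolding radial_wave_def[abs_def] radial_sum_def by measurable

text \<open>The asymptotic frequency z is parallel to x, so the radial component carries the whole
  gradient of the profile. Hence the limit for the radial part is already the full one.\<close>

lemma radial_profile_norm:
  assumes t: "t \<noteq> 0"
  shows "(cmod (radial_sum x (\<lambda>b. dispersive_phase t x * deriv_symbol b F ((1 / (4 * pi * t)) *\<^sub>R (x::'a::euclidean_space)))))\<^sup>2 =
    (1 / (4 * pi * \<bar>t\<bar>)) ^ DIM('a) * (2 * pi * norm ((1 / (4 * pi * t)) *\<^sub>R x) * cmod (F ((1 / (4 * pi * t)) *\<^sub>R x)))\<^sup>2"
proof -
  let ?s = "1 / (4 * pi * t)"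
  let ?z = "?s *\<^sub>R x"
  have "radial_sum x (\<lambda>b. dispersive_phase t x * deriv_symbol b F ?z) =
    (\<Sum>b\<in>Basis. (dispersive_phase t x * \<i> * F ?z * of_real (2 * pi * ?s)) * of_real ((x \<bullet> b)\<^sup>2 / norm x))"
    unfolding radial_sum_def deriv_symbol_def
    by (intro sum.cong refl) (simp add: power2_eq_square mult_ac)
  also have "\<dots> = (dispersive_phase t x * \<i> * F ?z * of_real (2 * pi * ?s)) * of_real ((norm x)\<^sup>2 / norm x)"
    unfolding sum_distrib_left[symmetric] of_real_sum[symmetric] sum_divide_distrib[symmetric] norm_square_Basis ..
  also have "(norm x)\<^sup>2 / norm x = norm x" by (simp add: power2_eq_square)
  finally have "cmod (radial_sum x (\<lambda>b. dispersive_phase t x * deriv_symbol b F ?z)) =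
     cmod (dispersive_phase t x) * (2 * pi * norm ?z * cmod (F ?z))"
    by (simp add: norm_mult norm_divide abs_mult)
  then show ?thesis by (simp only: power_mult_distrib norm_dispersive_phase[OF t])
qed

text \<open>Frequency z travels with speed 4 pi |z| and stays in the ball during a time interval of
  length R / (2 pi |z|). Multiplied by (2 pi |z| c)^2, this gives the factor 2 pi R of the
  limit.\<close>

lemma time_in_ball:
  assumes R: "R > 0"
  shows "(\<integral>\<^sup>+t. ennreal ((2 * pi * norm z * c)\<^sup>2) * indicator {t. 4 * pi * \<bar>t\<bar> * norm z < R} t \<partial>lborel) =
    ennreal (2 * pi * R) * ennreal (norm z * c\<^sup>2)"
proof (cases "z = 0")
  case False
  let ?r = "R / (4 * pi * norm z)"
  have r: "?r > 0" using False R by simp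
  have "4 * pi * \<bar>t\<bar> * norm z < R \<longleftrightarrow> \<bar>t\<bar> < ?r" for t
    using False by (simp add: pos_less_divide_eq mult_ac)
  then have "{t. 4 * pi * \<bar>t\<bar> * norm z < R} = {t. \<bar>t\<bar> < ?r}" by blast
  also have "\<dots> = {- ?r<..<?r}" by auto
  finally have "{t. 4 * pi * \<bar>t\<bar> * norm z < R} = {- ?r<..<?r}" .
  then have "(\<integral>\<^sup>+t. ennreal ((2 * pi * norm z * c)\<^sup>2) * indicator {t. 4 * pi * \<bar>t\<bar> * norm z < R} t \<partial>lborel) =
     ennreal ((2 * pi * norm z * c)\<^sup>2) * ennreal (2 * ?r)"
    using r by (simp add: nn_integral_cmult_indicator)
  also have "\<dots> = ennreal ((2 * pi * norm z * c)\<^sup>2 * (2 * ?r))"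
    by (rule ennreal_mult[symmetric]) (use r in auto)
  also have "(2 * pi * norm z * c)\<^sup>2 * (2 * ?r) = 2 * pi * R * (norm z * c\<^sup>2)"
    using False by (simp add: power2_eq_square field_simps)
  finally show ?thesis using R by (simp add: ennreal_mult)
qed simp


text \<open>The substitution z = x / (4 pi t) absorbs the dispersive factor. The ball is rewritten
  as a condition on t, ready for exchanging the two integrations.\<close>

lemma radial_profile_integral:
  fixes F :: "'a::euclidean_space \<Rightarrow> complex"
  assumes [measurable]: "F \<in> borel_measurable borel" and t: "t \<noteq> 0"
  shows "(\<integral>\<^sup>+x\<in>ball 0 R. ennreal ((cmod (radial_sum x (\<lambda>b. dispersive_phase t x * deriv_symbol b F ((1 / (4 * pi * t)) *\<^sub>R x))))\<^sup>2) \<partial>lborel) =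
    (\<integral>\<^sup>+z. ennreal ((2 * pi * norm z * cmod (F z))\<^sup>2) * indicator {t. 4 * pi * \<bar>t\<bar> * norm z < R} t \<partial>lborel)"
proof -
  let ?s = "1 / (4 * pi * t)"
  let ?G = "\<lambda>z. ennreal ((2 * pi * norm z * cmod (F z))\<^sup>2) * indicator {t. 4 * pi * \<bar>t\<bar> * norm z < R} t"
  have [measurable]: "?G \<in> borel_measurable borel"
  proof -
    have "?G = (\<lambda>z. ennreal ((2 * pi * norm z * cmod (F z))\<^sup>2) * indicator {z. 4 * pi * \<bar>t\<bar> * norm z < R} z)"
      by (auto simp: indicator_def)
    then show ?thesis by simp
  qed
  have s: "\<bar>?s\<bar> = 1 / (4 * pi * \<bar>t\<bar>)" by (simp add: abs_mult)
  have in_ball: "indicator {t. 4 * pi * \<bar>t\<bar> * norm (?s *\<^sub>R x) < R} t = (indicator (ball 0 R) x :: ennreal)" for x :: 'a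
    using t by (simp add: indicator_def abs_mult)
  have "(\<integral>\<^sup>+x\<in>ball 0 R. ennreal ((cmod (radial_sum x (\<lambda>b. dispersive_phase t x * deriv_symbol b F (?s *\<^sub>R x))))\<^sup>2) \<partial>lborel) =
    (\<integral>\<^sup>+x. ennreal (\<bar>?s\<bar> ^ DIM('a)) * ?G (?s *\<^sub>R x) \<partial>lborel)"
    unfolding radial_profile_norm[OF t] in_ball s
    by (intro nn_integral_cong, subst ennreal_mult) (auto simp: mult.assoc)
  also have "\<dots> = ennreal (\<bar>?s\<bar> ^ DIM('a)) * (\<integral>\<^sup>+x. ?G (?s *\<^sub>R x) \<partial>lborel)"
    by (rule nn_integral_cmult) measurable
  also have "\<dots> = (\<integral>\<^sup>+z. ?G z \<partial>lborel)"
    by (rule nn_integral_lborel_scale[symmetric]) (measurable, use t in simp)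
  finally show ?thesis .
qed

lemma radial_wave_error:
  fixes F :: "'a::euclidean_space \<Rightarrow> complex"
  assumes F: "test_function F"
  shows "\<exists>C\<ge>0. \<forall>t. t \<noteq> 0 \<longrightarrow>
    (\<integral>\<^sup>+x. ennreal ((cmod (radial_wave F (t, x) - radial_sum x (\<lambda>b. dispersive_phase t x * deriv_symbol b F ((1 / (4 * pi * t)) *\<^sub>R x))))\<^sup>2) \<partial>lborel) \<le> ennreal (C / (1 + t\<^sup>2))"
proof -
  have [measurable]: "F \<in> borel_measurable borel" by (rule test_function_measurable[OF F])
  let ?E = "\<lambda>b t x. free_wave (deriv_symbol b F) t x - dispersive_phase t x * deriv_symbol b F ((1 / (4 * pi * t)) *\<^sub>R x)"
  have "\<exists>C. \<forall>b\<in>Basis. C b \<ge> 0 \<and> (\<forall>t. t \<noteq> 0 \<longrightarrow> (\<integral>\<^sup>+x. ennreal ((cmod (?E b t x))\<^sup>2) \<partial>lborel) \<le> ennreal (C b / (1 + t\<^sup>2)))"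
    using free_wave_asymptotics[OF test_function_deriv_symbol[OF F]] by (intro bchoice) blast
  then obtain C where C0: "\<And>b. b \<in> Basis \<Longrightarrow> C b \<ge> 0"
    and C: "\<And>b t. b \<in> Basis \<Longrightarrow> t \<noteq> 0 \<Longrightarrow> (\<integral>\<^sup>+x. ennreal ((cmod (?E b t x))\<^sup>2) \<partial>lborel) \<le> ennreal (C b / (1 + t\<^sup>2))"
    by blast
  show ?thesis
  proof (intro exI[of _ "\<Sum>b\<in>Basis. C b"] conjI allI impI)
    show "(\<Sum>b\<in>Basis. C b) \<ge> 0" by (intro sum_nonneg C0)
    fix t :: real assume t: "t \<noteq> 0"
    have [measurable]: "dispersive_phase t \<in> borel_measurable (borel :: 'a measure)"
      unfolding dispersive_phase_def[abs_def] by measurable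
    have "(\<integral>\<^sup>+x. ennreal ((cmod (radial_wave F (t, x) - radial_sum x (\<lambda>b. dispersive_phase t x * deriv_symbol b F ((1 / (4 * pi * t)) *\<^sub>R x))))\<^sup>2) \<partial>lborel)
      \<le> (\<integral>\<^sup>+x. (\<Sum>b\<in>Basis. ennreal ((cmod (?E b t x))\<^sup>2)) \<partial>lborel)"
    proof (intro nn_integral_mono)
      fix x :: 'a
      have "(cmod (radial_sum x (\<lambda>b. ?E b t x)))\<^sup>2 \<le> (\<Sum>b\<in>Basis. (cmod (?E b t x))\<^sup>2)" by (rule radial_sum_le)
      then show "ennreal ((cmod (radial_wave F (t, x) - radial_sum x (\<lambda>b. dispersive_phase t x * deriv_symbol b F ((1 / (4 * pi * t)) *\<^sub>R x))))\<^sup>2)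
        \<le> (\<Sum>b\<in>Basis. ennreal ((cmod (?E b t x))\<^sup>2))"
        by (subst sum_ennreal) (auto simp: radial_wave_def radial_sum_diff intro!: ennreal_leI)
    qed
    also have "\<dots> = (\<Sum>b\<in>Basis. \<integral>\<^sup>+x. ennreal ((cmod (?E b t x))\<^sup>2) \<partial>lborel)"
      by (rule nn_integral_sum) measurable
    also have "\<dots> \<le> (\<Sum>b\<in>Basis. ennreal (C b / (1 + t\<^sup>2)))"
      by (intro sum_mono C t)
    also have "\<dots> = ennreal ((\<Sum>b\<in>Basis. C b) / (1 + t\<^sup>2))"
      using C0 by (subst sum_ennreal) (auto simp: sum_divide_distrib)
    finally show "(\<integral>\<^sup>+x. ennreal ((cmod (radial_wave F (t, x) - radial_sum x (\<lambda>b. dispersive_phase t x * deriv_symbol b F ((1 / (4 * pi * t)) *\<^sub>R x))))\<^sup>2) \<partial>lborel)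
      \<le> ennreal ((\<Sum>b\<in>Basis. C b) / (1 + t\<^sup>2))" .
  qed
qed

text \<open>The squared error at time t is at most C / (1 + t^2), whose integral over all times is
  finite; hence the constant does not depend on R. The weight k stays free so that the inequalities
  can be integrated in t first.\<close>

lemma radial_wave_weighted_asymptotics:
  fixes F :: "'a::euclidean_space \<Rightarrow> complex"
  assumes F: "test_function F"
  defines "Q \<equiv> \<lambda>R. \<integral>\<^sup>+p\<in>UNIV \<times> ball 0 R. ennreal ((cmod (radial_wave F p))\<^sup>2) \<partial>lborel"
    and "M \<equiv> \<integral>\<^sup>+\<xi>. ennreal (norm \<xi> * (cmod (F \<xi>))\<^sup>2) \<partial>lborel"
  shows "\<exists>C\<ge>0. \<forall>R>0. \<forall>k>0. Q R \<le> ennreal (1 + k) * (ennreal (2 * pi * R) * M) + ennreal (1 + 1 / k) * ennreal C \<and>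
    ennreal (2 * pi * R) * M \<le> ennreal (1 + k) * Q R + ennreal (1 + 1 / k) * ennreal C"
proof -
  have [measurable]: "F \<in> borel_measurable borel" by (rule test_function_measurable[OF F])
  let ?m = "\<lambda>t x. radial_sum x (\<lambda>b. dispersive_phase t x * deriv_symbol b F ((1 / (4 * pi * t)) *\<^sub>R x))"
  obtain C where C: "C \<ge> 0" "\<And>t. t \<noteq> 0 \<Longrightarrow> (\<integral>\<^sup>+x. ennreal ((cmod (radial_wave F (t, x) - ?m t x))\<^sup>2) \<partial>lborel) \<le> ennreal (C / (1 + t\<^sup>2))"
    using radial_wave_error[OF F] by blast
  define C' where "C' = (LINT t|lborel. C / (1 + t\<^sup>2))"
  have iC: "integrable lborel (\<lambda>t::real. C / (1 + t\<^sup>2))"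
    using integrable_mult_right[OF integrable_inverse_1_plus_square_lborel, of C] by simp
  have C'_eq: "(\<integral>\<^sup>+t. ennreal (C / (1 + t\<^sup>2)) \<partial>lborel) = ennreal C'"
    unfolding C'_def using C by (intro nn_integral_eq_integral iC) (auto simp: add_nonneg_nonneg)
  have C'0: "C' \<ge> 0" unfolding C'_def using C by (intro Bochner_Integration.integral_nonneg) (simp add: add_nonneg_nonneg)
  show ?thesis
  proof (intro exI[of _ C'] conjI allI impI C'0)
    fix R k :: real assume R: "R > 0" and k: "k > 0"
    let ?q = "\<lambda>t. \<integral>\<^sup>+x\<in>ball 0 R. ennreal ((cmod (radial_wave F (t, x)))\<^sup>2) \<partial>lborel"
    let ?G = "\<lambda>t z. ennreal ((2 * pi * norm z * cmod (F z))\<^sup>2) * indicator {t. 4 * pi * \<bar>t\<bar> * norm z < R} t"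
    let ?b = "\<lambda>t. \<integral>\<^sup>+z. ?G t z \<partial>lborel"
    have Gm: "(\<lambda>(t, z). ?G t z) \<in> borel_measurable (borel \<Otimes>\<^sub>M borel)"
    proof -
      have "(\<lambda>(t, z). ?G t z) = (\<lambda>p. ennreal ((2 * pi * norm (snd p) * cmod (F (snd p)))\<^sup>2) * indicator {p. 4 * pi * \<bar>fst p\<bar> * norm (snd p) < R} p)"
        by (auto simp: indicator_def fun_eq_iff)
      also have "\<dots> \<in> borel_measurable (borel \<Otimes>\<^sub>M borel)" unfolding borel_prod by measurable
      finally show ?thesis .
    qed
    have bm[measurable]: "?b \<in> borel_measurable borel"
      using Gm by measurable
    have [measurable]: "radial_wave F \<in> borel_measurable (borel \<Otimes>\<^sub>M borel)"
      unfolding borel_prod by measurable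
    have [measurable]: "Measurable.pred (borel \<Otimes>\<^sub>M borel) (\<lambda>x::real \<times> 'a. snd x \<in> ball 0 R)"
      unfolding mem_ball by measurable
    have qm[measurable]: "?q \<in> borel_measurable borel"
      by measurable
    have Q: "Q R = (\<integral>\<^sup>+t. ?q t \<partial>lborel)"
      unfolding Q_def by (subst nn_integral_lborel_pair) (auto simp: indicator_def intro!: nn_integral_cong)
    have bint: "(\<integral>\<^sup>+t. ?b t \<partial>lborel) = ennreal (2 * pi * R) * M"
    proof -
      have "(\<integral>\<^sup>+t. ?b t \<partial>lborel) = (\<integral>\<^sup>+z. \<integral>\<^sup>+t. ?G t z \<partial>lborel \<partial>lborel)"
        by (rule nn_swap) (use Gm in \<open>simp add: borel_prod\<close>)
      also have "\<dots> = (\<integral>\<^sup>+z. ennreal (2 * pi * R) * ennreal (norm z * (cmod (F z))\<^sup>2) \<partial>lborel)"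
        unfolding time_in_ball[OF R] ..
      also have "\<dots> = ennreal (2 * pi * R) * M"
        unfolding M_def by (rule nn_integral_cmult) measurable
      finally show ?thesis .
    qed
    have dm: "?m t \<in> borel_measurable lborel" for t
      unfolding radial_sum_def dispersive_phase_def by measurable
    have wm: "(\<lambda>x. radial_wave F (t, x)) \<in> borel_measurable lborel" for t
      by (simp add: radial_wave_def radial_sum_def)
    have err: "(\<integral>\<^sup>+x\<in>ball 0 R. ennreal ((cmod (radial_wave F (t, x) - ?m t x))\<^sup>2) \<partial>lborel) \<le> ennreal (C / (1 + t\<^sup>2))" if "t \<noteq> 0" for t
      by (rule order_trans[OF nn_integral_mono C(2)[OF that]]) (auto simp: indicator_def)
    have err': "(\<integral>\<^sup>+x\<in>ball 0 R. ennreal ((cmod (?m t x - radial_wave F (t, x)))\<^sup>2) \<partial>lborel) \<le> ennreal (C / (1 + t\<^sup>2))" if "t \<noteq> 0" for t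
      using err[OF that] by (simp add: norm_minus_commute)
    have le1: "?q t \<le> ennreal (1 + k) * ?b t + ennreal (1 + 1 / k) * ennreal (C / (1 + t\<^sup>2))" if t: "t \<noteq> 0" for t
      using nn_integral_weighted_triangle[OF wm[of t] dm[of t] _ k, of "ball 0 R"] mult_left_mono[OF err[OF t], of "ennreal (1 + 1 / k)"]
      unfolding radial_profile_integral[OF \<open>F \<in> borel_measurable borel\<close> t]
      by (auto intro: order_trans add_left_mono)
    have le2: "?b t \<le> ennreal (1 + k) * ?q t + ennreal (1 + 1 / k) * ennreal (C / (1 + t\<^sup>2))" if t: "t \<noteq> 0" for t
      using nn_integral_weighted_triangle[OF dm[of t] wm[of t] _ k, of "ball 0 R"] mult_left_mono[OF err'[OF t], of "ennreal (1 + 1 / k)"]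
      unfolding radial_profile_integral[OF \<open>F \<in> borel_measurable borel\<close> t]
      by (auto intro: order_trans add_left_mono)
    \<comment> \<open>The profile is singular at time 0, a null set.\<close>
    have AE0: "AE t in lborel. t \<noteq> (0::real)" by (rule AE_lborel_singleton)
    have lin: "(\<integral>\<^sup>+t. ennreal (1 + k) * g t + ennreal (1 + 1 / k) * ennreal (C / (1 + t\<^sup>2)) \<partial>lborel) =
       ennreal (1 + k) * (\<integral>\<^sup>+t. g t \<partial>lborel) + ennreal (1 + 1 / k) * ennreal C'"
      if [measurable]: "g \<in> borel_measurable borel" for g
      unfolding C'_eq[symmetric] by (simp add: nn_integral_add nn_integral_cmult)
    have "Q R \<le> (\<integral>\<^sup>+t. ennreal (1 + k) * ?b t + ennreal (1 + 1 / k) * ennreal (C / (1 + t\<^sup>2)) \<partial>lborel)"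
      unfolding Q by (rule nn_integral_mono_AE, rule AE_mp[OF AE0]) (use le1 in auto)
    then show "Q R \<le> ennreal (1 + k) * (ennreal (2 * pi * R) * M) + ennreal (1 + 1 / k) * ennreal C'"
      unfolding lin[OF bm] bint .
    have "ennreal (2 * pi * R) * M \<le> (\<integral>\<^sup>+t. ennreal (1 + k) * ?q t + ennreal (1 + 1 / k) * ennreal (C / (1 + t\<^sup>2)) \<partial>lborel)"
      unfolding bint[symmetric] by (rule nn_integral_mono_AE, rule AE_mp[OF AE0]) (use le2 in auto)
    then show "ennreal (2 * pi * R) * M \<le> ennreal (1 + k) * Q R + ennreal (1 + 1 / k) * ennreal C'"
      unfolding lin[OF qm] Q[symmetric] .
  qed
qed

section \<open>The gradient of rough waves\<close>

text \<open>The increments are at most sqrt w * 2^(-k/2), hence at most sqrt w * (3/4)^k because 1/2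
  <= 9/16; the geometric series has sum 4.\<close>

lemma fast_cauchy_limit:
  fixes x :: "nat \<Rightarrow> complex"
  assumes w: "w \<ge> 0" and le: "\<And>k. 2 ^ k * (cmod (x (Suc k) - x k))\<^sup>2 \<le> w"
  shows "x \<longlonglongrightarrow> lim x" and "cmod (lim x - x k) \<le> 4 * sqrt w"
proof -
  have d: "cmod (x (Suc k) - x k) \<le> sqrt w * (3 / 4) ^ k" for k
  proof -
    have "(cmod (x (Suc k) - x k))\<^sup>2 \<le> w * (1 / 2) ^ k"
      using le[of k] by (simp add: power_divide field_simps)
    also have "\<dots> \<le> w * (9 / 16) ^ k"
      using w by (intro mult_left_mono power_mono) auto
    also have "\<dots> = (sqrt w * (3 / 4) ^ k)\<^sup>2"
    proof -
      have "((3 / 4) ^ k)\<^sup>2 = (9 / 16 :: real) ^ k"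
        by (simp add: power2_eq_square flip: power_mult_distrib)
      then show ?thesis using w by (simp add: power_mult_distrib)
    qed
    finally have "(cmod (x (Suc k) - x k))\<^sup>2 \<le> (sqrt w * (3 / 4) ^ k)\<^sup>2" .
    then show ?thesis by (rule power2_le_imp_le) (use w in simp)
  qed
  have sb: "summable (\<lambda>k. sqrt w * (3 / 4) ^ k)"
    by (intro summable_mult summable_geometric) simp
  have "summable (\<lambda>k. x (Suc k) - x k)"
    by (rule summable_comparison_test'[OF sb]) (use d in simp)
  then have "convergent (\<lambda>n. \<Sum>k<n. x (Suc k) - x k)"
    by (simp add: summable_iff_convergent)
  then have "convergent (\<lambda>n. x n - x 0)" by (simp add: sum_lessThan_telescope)
  then have "convergent (\<lambda>n. (x n - x 0) + x 0)" by (intro convergent_add convergent_const)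
  then show lim: "x \<longlonglongrightarrow> lim x" by (simp add: convergent_LIMSEQ_iff)
  have "cmod (x n - x k) \<le> 4 * sqrt w" if "n \<ge> k" for n
  proof -
    have "x n - x k = (\<Sum>l=k..<n. x (Suc l) - x l)"
      using sum_Suc_diff'[OF that, of x] by simp
    also have "cmod \<dots> \<le> (\<Sum>l=k..<n. sqrt w * (3 / 4) ^ l)"
      by (intro sum_norm_le d)
    also have "\<dots> \<le> (\<Sum>l. sqrt w * (3 / 4) ^ l)"
      using w by (intro sum_le_suminf sb) auto
    also have "\<dots> = sqrt w * 4"
      by (subst suminf_mult) (auto simp: suminf_geometric summable_geometric)
    finally show ?thesis by simp
  qed
  moreover have "(\<lambda>n. cmod (x n - x k)) \<longlonglongrightarrow> cmod (lim x - x k)"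
    by (intro tendsto_intros lim)
  ultimately show "cmod (lim x - x k) \<le> 4 * sqrt w"
    by (intro LIMSEQ_le_const2) auto
qed

lemma free_wave_integrable:
  fixes \<Phi> :: "'a::euclidean_space \<Rightarrow> complex"
  assumes "integrable lborel \<Phi>"
  shows "integrable lborel (\<lambda>\<xi>. cis (2 * pi * (x \<bullet> \<xi>) - 4 * pi\<^sup>2 * t * (norm \<xi>)\<^sup>2) * \<Phi> \<xi>)"
proof (rule Bochner_Integration.integrable_bound[OF assms])
  have [measurable]: "\<Phi> \<in> borel_measurable borel" using assms by auto
  show "(\<lambda>\<xi>. cis (2 * pi * (x \<bullet> \<xi>) - 4 * pi\<^sup>2 * t * (norm \<xi>)\<^sup>2) * \<Phi> \<xi>) \<in> borel_measurable lborel"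
    by measurable
qed (simp add: norm_mult)

lemma free_wave_diff:
  fixes \<Phi> \<Psi> :: "'a::euclidean_space \<Rightarrow> complex"
  assumes "integrable lborel \<Phi>" "integrable lborel \<Psi>"
  shows "free_wave (\<lambda>\<xi>. \<Phi> \<xi> - \<Psi> \<xi>) t x = free_wave \<Phi> t x - free_wave \<Psi> t x"
  unfolding free_wave_def right_diff_distrib
  by (rule Bochner_Integration.integral_diff[OF free_wave_integrable[OF assms(1)] free_wave_integrable[OF assms(2)]])

lemma deriv_symbol_diff: "deriv_symbol b (\<lambda>\<xi>. F \<xi> - G \<xi>) = (\<lambda>\<xi>. deriv_symbol b F \<xi> - deriv_symbol b G \<xi>)"
  by (simp add: deriv_symbol_def fun_eq_iff right_diff_distrib)

lemma free_wave_bounded: "cmod (free_wave \<Phi> t x) \<le> (LINT \<xi>|lborel. cmod (\<Phi> \<xi>))"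
  unfolding free_wave_def by (rule integral_norm_bound[THEN order_trans]) (simp add: norm_mult)

text \<open>Fubini moves the wave onto the test side. The right-hand side still makes sense for
  symbols that are not integrable, and so identifies the limit of the truncations.\<close>

lemma free_wave_pairing:
  fixes \<Phi> \<phi> :: "'a::euclidean_space \<Rightarrow> complex"
  assumes \<Phi>: "integrable lborel \<Phi>" and \<phi>: "integrable lborel \<phi>"
  shows "(LINT x|lborel. free_wave \<Phi> t x * \<phi> x) =
    (LINT \<xi>|lborel. cis (- 4 * pi\<^sup>2 * t * (norm \<xi>)\<^sup>2) * \<Phi> \<xi> * inv_fourier \<phi> \<xi>)"
proof -
  have [measurable]: "\<Phi> \<in> borel_measurable borel" "\<phi> \<in> borel_measurable borel"
    using \<Phi> \<phi> by auto
  have "(LINT x|lborel. free_wave \<Phi> t x * \<phi> x) =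
    (LINT x|lborel. LINT \<xi>|lborel. cis (2 * pi * (x \<bullet> \<xi>) - 4 * pi\<^sup>2 * t * (norm \<xi>)\<^sup>2) * \<Phi> \<xi> * \<phi> x)"
    unfolding free_wave_def by (intro Bochner_Integration.integral_cong refl integral_mult_left_zero[symmetric])
  also have "\<dots> = (LINT \<xi>|lborel. LINT x|lborel. cis (2 * pi * (x \<bullet> \<xi>) - 4 * pi\<^sup>2 * t * (norm \<xi>)\<^sup>2) * \<Phi> \<xi> * \<phi> x)"
  proof (rule swap_lebesgue_integrals[OF _ _ integrable_norm[OF \<phi>] integrable_norm[OF \<Phi>]])
    show "(\<lambda>(x, \<xi>). cis (2 * pi * (x \<bullet> \<xi>) - 4 * pi\<^sup>2 * t * (norm \<xi>)\<^sup>2) * \<Phi> \<xi> * \<phi> x) \<in> borel_measurable borel"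
      unfolding borel_prod[symmetric] by measurable
  qed (simp add: norm_mult)
  also have "\<dots> = (LINT \<xi>|lborel. cis (- 4 * pi\<^sup>2 * t * (norm \<xi>)\<^sup>2) * \<Phi> \<xi> * inv_fourier \<phi> \<xi>)"
  proof (intro Bochner_Integration.integral_cong refl)
    fix \<xi> :: 'a
    have "cis (2 * pi * (x \<bullet> \<xi>) - 4 * pi\<^sup>2 * t * (norm \<xi>)\<^sup>2) = cis (- 4 * pi\<^sup>2 * t * (norm \<xi>)\<^sup>2) * cis (2 * pi * (\<xi> \<bullet> x))" for x
      by (simp add: cis_mult inner_commute)
    then have "(LINT x|lborel. cis (2 * pi * (x \<bullet> \<xi>) - 4 * pi\<^sup>2 * t * (norm \<xi>)\<^sup>2) * \<Phi> \<xi> * \<phi> x) =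
      (LINT x|lborel. (cis (- 4 * pi\<^sup>2 * t * (norm \<xi>)\<^sup>2) * \<Phi> \<xi>) * (cis (2 * pi * (\<xi> \<bullet> x)) * \<phi> x))"
      by (simp only: mult_ac)
    also have "\<dots> = cis (- 4 * pi\<^sup>2 * t * (norm \<xi>)\<^sup>2) * \<Phi> \<xi> * inv_fourier \<phi> \<xi>"
      unfolding inv_fourier_def by (rule integral_mult_right_zero)
    finally show "(LINT x|lborel. cis (2 * pi * (x \<bullet> \<xi>) - 4 * pi\<^sup>2 * t * (norm \<xi>)\<^sup>2) * \<Phi> \<xi> * \<phi> x) =
      cis (- 4 * pi\<^sup>2 * t * (norm \<xi>)\<^sup>2) * \<Phi> \<xi> * inv_fourier \<phi> \<xi>" .
  qed
  finally show ?thesis .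
qed

lemma dist2_sym: "dist2 F G = dist2 G F"
  unfolding dist2_def by (simp add: norm_minus_commute)

lemma gradient_smoothing_diff:
  fixes F G :: "'a::euclidean_space \<Rightarrow> complex"
  assumes [measurable]: "F \<in> borel_measurable borel" "G \<in> borel_measurable borel"
    and iF: "\<And>b. b \<in> Basis \<Longrightarrow> integrable lborel (deriv_symbol b F)"
    and iG: "\<And>b. b \<in> Basis \<Longrightarrow> integrable lborel (deriv_symbol b G)" and R: "R > 0"
  shows "(\<integral>\<^sup>+p\<in>UNIV \<times> ball 0 R. ennreal (\<Sum>b\<in>Basis. (cmod (free_wave (deriv_symbol b F) (fst p) (snd p) - free_wave (deriv_symbol b G) (fst p) (snd p)))\<^sup>2) \<partial>lborel)
    \<le> ennreal (smoothing_bound DIM('a) * R) * dist2 F G"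
proof -
  have "(\<Sum>b\<in>Basis. (cmod (free_wave (deriv_symbol b F) t x - free_wave (deriv_symbol b G) t x))\<^sup>2) =
    (\<Sum>b\<in>Basis. (cmod (free_wave (deriv_symbol b (\<lambda>\<xi>. F \<xi> - G \<xi>)) t x))\<^sup>2)" for t x
    using iF iG by (intro sum.cong refl) (simp add: deriv_symbol_diff free_wave_diff)
  then show ?thesis
    using gradient_local_smoothing[of "\<lambda>\<xi>. F \<xi> - G \<xi>", OF _ _ R] iF iG
    by (simp add: dist2_def deriv_symbol_diff)
qed

text \<open>Truncations of the symbol whose derivatives have integrable symbols, so that their
  gradients are honest integrals. The rate 4^-k leaves room for the weights 2^k that turn L^2
  convergence into convergence almost everywhere.\<close>

locale gradient_approximation =
  fixes F :: "'a::euclidean_space \<Rightarrow> complex" and Fk :: "nat \<Rightarrow> 'a \<Rightarrow> complex"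
  assumes F_meas[measurable]: "F \<in> borel_measurable borel"
    and Fk_meas[measurable]: "\<And>k. Fk k \<in> borel_measurable borel"
    and Fk_int: "\<And>k b. b \<in> Basis \<Longrightarrow> integrable lborel (deriv_symbol b (Fk k))"
    and Fk_le: "\<And>k \<xi>. cmod (Fk k \<xi>) \<le> cmod (F \<xi>)"
    and Fk_lim: "\<And>\<xi>. (\<lambda>k. Fk k \<xi>) \<longlonglongrightarrow> F \<xi>"
    and Fk_dist: "\<And>k. dist2 F (Fk k) \<le> ennreal ((1 / 4) ^ k)"
    and F_fin: "integrable lborel (\<lambda>\<xi>. norm \<xi> * (cmod (F \<xi>))\<^sup>2)"
begin

definition truncated_gradient :: "nat \<Rightarrow> 'a \<Rightarrow> real \<times> 'a \<Rightarrow> complex" where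
  "truncated_gradient k b p = free_wave (deriv_symbol b (Fk k)) (fst p) (snd p)"

definition increment :: "nat \<Rightarrow> real \<times> 'a \<Rightarrow> real" where
  "increment k p = (\<Sum>b\<in>Basis. (cmod (truncated_gradient (Suc k) b p - truncated_gradient k b p))\<^sup>2)"

text \<open>Where this is finite, the truncated gradients converge, with a bound by its square root;
  its integrability also provides the dominating functions below.\<close>

definition weighted_increments :: "real \<times> 'a \<Rightarrow> ennreal" where
  "weighted_increments p = (\<Sum>k. ennreal (2 ^ k * increment k p))"

text \<open>A pointwise limit, hence jointly measurable in t and x. Where the sequence diverges, a
  null set, the value of \<open>lim\<close> carries no meaning.\<close>

definition limit_gradient :: "'a \<Rightarrow> real \<times> 'a \<Rightarrow> complex" where
  "limit_gradient b p = lim (\<lambda>k. truncated_gradient k b p)"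

lemma truncated_gradient_measurable[measurable]: "truncated_gradient k b \<in> borel_measurable borel"
  unfolding truncated_gradient_def[abs_def] by measurable

lemma increment_measurable[measurable]: "increment k \<in> borel_measurable borel"
  unfolding increment_def[abs_def] by measurable

lemma increment_nonneg: "increment k p \<ge> 0"
  by (simp add: increment_def sum_nonneg)

lemma weighted_increments_measurable[measurable]: "weighted_increments \<in> borel_measurable borel"
  unfolding weighted_increments_def[abs_def] by measurable

lemma limit_gradient_measurable[measurable]: "limit_gradient b \<in> borel_measurable borel"
  unfolding limit_gradient_def[abs_def] by measurable

lemma Fk_Suc_dist: "dist2 (Fk (Suc k)) (Fk k) \<le> ennreal (4 * (1 / 4) ^ k)"
proof -
  have "dist2 (Fk (Suc k)) (Fk k) \<le> 2 * dist2 (Fk (Suc k)) F + 2 * dist2 F (Fk k)"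
    by (rule dist2_triangle) measurable
  also have "\<dots> \<le> 2 * ennreal ((1 / 4) ^ k) + 2 * ennreal ((1 / 4) ^ k)"
  proof (intro add_mono mult_left_mono Fk_dist)
    have "dist2 (Fk (Suc k)) F \<le> ennreal ((1 / 4) ^ Suc k)"
      using Fk_dist[of "Suc k"] by (simp add: dist2_sym)
    also have "\<dots> \<le> ennreal ((1 / 4) ^ k)"
      by (intro ennreal_leI power_decreasing) auto
    finally show "dist2 (Fk (Suc k)) F \<le> ennreal ((1 / 4) ^ k)" .
  qed auto
  also have "\<dots> = ennreal (4 * (1 / 4) ^ k)"
    by (simp add: ennreal_mult' flip: distrib_right)
  finally show ?thesis .
qed

text \<open>Local smoothing of the increments: 2^k times 4 * 4^-k is summable.\<close>

lemma weighted_increments_integral: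
  assumes R: "R > 0"
  shows "(\<integral>\<^sup>+p\<in>UNIV \<times> ball 0 R. weighted_increments p \<partial>lborel) < \<infinity>"
proof -
  let ?K = "smoothing_bound DIM('a) * R"
  have K: "?K \<ge> 0" using R by (simp add: smoothing_bound_nonneg)
  have step: "(\<integral>\<^sup>+p. ennreal (2 ^ k * increment k p) * indicator (UNIV \<times> ball 0 R) p \<partial>lborel) \<le> ennreal (?K * 4 * (1 / 2) ^ k)" for k
  proof -
    have "(\<integral>\<^sup>+p. ennreal (2 ^ k * increment k p) * indicator (UNIV \<times> ball 0 R) p \<partial>lborel) =
      ennreal (2 ^ k) * (\<integral>\<^sup>+p\<in>UNIV \<times> ball 0 R. ennreal (increment k p) \<partial>lborel)"
      by (subst nn_integral_cmult[symmetric]) (measurable, simp add: ennreal_mult increment_nonneg mult.assoc)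
    also have "\<dots> \<le> ennreal (2 ^ k) * (ennreal ?K * ennreal (4 * (1 / 4) ^ k))"
      unfolding increment_def truncated_gradient_def
      by (intro mult_left_mono order_trans[OF gradient_smoothing_diff[OF _ _ _ _ R]] Fk_Suc_dist Fk_int Fk_meas) auto
    also have "\<dots> = ennreal (2 ^ k * (?K * (4 * (1 / 4) ^ k)))"
      using K by (simp add: ennreal_mult[symmetric])
    also have "2 ^ k * (?K * (4 * (1 / 4) ^ k)) = ?K * 4 * (2 * (1 / 4)) ^ k"
      unfolding power_mult_distrib by simp
    finally show ?thesis by simp
  qed
  have "(\<integral>\<^sup>+p\<in>UNIV \<times> ball 0 R. weighted_increments p \<partial>lborel) = (\<integral>\<^sup>+p. (\<Sum>k. ennreal (2 ^ k * increment k p) * indicator (UNIV \<times> ball 0 R) p) \<partial>lborel)"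
    unfolding weighted_increments_def by (subst ennreal_suminf_multc) simp
  also have "\<dots> = (\<Sum>k. \<integral>\<^sup>+p. ennreal (2 ^ k * increment k p) * indicator (UNIV \<times> ball 0 R) p \<partial>lborel)"
    by (rule nn_integral_suminf) measurable
  also have "\<dots> \<le> (\<Sum>k. ennreal (?K * 4 * (1 / 2) ^ k))"
    by (intro suminf_le step) auto
  also have "\<dots> < \<infinity>"
  proof -
    have "summable (\<lambda>k. ?K * 4 * (1 / 2) ^ k)"
      by (intro summable_mult summable_geometric) simp
    then have "(\<Sum>k. ennreal (?K * 4 * (1 / 2) ^ k)) \<noteq> top"
      by (rule ennreal_suminf_neq_top) (use K in simp)
    then show ?thesis by (simp add: less_top)
  qed
  finally show ?thesis .
qed

lemma truncated_gradient_limit: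
  assumes weighted_increments: "weighted_increments p < \<infinity>" and b: "b \<in> Basis"
  shows "(\<lambda>k. truncated_gradient k b p) \<longlonglongrightarrow> limit_gradient b p"
    and "cmod (limit_gradient b p - truncated_gradient k b p) \<le> 4 * sqrt (enn2real (weighted_increments p))"
proof -
  have le: "2 ^ k * (cmod (truncated_gradient (Suc k) b p - truncated_gradient k b p))\<^sup>2 \<le> enn2real (weighted_increments p)" for k
  proof -
    have "(cmod (truncated_gradient (Suc k) b p - truncated_gradient k b p))\<^sup>2 \<le> increment k p"
      unfolding increment_def using b by (intro member_le_sum) auto
    then have "2 ^ k * (cmod (truncated_gradient (Suc k) b p - truncated_gradient k b p))\<^sup>2 \<le> 2 ^ k * increment k p"
      by (rule mult_left_mono) simp
    also have "\<dots> \<le> enn2real (weighted_increments p)"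
    proof -
      have "ennreal (2 ^ k * increment k p) \<le> weighted_increments p"
        unfolding weighted_increments_def using sum_le_suminf[of "\<lambda>k. ennreal (2 ^ k * increment k p)" "{k}"] by simp
      then show ?thesis
        using weighted_increments increment_nonneg[of k p] by (metis enn2real_ennreal enn2real_mono infinity_ennreal_def mult_nonneg_nonneg zero_le_numeral zero_le_power)
    qed
    finally show ?thesis .
  qed
  show "(\<lambda>k. truncated_gradient k b p) \<longlonglongrightarrow> limit_gradient b p" "cmod (limit_gradient b p - truncated_gradient k b p) \<le> 4 * sqrt (enn2real (weighted_increments p))"
    using fast_cauchy_limit[OF _ le] unfolding limit_gradient_def by auto
qed

lemma AE_weighted_increments_finite: "AE p in lborel. weighted_increments p < \<infinity>"
proof -
  have "AE p in lborel. weighted_increments p * indicator (UNIV \<times> ball 0 (real (Suc n))) p \<noteq> \<infinity>" for n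
  proof (rule nn_integral_PInf_AE)
    show "(\<integral>\<^sup>+p. weighted_increments p * indicator (UNIV \<times> ball 0 (real (Suc n))) p \<partial>lborel) \<noteq> \<infinity>"
      using weighted_increments_integral[of "real (Suc n)"] by auto
  qed measurable
  then have "AE p in lborel. \<forall>n. weighted_increments p * indicator (UNIV \<times> ball 0 (real (Suc n))) p \<noteq> \<infinity>"
    unfolding AE_all_countable by blast
  then show ?thesis
  proof (rule AE_mp, intro AE_I2 impI)
    fix p :: "real \<times> 'a"
    assume *: "\<forall>n. weighted_increments p * indicator (UNIV \<times> ball 0 (real (Suc n))) p \<noteq> \<infinity>"
    obtain n :: nat where n: "norm (snd p) < real n" using reals_Archimedean2 by blast
    then have "p \<in> UNIV \<times> ball 0 (real (Suc n))" by (cases p) auto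
    then show "weighted_increments p < \<infinity>" using *[rule_format, of n] by (simp add: less_top)
  qed
qed

text \<open>Smoothing for F_k - G passes to the limit by Fatou. Indices are shifted by N so that
  4^-N < e; then F_k and G are both within e of F, and the triangle inequality gives 4 e.\<close>

lemma limit_gradient_approx:
  assumes G: "test_function G" and R: "R > 0" and e: "e > 0" and FG: "dist2 F G \<le> ennreal e"
  shows "(\<integral>\<^sup>+p\<in>UNIV \<times> ball 0 R. ennreal (\<Sum>b\<in>Basis. (cmod (limit_gradient b p - free_wave (deriv_symbol b G) (fst p) (snd p)))\<^sup>2) \<partial>lborel)
    \<le> ennreal (4 * smoothing_bound DIM('a) * R * e)"
proof -
  have [measurable]: "G \<in> borel_measurable borel" by (rule test_function_measurable[OF G])
  let ?K = "smoothing_bound DIM('a) * R"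
  have K: "?K \<ge> 0" using R by (simp add: smoothing_bound_nonneg)
  let ?h = "\<lambda>k p. ennreal (\<Sum>b\<in>Basis. (cmod (truncated_gradient k b p - free_wave (deriv_symbol b G) (fst p) (snd p)))\<^sup>2) * indicator (UNIV \<times> ball 0 R) p"
  obtain N :: nat where N: "(1 / 4) ^ N < e"
    using real_arch_pow_inv[OF e, of "1 / 4"] by auto
  have bd: "(\<integral>\<^sup>+p. ?h (k + N) p \<partial>lborel) \<le> ennreal (4 * smoothing_bound DIM('a) * R * e)" for k
  proof -
    have "dist2 (Fk (k + N)) F \<le> ennreal ((1 / 4) ^ (k + N))" using Fk_dist by (simp add: dist2_sym)
    also have "\<dots> \<le> ennreal e"
    proof (rule ennreal_leI)
      have "(1 / 4) ^ (k + N) \<le> ((1 / 4) ^ N :: real)" by (rule power_decreasing) auto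
      then show "(1 / 4) ^ (k + N) \<le> e" by (rule order_trans[OF _ less_imp_le[OF N]])
    qed
    finally have 1: "dist2 (Fk (k + N)) F \<le> ennreal e" .
    have "(\<integral>\<^sup>+p. ?h (k + N) p \<partial>lborel) \<le> ennreal ?K * dist2 (Fk (k + N)) G"
      unfolding truncated_gradient_def
      by (intro gradient_smoothing_diff Fk_int Fk_meas R test_function_integrable test_function_deriv_symbol G) auto
    also have "\<dots> \<le> ennreal ?K * (2 * dist2 (Fk (k + N)) F + 2 * dist2 F G)"
      by (intro mult_left_mono dist2_triangle) auto
    also have "\<dots> \<le> ennreal ?K * (2 * ennreal e + 2 * ennreal e)"
      by (intro mult_left_mono add_mono 1 FG) auto
    also have "2 * ennreal e + 2 * ennreal e = ennreal (4 * e)"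
      using e by (simp add: ennreal_mult' flip: distrib_right)
    also have "ennreal ?K * ennreal (4 * e) = ennreal (4 * smoothing_bound DIM('a) * R * e)"
      using K e by (simp add: ennreal_mult[symmetric] mult_ac)
    finally show ?thesis .
  qed
  have "(\<integral>\<^sup>+p\<in>UNIV \<times> ball 0 R. ennreal (\<Sum>b\<in>Basis. (cmod (limit_gradient b p - free_wave (deriv_symbol b G) (fst p) (snd p)))\<^sup>2) \<partial>lborel)
     = (\<integral>\<^sup>+p. liminf (\<lambda>k. ?h (k + N) p) \<partial>lborel)"
  proof (rule nn_integral_cong_AE, rule AE_mp[OF AE_weighted_increments_finite], intro AE_I2 impI)
    fix p :: "real \<times> 'a" assume weighted_increments: "weighted_increments p < \<infinity>"
    have "(\<lambda>k. truncated_gradient (k + N) b p) \<longlonglongrightarrow> limit_gradient b p" if "b \<in> Basis" for b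
      using LIMSEQ_ignore_initial_segment[OF truncated_gradient_limit(1)[OF weighted_increments that], of N] .
    then have "(\<lambda>k. ennreal (\<Sum>b\<in>Basis. (cmod (truncated_gradient (k + N) b p - free_wave (deriv_symbol b G) (fst p) (snd p)))\<^sup>2))
       \<longlonglongrightarrow> ennreal (\<Sum>b\<in>Basis. (cmod (limit_gradient b p - free_wave (deriv_symbol b G) (fst p) (snd p)))\<^sup>2)"
      by (intro tendsto_ennrealI tendsto_sum tendsto_power tendsto_norm tendsto_diff tendsto_const) auto
    then have "(\<lambda>k. ?h (k + N) p) \<longlonglongrightarrow> ennreal (\<Sum>b\<in>Basis. (cmod (limit_gradient b p - free_wave (deriv_symbol b G) (fst p) (snd p)))\<^sup>2) * indicator (UNIV \<times> ball 0 R) p"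
      by (cases "p \<in> UNIV \<times> ball 0 R") auto
    then show "ennreal (\<Sum>b\<in>Basis. (cmod (limit_gradient b p - free_wave (deriv_symbol b G) (fst p) (snd p)))\<^sup>2) * indicator (UNIV \<times> ball 0 R) p
       = liminf (\<lambda>k. ?h (k + N) p)"
      by (intro lim_imp_Liminf[symmetric]) auto
  qed
  also have "\<dots> \<le> liminf (\<lambda>k. \<integral>\<^sup>+p. ?h (k + N) p \<partial>lborel)"
    by (rule nn_integral_liminf) measurable
  also have "\<dots> \<le> liminf (\<lambda>k::nat. ennreal (4 * smoothing_bound DIM('a) * R * e))"
    by (rule Liminf_mono) (simp only: bd always_eventually simp_thms)
  finally show ?thesis by (simp add: Liminf_const)
qed

lemma limit_gradient_slice_measurable[measurable]: "(\<lambda>x. limit_gradient b (t, x)) \<in> borel_measurable borel"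
proof -
  have [measurable]: "limit_gradient b \<in> borel_measurable (borel \<Otimes>\<^sub>M borel)" by (simp add: borel_prod)
  show ?thesis by measurable
qed

lemma weighted_increments_slice_measurable[measurable]: "(\<lambda>x. weighted_increments (t, x)) \<in> borel_measurable borel"
proof -
  have [measurable]: "weighted_increments \<in> borel_measurable (borel \<Otimes>\<^sub>M borel)" by (simp add: borel_prod)
  show ?thesis by measurable
qed

lemma weighted_increments_real_slice_measurable: "(\<lambda>x. enn2real (weighted_increments (t, x))) \<in> borel_measurable borel"
  using weighted_increments_slice_measurable[of t] by (rule measurable_compose) measurable

text \<open>Fubini singles out the good times, at which the increments are integrable over every
  ball. At such a time the gradient is a locally integrable function.\<close>

lemma AE_weighted_increments_slice: "AE t in lborel. \<forall>n. (\<integral>\<^sup>+x\<in>ball 0 (real (Suc n)). weighted_increments (t, x) \<partial>lborel) < \<infinity>"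
proof -
  have "AE t in lborel. (\<integral>\<^sup>+x. weighted_increments (t, x) * indicator (UNIV \<times> ball 0 (real (Suc n))) (t, x) \<partial>lborel) \<noteq> \<infinity>" for n
  proof (rule nn_integral_PInf_AE)
    have m: "(\<lambda>p. weighted_increments p * indicator (UNIV \<times> ball 0 (real (Suc n))) p) \<in> borel_measurable (borel \<Otimes>\<^sub>M borel)"
      unfolding borel_prod by measurable
    show "(\<lambda>t. \<integral>\<^sup>+x. weighted_increments (t, x) * indicator (UNIV \<times> ball 0 (real (Suc n))) (t, x) \<partial>lborel) \<in> borel_measurable lborel"
      using lborel.borel_measurable_nn_integral_fst[of "\<lambda>p. weighted_increments p * indicator (UNIV \<times> ball 0 (real (Suc n))) p" borel] m by simp
    have "(\<integral>\<^sup>+p. weighted_increments p * indicator (UNIV \<times> ball 0 (real (Suc n))) p \<partial>lborel) =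
       (\<integral>\<^sup>+t. \<integral>\<^sup>+x. weighted_increments (t, x) * indicator (UNIV \<times> ball 0 (real (Suc n))) (t, x) \<partial>lborel \<partial>lborel)"
      by (rule nn_integral_lborel_pair) measurable
    then show "(\<integral>\<^sup>+t. \<integral>\<^sup>+x. weighted_increments (t, x) * indicator (UNIV \<times> ball 0 (real (Suc n))) (t, x) \<partial>lborel \<partial>lborel) \<noteq> \<infinity>"
      using weighted_increments_integral[of "real (Suc n)"] by auto
  qed
  then have "AE t in lborel. \<forall>n. (\<integral>\<^sup>+x. weighted_increments (t, x) * indicator (UNIV \<times> ball 0 (real (Suc n))) (t, x) \<partial>lborel) \<noteq> \<infinity>"
    unfolding AE_all_countable by blast
  then show ?thesis
    by (rule AE_mp) (auto simp: less_top indicator_def intro!: AE_I2)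
qed

section \<open>The gradient at a fixed good time\<close>

context
  fixes t :: real
  assumes slice: "\<And>n. (\<integral>\<^sup>+x\<in>ball 0 (real (Suc n)). weighted_increments (t, x) \<partial>lborel) < \<infinity>"
begin

lemma AE_weighted_increments_slice_finite: "AE x in lborel. weighted_increments (t, x) < \<infinity>"
proof -
  have "AE x in lborel. weighted_increments (t, x) * indicator (ball 0 (real (Suc n))) x \<noteq> \<infinity>" for n
  proof (rule nn_integral_PInf_AE)
    show "(\<lambda>x. weighted_increments (t, x) * indicator (ball 0 (real (Suc n))) x) \<in> borel_measurable lborel"
      using weighted_increments_slice_measurable[of t] by (intro borel_measurable_times_ennreal borel_measurable_indicator) auto
    show "(\<integral>\<^sup>+x. weighted_increments (t, x) * indicator (ball 0 (real (Suc n))) x \<partial>lborel) \<noteq> \<infinity>"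
      using slice[of n] by auto
  qed
  then have "AE x in lborel. \<forall>n. weighted_increments (t, x) * indicator (ball 0 (real (Suc n))) x \<noteq> \<infinity>"
    unfolding AE_all_countable by blast
  then show ?thesis
  proof (rule AE_mp, intro AE_I2 impI)
    fix x :: 'a
    assume *: "\<forall>n. weighted_increments (t, x) * indicator (ball 0 (real (Suc n))) x \<noteq> \<infinity>"
    obtain n :: nat where n: "norm x < real n" using reals_Archimedean2 by blast
    then have "x \<in> ball 0 (real (Suc n))" by auto
    then show "weighted_increments (t, x) < \<infinity>" using *[rule_format, of n] by (simp add: less_top)
  qed
qed

lemma dominating_integrable: "integrable lborel (\<lambda>x. C * (indicator (ball 0 (real (Suc n))) x * (B + 8 * enn2real (weighted_increments (t, x)))))"
proof -
  have 1: "integrable lborel (\<lambda>x. indicator (ball 0 (real (Suc n))) x * enn2real (weighted_increments (t, x)))"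
  proof (rule integrableI_bounded)
    have "(\<integral>\<^sup>+x. ennreal (norm (indicator (ball 0 (real (Suc n))) x * enn2real (weighted_increments (t, x)))) \<partial>lborel) \<le>
       (\<integral>\<^sup>+x\<in>ball 0 (real (Suc n)). weighted_increments (t, x) \<partial>lborel)"
    proof (intro nn_integral_mono)
      fix x
      show "ennreal (norm (indicator (ball 0 (real (Suc n))) x * enn2real (weighted_increments (t, x)))) \<le> weighted_increments (t, x) * indicator (ball 0 (real (Suc n))) x"
        by (cases "x \<in> ball 0 (real (Suc n))"; cases "weighted_increments (t, x)" rule: ennreal_cases) auto
    qed
    also have "\<dots> < \<infinity>" by (rule slice)
    finally show "(\<integral>\<^sup>+x. ennreal (norm (indicator (ball 0 (real (Suc n))) x * enn2real (weighted_increments (t, x)))) \<partial>lborel) < \<infinity>" .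
    show "(\<lambda>x. indicator (ball 0 (real (Suc n))) x * enn2real (weighted_increments (t, x))) \<in> borel_measurable lborel"
      using weighted_increments_real_slice_measurable[of t] by (intro borel_measurable_times borel_measurable_indicator) auto
  qed
  have 2: "integrable lborel (indicator (ball 0 (real (Suc n))) :: 'a \<Rightarrow> real)"
    using emeasure_compact_finite[OF compact_cball, of 0 "real (Suc n)"] emeasure_mono[OF ball_subset_cball, of 0 "real (Suc n)" "lborel :: 'a measure"]
    by (intro integrable_real_indicator) (auto intro: le_less_trans)
  have "integrable lborel (\<lambda>x. C * (B * indicator (ball 0 (real (Suc n))) x + 8 * (indicator (ball 0 (real (Suc n))) x * enn2real (weighted_increments (t, x)))))"
    by (intro integrable_mult_right Bochner_Integration.integrable_add 1 2)
  then show ?thesis by (simp add: algebra_simps)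
qed

text \<open>The truncation F_0 has a bounded gradient, and passing to the limit or back to step k
  costs 4 sqrt w each time. The estimate sqrt w <= 1 + w makes the bound linear in the integrable w;
  this is where the two constants 8 come from.\<close>

lemma slice_bound:
  assumes weighted_increments: "weighted_increments (t, x) < \<infinity>" and b: "b \<in> Basis"
  defines "B \<equiv> (LINT \<xi>|lborel. cmod (deriv_symbol b (Fk 0) \<xi>)) + 8"
  shows "cmod (limit_gradient b (t, x)) \<le> B + 8 * enn2real (weighted_increments (t, x))"
    and "cmod (truncated_gradient k b (t, x)) \<le> B + 8 * enn2real (weighted_increments (t, x))"
proof -
  let ?w = "enn2real (weighted_increments (t, x))"
  have s: "sqrt ?w \<le> 1 + ?w"
  proof -
    have "?w \<le> (1 + ?w)\<^sup>2" by (simp add: power2_sum add_increasing)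
    then show ?thesis by (intro real_le_lsqrt) auto
  qed
  have 0: "cmod (truncated_gradient 0 b (t, x)) \<le> (LINT \<xi>|lborel. cmod (deriv_symbol b (Fk 0) \<xi>))"
    by (simp add: truncated_gradient_def free_wave_bounded)
  have 1: "cmod (limit_gradient b (t, x)) \<le> cmod (truncated_gradient 0 b (t, x)) + 4 * sqrt ?w"
    using truncated_gradient_limit(2)[OF weighted_increments b, of 0] norm_triangle_sub[of "limit_gradient b (t, x)" "truncated_gradient 0 b (t, x)"] by linarith
  have 2: "cmod (truncated_gradient k b (t, x)) \<le> cmod (limit_gradient b (t, x)) + 4 * sqrt ?w"
    using truncated_gradient_limit(2)[OF weighted_increments b, of k] norm_triangle_sub[of "truncated_gradient k b (t, x)" "limit_gradient b (t, x)"]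
    by (simp add: norm_minus_commute)
  have "0 \<le> ?w" by simp
  then show "cmod (limit_gradient b (t, x)) \<le> B + 8 * ?w" "cmod (truncated_gradient k b (t, x)) \<le> B + 8 * ?w"
    using 0 1 2 s unfolding B_def by linarith+
qed

lemma limit_gradient_locally_integrable:
  assumes b: "b \<in> Basis"
  shows "locally_integrable (\<lambda>x. limit_gradient b (t, x))"
  unfolding locally_integrable_def
proof (intro allI impI)
  fix K :: "'a set" assume K: "compact K"
  obtain r where "\<And>x. x \<in> K \<Longrightarrow> norm x \<le> r" using compact_imp_bounded[OF K] by (auto simp: bounded_iff)
  moreover obtain n :: nat where "r < real n" using reals_Archimedean2 by blast
  ultimately have Kn: "K \<subseteq> ball 0 (real (Suc n))" by force
  let ?B = "(LINT \<xi>|lborel. cmod (deriv_symbol b (Fk 0) \<xi>)) + 8"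
  have [measurable]: "K \<in> sets borel" using K by (simp add: borel_compact)
  show "set_integrable lborel K (\<lambda>x. limit_gradient b (t, x))"
    unfolding set_integrable_def
  proof (rule Bochner_Integration.integrable_bound[OF dominating_integrable[of 1 n ?B]])
    show "AE x in lborel. norm (indicator K x *\<^sub>R limit_gradient b (t, x)) \<le>
      norm (1 * (indicator (ball 0 (real (Suc n))) x * (?B + 8 * enn2real (weighted_increments (t, x)))))"
    proof (rule AE_mp[OF AE_weighted_increments_slice_finite], intro AE_I2 impI)
      fix x assume "weighted_increments (t, x) < \<infinity>"
      from slice_bound(1)[OF this b] Kn
      show "norm (indicator K x *\<^sub>R limit_gradient b (t, x)) \<le>
        norm (1 * (indicator (ball 0 (real (Suc n))) x * (?B + 8 * enn2real (weighted_increments (t, x)))))"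
        by (cases "x \<in> K") auto
    qed
  qed measurable
qed

text \<open>The pairing identity for truncations passes to the limit on both sides: in space the
  slice bound dominates on a ball containing the support of the test function, in frequency the
  weighted L^2 norms do.\<close>

lemma limit_gradient_pairing:
  assumes b: "b \<in> Basis" and \<phi>: "test_function \<phi>"
  shows "(LINT x|lborel. limit_gradient b (t, x) * \<phi> x) =
    (LINT \<xi>|lborel. cis (- 4 * pi\<^sup>2 * t * (norm \<xi>)\<^sup>2) * deriv_symbol b F \<xi> * inv_fourier \<phi> \<xi>)"
proof -
  have \<phi>m[measurable]: "\<phi> \<in> borel_measurable borel" by (rule test_function_measurable[OF \<phi>])
  obtain C r where C: "C \<ge> 0" "\<And>x. cmod (\<phi> x) \<le> C * indicator (cball 0 r) x"
    using test_function_bounded[OF \<phi>] by blast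
  obtain n :: nat where n: "r < real n" using reals_Archimedean2 by blast
  let ?B = "(LINT \<xi>|lborel. cmod (deriv_symbol b (Fk 0) \<xi>)) + 8"
  have [measurable]: "(\<lambda>x. truncated_gradient k b (t, x)) \<in> borel_measurable borel" for k
    unfolding truncated_gradient_def by measurable
  have lim1: "(\<lambda>k. LINT x|lborel. truncated_gradient k b (t, x) * \<phi> x) \<longlonglongrightarrow> (LINT x|lborel. limit_gradient b (t, x) * \<phi> x)"
  proof (rule integral_dominated_convergence[OF _ _ dominating_integrable[of C n ?B]])
    show "AE x in lborel. (\<lambda>k. truncated_gradient k b (t, x) * \<phi> x) \<longlonglongrightarrow> limit_gradient b (t, x) * \<phi> x"
      by (rule AE_mp[OF AE_weighted_increments_slice_finite], intro AE_I2 impI tendsto_mult_right truncated_gradient_limit(1) b)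
    show "AE x in lborel. norm (truncated_gradient k b (t, x) * \<phi> x) \<le> C * (indicator (ball 0 (real (Suc n))) x * (?B + 8 * enn2real (weighted_increments (t, x))))" for k
    proof (rule AE_mp[OF AE_weighted_increments_slice_finite], intro AE_I2 impI)
      fix x assume "weighted_increments (t, x) < \<infinity>"
      note 1 = slice_bound(2)[OF this b, of k]
      have "cmod (\<phi> x) \<le> C * indicator (ball 0 (real (Suc n))) x"
        using C(2)[of x] C(1) n by (cases "norm x \<le> r") (auto simp: indicator_def)
      then have "cmod (truncated_gradient k b (t, x)) * cmod (\<phi> x) \<le> (?B + 8 * enn2real (weighted_increments (t, x))) * (C * indicator (ball 0 (real (Suc n))) x)"
        using 1 by (intro mult_mono) auto
      then show "norm (truncated_gradient k b (t, x) * \<phi> x) \<le> C * (indicator (ball 0 (real (Suc n))) x * (?B + 8 * enn2real (weighted_increments (t, x))))"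
        by (simp add: norm_mult mult_ac)
    qed
  qed measurable
  have eq: "(LINT x|lborel. truncated_gradient k b (t, x) * \<phi> x) =
      (LINT \<xi>|lborel. cis (- 4 * pi\<^sup>2 * t * (norm \<xi>)\<^sup>2) * deriv_symbol b (Fk k) \<xi> * inv_fourier \<phi> \<xi>)" for k
    unfolding truncated_gradient_def fst_conv snd_conv by (rule free_wave_pairing[OF Fk_int[OF b] test_function_integrable[OF \<phi>]])
  have lim2: "(\<lambda>k. LINT \<xi>|lborel. cis (- 4 * pi\<^sup>2 * t * (norm \<xi>)\<^sup>2) * deriv_symbol b (Fk k) \<xi> * inv_fourier \<phi> \<xi>)
     \<longlonglongrightarrow> (LINT \<xi>|lborel. cis (- 4 * pi\<^sup>2 * t * (norm \<xi>)\<^sup>2) * deriv_symbol b F \<xi> * inv_fourier \<phi> \<xi>)"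
  proof (rule integral_dominated_convergence)
    \<comment> \<open>By |\<xi>| * 2 a b <= |\<xi>| (a^2 + b^2): the weight of the Sobolev norm is
      split evenly between F and the transform of the test function.\<close>
    show "integrable lborel (\<lambda>\<xi>. pi * (norm \<xi> * (cmod (F \<xi>))\<^sup>2 + norm \<xi> * (cmod (inv_fourier \<phi> \<xi>))\<^sup>2))"
      by (intro integrable_mult_right Bochner_Integration.integrable_add F_fin inv_fourier_weighted_integrable \<phi>)
    show "AE \<xi> in lborel. (\<lambda>k. cis (- 4 * pi\<^sup>2 * t * (norm \<xi>)\<^sup>2) * deriv_symbol b (Fk k) \<xi> * inv_fourier \<phi> \<xi>)
       \<longlonglongrightarrow> cis (- 4 * pi\<^sup>2 * t * (norm \<xi>)\<^sup>2) * deriv_symbol b F \<xi> * inv_fourier \<phi> \<xi>"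
      unfolding deriv_symbol_def by (intro AE_I2 tendsto_intros Fk_lim)
    show "AE \<xi> in lborel. norm (cis (- 4 * pi\<^sup>2 * t * (norm \<xi>)\<^sup>2) * deriv_symbol b (Fk k) \<xi> * inv_fourier \<phi> \<xi>)
       \<le> pi * (norm \<xi> * (cmod (F \<xi>))\<^sup>2 + norm \<xi> * (cmod (inv_fourier \<phi> \<xi>))\<^sup>2)" for k
    proof (rule AE_I2)
      fix \<xi> :: 'a
      have "norm (cis (- 4 * pi\<^sup>2 * t * (norm \<xi>)\<^sup>2) * deriv_symbol b (Fk k) \<xi> * inv_fourier \<phi> \<xi>) =
        2 * pi * \<bar>\<xi> \<bullet> b\<bar> * cmod (Fk k \<xi>) * cmod (inv_fourier \<phi> \<xi>)"
        by (simp add: deriv_symbol_def norm_mult)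
      also have "\<dots> \<le> 2 * pi * norm \<xi> * cmod (F \<xi>) * cmod (inv_fourier \<phi> \<xi>)"
        using Basis_le_norm[OF b, of \<xi>] Fk_le[of k \<xi>] by (intro mult_mono) auto
      also have "\<dots> = pi * norm \<xi> * (2 * cmod (F \<xi>) * cmod (inv_fourier \<phi> \<xi>))" by simp
      also have "\<dots> \<le> pi * norm \<xi> * ((cmod (F \<xi>))\<^sup>2 + (cmod (inv_fourier \<phi> \<xi>))\<^sup>2)"
        by (intro mult_left_mono sum_squares_bound) auto
      finally show "norm (cis (- 4 * pi\<^sup>2 * t * (norm \<xi>)\<^sup>2) * deriv_symbol b (Fk k) \<xi> * inv_fourier \<phi> \<xi>)
        \<le> pi * (norm \<xi> * (cmod (F \<xi>))\<^sup>2 + norm \<xi> * (cmod (inv_fourier \<phi> \<xi>))\<^sup>2)"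
        by (simp add: algebra_simps)
    qed
  qed measurable
  show ?thesis
    by (rule LIMSEQ_unique[OF lim1[unfolded eq] lim2])
qed

end

end

section \<open>Radial asymptotics of rough waves\<close>

lemma locally_integrable_cball:
  assumes "locally_integrable g"
  shows "integrable lborel (\<lambda>x. indicator (cball 0 r) x *\<^sub>R g x)"
proof -
  have "set_integrable lborel (cball 0 r) g"
    using assms compact_cball[of 0 r] unfolding locally_integrable_def by blast
  then show ?thesis by (simp only: set_integrable_def)
qed

lemma locally_integrable_measurable:
  assumes "locally_integrable g" shows "g \<in> borel_measurable borel"
proof (rule borel_measurable_LIMSEQ_metric)
  show "(\<lambda>x. indicator (cball 0 (real n)) x *\<^sub>R g x) \<in> borel_measurable borel" for n
    using borel_measurable_integrable[OF locally_integrable_cball[OF assms]] by simp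
  show "(\<lambda>n. indicator (cball 0 (real n)) x *\<^sub>R g x) \<longlonglongrightarrow> g x" for x
  proof (rule tendsto_eventually)
    obtain N :: nat where N: "norm x < real N" using reals_Archimedean2 by blast
    show "\<forall>\<^sub>F n in sequentially. indicator (cball 0 (real n)) x *\<^sub>R g x = g x"
      by (rule eventually_sequentiallyI[of N]) (use N in simp)
  qed
qed

lemma locally_integrable_test_integrable:
  fixes g \<phi> :: "'a::euclidean_space \<Rightarrow> complex"
  assumes g: "locally_integrable g" and \<phi>: "test_function \<phi>"
  shows "integrable lborel (\<lambda>x. g x * \<phi> x)"
proof -
  have [measurable]: "g \<in> borel_measurable borel" by (rule locally_integrable_measurable[OF g])
  have [measurable]: "\<phi> \<in> borel_measurable borel" by (rule test_function_measurable[OF \<phi>])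
  obtain C r where C: "C \<ge> 0" "\<And>x. cmod (\<phi> x) \<le> C * indicator (cball 0 r) x"
    using test_function_bounded[OF \<phi>] by blast
  have i: "integrable lborel (\<lambda>x. C * norm (indicator (cball 0 r) x *\<^sub>R g x))"
    by (intro integrable_mult_right integrable_norm locally_integrable_cball g)
  show ?thesis
  proof (rule Bochner_Integration.integrable_bound[OF i])
    show "AE x in lborel. norm (g x * \<phi> x) \<le> norm (C * norm (indicator (cball 0 r) x *\<^sub>R g x))"
    proof (rule AE_I2)
      fix x
      have "cmod (g x) * cmod (\<phi> x) \<le> cmod (g x) * (C * indicator (cball 0 r) x)"
        by (intro mult_left_mono C(2)) simp
      also have "\<dots> = C * norm (indicator (cball 0 r) x *\<^sub>R g x)"
        by (cases "x \<in> cball 0 r") auto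
      finally show "norm (g x * \<phi> x) \<le> norm (C * norm (indicator (cball 0 r) x *\<^sub>R g x))"
        using C(1) by (simp add: norm_mult)
    qed
  qed measurable
qed

lemma represented_by_unique:
  fixes g h :: "'a::euclidean_space \<Rightarrow> complex"
  assumes "represented_by T g" "represented_by T h"
  shows "AE x in lborel. g x = h x"
proof -
  have g: "locally_integrable g" and h: "locally_integrable h" using assms by (auto simp: represented_by_def)
  have "AE x in lborel. g x - h x = 0"
  proof (rule test_function_separating)
    show "locally_integrable (\<lambda>x. g x - h x)"
      using g h unfolding locally_integrable_def by (auto intro: set_integral_diff(1))
    show "(\<lambda>x. g x - h x) \<in> borel_measurable borel"
      using g h by (intro borel_measurable_diff locally_integrable_measurable)
    fix \<phi> :: "'a \<Rightarrow> complex" assume \<phi>: "test_function \<phi>"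
    have "(LINT x|lborel. g x * \<phi> x) = (LINT x|lborel. h x * \<phi> x)"
      using assms \<phi> by (simp add: represented_by_def distribution_of_def)
    then show "(LINT x|lborel. (g x - h x) * \<phi> x) = 0"
      unfolding left_diff_distrib
      by (subst Bochner_Integration.integral_diff) (auto intro: locally_integrable_test_integrable g h \<phi>)
  qed
  then show ?thesis by simp
qed

text \<open>On a ball |\<xi>| is bounded and F is integrable, so truncating F to balls makes the
  derivative symbols integrable. The radii are chosen for the rate 4^-k.\<close>

lemma gradient_approximation_exists:
  fixes F :: "'a::euclidean_space \<Rightarrow> complex"
  assumes F: "locally_integrable F" and fin: "integrable lborel (\<lambda>\<xi>. norm \<xi> * (cmod (F \<xi>))\<^sup>2)"
  shows "\<exists>Fk. gradient_approximation F Fk"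
proof -
  have Fm[measurable]: "F \<in> borel_measurable borel" by (rule locally_integrable_measurable[OF F])
  define T :: "nat \<Rightarrow> 'a \<Rightarrow> complex" where "T m \<xi> = indicator (ball 0 (real m)) \<xi> * F \<xi>" for m \<xi>
  have Tm[measurable]: "T m \<in> borel_measurable borel" for m
    unfolding T_def[abs_def] by (intro borel_measurable_times borel_measurable_indicator Fm) simp
  have T_eq: "T m \<xi> = F \<xi>" if "norm \<xi> < real m" for m \<xi> using that by (simp add: T_def)
  have T_le: "cmod (T m \<xi>) \<le> cmod (F \<xi>)" for m \<xi> by (simp add: T_def norm_mult indicator_def)
  have "(\<lambda>m. dist2 F (T m)) \<longlonglongrightarrow> (\<integral>\<^sup>+\<xi>. 0 \<partial>(lborel :: 'a measure))"
    unfolding dist2_def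
  proof (rule nn_integral_dominated_convergence)
    show "(\<integral>\<^sup>+\<xi>. ennreal (norm \<xi> * (cmod (F \<xi>))\<^sup>2) \<partial>lborel) < \<infinity>"
      using nn_integral_eq_integral[OF fin] by simp
    show "AE \<xi> in lborel. ennreal (norm \<xi> * (cmod (F \<xi> - T m \<xi>))\<^sup>2) \<le> ennreal (norm \<xi> * (cmod (F \<xi>))\<^sup>2)" for m
      by (intro AE_I2 ennreal_leI mult_left_mono power_mono) (auto simp: T_def indicator_def)
    show "AE \<xi> in lborel. (\<lambda>m. ennreal (norm \<xi> * (cmod (F \<xi> - T m \<xi>))\<^sup>2)) \<longlonglongrightarrow> 0"
    proof (intro AE_I2 tendsto_eventually)
      fix \<xi> :: 'a
      obtain N :: nat where "norm \<xi> < real N" using reals_Archimedean2 by blast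
      then show "\<forall>\<^sub>F m in sequentially. ennreal (norm \<xi> * (cmod (F \<xi> - T m \<xi>))\<^sup>2) = 0"
        by (intro eventually_sequentiallyI[of N]) (auto simp: T_eq)
    qed
  qed measurable
  then have lim: "(\<lambda>m. dist2 F (T m)) \<longlonglongrightarrow> 0" by simp
  \<comment> \<open>The demand k <= m forces the radii to infinity, which gives pointwise
    convergence for every frequency.\<close>
  have "\<forall>k. \<exists>m. k \<le> m \<and> dist2 F (T m) < ennreal ((1 / 4) ^ k)"
  proof
    fix k
    have "\<forall>\<^sub>F m in sequentially. dist2 F (T m) < ennreal ((1 / 4) ^ k)"
      using lim by (intro order_tendstoD(2)) auto
    then have "\<forall>\<^sub>F m in sequentially. k \<le> m \<and> dist2 F (T m) < ennreal ((1 / 4) ^ k)"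
      by (intro eventually_conj eventually_ge_at_top)
    then show "\<exists>m. k \<le> m \<and> dist2 F (T m) < ennreal ((1 / 4) ^ k)"
      by (rule eventually_happens'[OF sequentially_bot])
  qed
  from choice[OF this] obtain \<mu> where \<mu>': "\<forall>k. k \<le> \<mu> k \<and> dist2 F (T (\<mu> k)) < ennreal ((1 / 4) ^ k)" ..
  then have \<mu>: "\<And>k. \<mu> k \<ge> k" "\<And>k. dist2 F (T (\<mu> k)) \<le> ennreal ((1 / 4) ^ k)"
    by (auto intro: less_imp_le)
  have "gradient_approximation F (\<lambda>k. T (\<mu> k))"
  proof
    show "integrable lborel (deriv_symbol b (T (\<mu> k)))" if b: "b \<in> Basis" for k b
    proof -
      let ?m = "real (\<mu> k)"
      have i: "integrable lborel (\<lambda>\<xi>. 2 * pi * ?m * norm (indicator (cball 0 ?m) \<xi> *\<^sub>R F \<xi>))"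
        by (intro integrable_mult_right integrable_norm locally_integrable_cball F)
      show ?thesis
      proof (rule Bochner_Integration.integrable_bound[OF i])
        show "AE \<xi> in lborel. norm (deriv_symbol b (T (\<mu> k)) \<xi>) \<le> norm (2 * pi * ?m * norm (indicator (cball 0 ?m) \<xi> *\<^sub>R F \<xi>))"
        proof (rule AE_I2)
          fix \<xi> :: 'a
          show "norm (deriv_symbol b (T (\<mu> k)) \<xi>) \<le> norm (2 * pi * ?m * norm (indicator (cball 0 ?m) \<xi> *\<^sub>R F \<xi>))"
          proof (cases "norm \<xi> < ?m")
            case True
            then have "2 * pi * \<bar>\<xi> \<bullet> b\<bar> * cmod (F \<xi>) \<le> 2 * pi * ?m * cmod (F \<xi>)"
              using Basis_le_norm[OF b, of \<xi>] by (intro mult_right_mono mult_left_mono) auto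
            then show ?thesis using True by (simp add: deriv_symbol_def T_def norm_mult)
          qed (simp add: deriv_symbol_def T_def)
        qed
      qed measurable
    qed
    show "(\<lambda>k. T (\<mu> k) \<xi>) \<longlonglongrightarrow> F \<xi>" for \<xi>
    proof (rule tendsto_eventually)
      obtain N :: nat where N: "norm \<xi> < real N" using reals_Archimedean2 by blast
      show "\<forall>\<^sub>F k in sequentially. T (\<mu> k) \<xi> = F \<xi>"
      proof (rule eventually_sequentiallyI[of N])
        fix k assume "N \<le> k"
        then have "N \<le> \<mu> k" using \<mu>(1)[of k] by linarith
        then show "T (\<mu> k) \<xi> = F \<xi>" using N by (intro T_eq) simp
      qed
    qed
  qed (use fin \<mu>(2) T_le in auto)
  then show ?thesis by blast
qed

text \<open>Optimizing k in the weighted inequalities leaves an error that is bounded independently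
  of R, hence negligible after division by sqrt R.\<close>

lemma radial_wave_sqrt_asymptotics:
  fixes G :: "'a::euclidean_space \<Rightarrow> complex"
  assumes G: "test_function G"
  defines "M \<equiv> \<integral>\<^sup>+\<xi>. ennreal (norm \<xi> * (cmod (G \<xi>))\<^sup>2) \<partial>lborel"
  assumes M: "M < \<infinity>"
  shows "\<exists>C\<ge>0. \<forall>R>0. (\<integral>\<^sup>+p\<in>UNIV \<times> ball 0 R. ennreal ((cmod (radial_wave G p))\<^sup>2) \<partial>lborel) < \<infinity> \<and>
    \<bar>sqrt (enn2real (\<integral>\<^sup>+p\<in>UNIV \<times> ball 0 R. ennreal ((cmod (radial_wave G p))\<^sup>2) \<partial>lborel)) - sqrt (2 * pi * R * enn2real M)\<bar> \<le> sqrt C"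
proof -
  let ?Q = "\<lambda>R. \<integral>\<^sup>+p\<in>UNIV \<times> ball 0 R. ennreal ((cmod (radial_wave G p))\<^sup>2) \<partial>lborel"
  obtain C where C: "C \<ge> 0"
    and le1: "\<And>R k. R > 0 \<Longrightarrow> k > 0 \<Longrightarrow> ?Q R \<le> ennreal (1 + k) * (ennreal (2 * pi * R) * M) + ennreal (1 + 1 / k) * ennreal C"
    and le2: "\<And>R k. R > 0 \<Longrightarrow> k > 0 \<Longrightarrow> ennreal (2 * pi * R) * M \<le> ennreal (1 + k) * ?Q R + ennreal (1 + 1 / k) * ennreal C"
    using radial_wave_weighted_asymptotics[OF G] unfolding M_def by blast
  have conv: "enn2real p \<le> (1 + k) * enn2real q + (1 + 1 / k) * C"
    if "p \<le> ennreal (1 + k) * q + ennreal (1 + 1 / k) * ennreal C" "q < \<infinity>" "k > 0" for p q k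
  proof -
    have "ennreal (1 + k) * q + ennreal (1 + 1 / k) * ennreal C = ennreal ((1 + k) * enn2real q + (1 + 1 / k) * C)"
      using that C by (cases q rule: ennreal_cases) (auto simp: ennreal_mult[symmetric] ennreal_plus[symmetric] simp del: ennreal_plus)
    then have "p \<le> ennreal ((1 + k) * enn2real q + (1 + 1 / k) * C)" using that by simp
    then show ?thesis using C that by (intro enn2real_leI) auto
  qed
  show ?thesis
  proof (intro exI[of _ C] conjI allI impI C)
    fix R :: real assume R: "R > 0"
    have RM: "ennreal (2 * pi * R) * M < \<infinity>" using M by (simp add: ennreal_mult_less_top)
    have RM_eq: "enn2real (ennreal (2 * pi * R) * M) = 2 * pi * R * enn2real M"
      using R by (simp add: enn2real_mult)
    have "?Q R \<le> ennreal (1 + 1) * (ennreal (2 * pi * R) * M) + ennreal (1 + 1 / 1) * ennreal C"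
      by (rule le1[OF R]) simp
    also have "\<dots> < \<infinity>" using M by (simp add: ennreal_mult_less_top)
    finally show Q: "?Q R < \<infinity>" .
    have "sqrt (enn2real (?Q R)) \<le> sqrt (2 * pi * R * enn2real M) + sqrt C"
      by (rule sqrt_le_of_weighted) (use conv[OF le1[OF R] RM] RM_eq C R in auto)
    moreover have "sqrt (2 * pi * R * enn2real M) \<le> sqrt (enn2real (?Q R)) + sqrt C"
      by (rule sqrt_le_of_weighted) (use conv[OF le2[OF R] Q] RM_eq C R in auto)
    ultimately show "\<bar>sqrt (enn2real (?Q R)) - sqrt (2 * pi * R * enn2real M)\<bar> \<le> sqrt C" by linarith
  qed
qed

context gradient_approximation
begin

definition radial_limit :: "real \<times> 'a \<Rightarrow> complex" where
  "radial_limit p = radial_sum (snd p) (\<lambda>b. limit_gradient b p)"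

lemma radial_limit_measurable[measurable]: "radial_limit \<in> borel_measurable borel"
  unfolding radial_limit_def[abs_def] radial_sum_def by measurable

lemma radial_limit_approx:
  assumes G: "test_function G" and R: "R > 0" and e: "e > 0" and FG: "dist2 F G \<le> ennreal e"
  shows "(\<integral>\<^sup>+p\<in>UNIV \<times> ball 0 R. ennreal ((cmod (radial_limit p - radial_wave G p))\<^sup>2) \<partial>lborel)
    \<le> ennreal (4 * smoothing_bound DIM('a) * R * e)"
proof (rule order_trans[OF _ limit_gradient_approx[OF assms]], intro nn_integral_mono mult_right_mono ennreal_leI)
  fix p :: "real \<times> 'a"
  show "(cmod (radial_limit p - radial_wave G p))\<^sup>2 \<le> (\<Sum>b\<in>Basis. (cmod (limit_gradient b p - free_wave (deriv_symbol b G) (fst p) (snd p)))\<^sup>2)"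
    unfolding radial_limit_def radial_wave_def radial_sum_diff[symmetric] by (rule radial_sum_le)
qed simp

text \<open>Multiplication by sqrt |\<xi>| turns the weighted norm into an ordinary L^2 norm, to
  which the triangle inequality applies.\<close>

lemma sqrt_weighted_norm_diff:
  assumes [measurable]: "G \<in> borel_measurable borel" and e: "e > 0" and FG: "dist2 F G \<le> ennreal e"
  shows "(\<integral>\<^sup>+\<xi>. ennreal (norm \<xi> * (cmod (G \<xi>))\<^sup>2) \<partial>lborel) < \<infinity>"
    and "\<bar>sqrt (enn2real (\<integral>\<^sup>+\<xi>. ennreal (norm \<xi> * (cmod (G \<xi>))\<^sup>2) \<partial>lborel)) -
      sqrt (LINT \<xi>|lborel. norm \<xi> * (cmod (F \<xi>))\<^sup>2)\<bar> \<le> sqrt e"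
proof -
  let ?w = "\<lambda>H \<xi>. complex_of_real (sqrt (norm \<xi>)) * H \<xi>"
  have w: "(cmod (?w H \<xi>))\<^sup>2 = norm \<xi> * (cmod (H \<xi>))\<^sup>2" for H :: "'a \<Rightarrow> complex" and \<xi>
    by (simp add: norm_mult power_mult_distrib)
  have wd: "(cmod (?w G \<xi> - ?w F \<xi>))\<^sup>2 = norm \<xi> * (cmod (G \<xi> - F \<xi>))\<^sup>2" for \<xi>
    unfolding right_diff_distrib[symmetric] by (simp add: norm_mult power_mult_distrib)
  have Ff: "(\<integral>\<^sup>+\<xi>. ennreal (norm \<xi> * (cmod (F \<xi>))\<^sup>2) \<partial>lborel) = ennreal (LINT \<xi>|lborel. norm \<xi> * (cmod (F \<xi>))\<^sup>2)"
    by (rule nn_integral_eq_integral[OF F_fin]) simp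
  have M0: "(LINT \<xi>|lborel. norm \<xi> * (cmod (F \<xi>))\<^sup>2) \<ge> 0" by (intro Bochner_Integration.integral_nonneg) simp
  have m: "?w G \<in> borel_measurable lborel" "?w F \<in> borel_measurable lborel" "(UNIV :: 'a set) \<in> sets lborel"
    by measurable
  have fin: "(\<integral>\<^sup>+\<xi>\<in>UNIV. ennreal ((cmod (?w F \<xi>))\<^sup>2) \<partial>lborel) < \<infinity>"
    unfolding w using Ff by simp
  have d: "(\<integral>\<^sup>+\<xi>\<in>UNIV. ennreal ((cmod (?w G \<xi> - ?w F \<xi>))\<^sup>2) \<partial>lborel) \<le> ennreal e"
    unfolding wd using FG unfolding dist2_sym[of F] by (simp add: dist2_def)
  from sqrt_integral_triangle[OF m fin d less_imp_le[OF e]]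
  show "(\<integral>\<^sup>+\<xi>. ennreal (norm \<xi> * (cmod (G \<xi>))\<^sup>2) \<partial>lborel) < \<infinity>"
    and "\<bar>sqrt (enn2real (\<integral>\<^sup>+\<xi>. ennreal (norm \<xi> * (cmod (G \<xi>))\<^sup>2) \<partial>lborel)) -
      sqrt (LINT \<xi>|lborel. norm \<xi> * (cmod (F \<xi>))\<^sup>2)\<bar> \<le> sqrt e"
    unfolding w by (simp_all add: Ff M0)
qed

text \<open>The rough wave is compared with the wave of a test function G near F. Local smoothing
  bounds the difference of the waves uniformly in R after scaling, dispersion bounds the wave of G
  up to sqrt C / sqrt R, and the weighted norms of F and G differ by at most sqrt e.\<close>

theorem radial_limit_asymptotics:
  "((\<lambda>R. (\<integral>\<^sup>+p\<in>UNIV \<times> ball 0 R. ennreal ((cmod (radial_limit p))\<^sup>2) \<partial>lborel) / ennreal R)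
    \<longlongrightarrow> ennreal (2 * pi * (LINT \<xi>|lborel. norm \<xi> * (cmod (F \<xi>))\<^sup>2))) at_top"
proof -
  let ?M = "LINT \<xi>|lborel. norm \<xi> * (cmod (F \<xi>))\<^sup>2"
  let ?K = "smoothing_bound DIM('a)"
  let ?Q = "\<lambda>R. \<integral>\<^sup>+p\<in>UNIV \<times> ball 0 R. ennreal ((cmod (radial_limit p))\<^sup>2) \<partial>lborel"
  have M0: "?M \<ge> 0" by (intro Bochner_Integration.integral_nonneg) simp
  have K0: "?K \<ge> 0" by (rule smoothing_bound_nonneg)
  have "(\<integral>\<^sup>+\<xi>. ennreal (norm \<xi> * (cmod (F \<xi>))\<^sup>2) \<partial>lborel) < \<infinity>"
    using nn_integral_eq_integral[OF F_fin] by simp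
  then have apx: "approximable F" by (intro approximable_weighted_L2 F_meas)
  \<comment> \<open>C depends on e through the choice of G but not on R, so R tends to infinity with
    e fixed.\<close>
  have key: "\<exists>C\<ge>0. \<forall>R>0. ?Q R < \<infinity> \<and> \<bar>sqrt (enn2real (?Q R)) / sqrt R - sqrt (2 * pi * ?M)\<bar> \<le> sqrt e * (sqrt (4 * ?K) + sqrt (2 * pi)) + sqrt C / sqrt R"
    if e: "e > 0" for e
  proof -
    obtain G where G: "test_function G" and FG: "dist2 F G \<le> ennreal e"
      using apx e unfolding approximable_def by blast
    have Gm[measurable]: "G \<in> borel_measurable borel" by (rule test_function_measurable[OF G])
    let ?MG = "\<integral>\<^sup>+\<xi>. ennreal (norm \<xi> * (cmod (G \<xi>))\<^sup>2) \<partial>lborel"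
    note MG = sqrt_weighted_norm_diff[OF Gm e FG]
    let ?QG = "\<lambda>R. \<integral>\<^sup>+p\<in>UNIV \<times> ball 0 R. ennreal ((cmod (radial_wave G p))\<^sup>2) \<partial>lborel"
    obtain C where C: "C \<ge> 0" and QG: "\<And>R. R > 0 \<Longrightarrow> ?QG R < \<infinity>"
      "\<And>R. R > 0 \<Longrightarrow> \<bar>sqrt (enn2real (?QG R)) - sqrt (2 * pi * R * enn2real ?MG)\<bar> \<le> sqrt C"
      using radial_wave_sqrt_asymptotics[OF G MG(1)] by blast
    show ?thesis
    proof (intro exI[of _ C] conjI allI impI C)
      fix R :: real assume R: "R > 0"
      have nn: "4 * ?K * R * e \<ge> 0" using K0 R e by simp
      have mm: "radial_limit \<in> borel_measurable lborel" "radial_wave G \<in> borel_measurable lborel"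
        "UNIV \<times> ball 0 R \<in> sets (lborel :: (real \<times> 'a) measure)"
        by measurable
      note tri = sqrt_integral_triangle[OF mm QG(1)[OF R] radial_limit_approx[OF G R e FG] nn]
      show "?Q R < \<infinity>" by (rule tri(1))
      have 1: "sqrt (4 * ?K * R * e) = sqrt R * (sqrt e * sqrt (4 * ?K))" by (simp add: real_sqrt_mult)
      have 2: "sqrt (2 * pi * R * enn2real ?MG) = sqrt R * (sqrt (2 * pi) * sqrt (enn2real ?MG))" by (simp add: real_sqrt_mult)
      have "\<bar>sqrt (2 * pi) * sqrt (enn2real ?MG) - sqrt (2 * pi) * sqrt ?M\<bar> \<le> sqrt (2 * pi) * sqrt e"
        unfolding right_diff_distrib[symmetric] abs_mult using MG(2) by (simp add: mult_left_mono)
      then have "sqrt R * \<bar>sqrt (2 * pi) * sqrt (enn2real ?MG) - sqrt (2 * pi) * sqrt ?M\<bar> \<le> sqrt R * (sqrt (2 * pi) * sqrt e)"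
        using R by (intro mult_left_mono) auto
      then have 3: "\<bar>sqrt R * (sqrt (2 * pi) * sqrt (enn2real ?MG)) - sqrt R * sqrt (2 * pi * ?M)\<bar> \<le> sqrt R * (sqrt (2 * pi) * sqrt e)"
        using R by (simp add: real_sqrt_mult right_diff_distrib[symmetric] abs_mult)
      have "\<bar>sqrt (enn2real (?Q R)) - sqrt R * sqrt (2 * pi * ?M)\<bar> \<le> sqrt R * (sqrt e * sqrt (4 * ?K)) + sqrt C + sqrt R * (sqrt (2 * pi) * sqrt e)"
        using tri(2) QG(2)[OF R] 3 unfolding 1 2 by linarith
      then have "\<bar>sqrt (enn2real (?Q R)) - sqrt R * sqrt (2 * pi * ?M)\<bar> / sqrt R \<le>
          (sqrt R * (sqrt e * sqrt (4 * ?K)) + sqrt C + sqrt R * (sqrt (2 * pi) * sqrt e)) / sqrt R"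
        using R by (intro divide_right_mono) auto
      also have "\<dots> = sqrt e * (sqrt (4 * ?K) + sqrt (2 * pi)) + sqrt C / sqrt R"
        using R by (simp add: add_divide_distrib distrib_left mult.commute)
      also have "\<bar>sqrt (enn2real (?Q R)) - sqrt R * sqrt (2 * pi * ?M)\<bar> / sqrt R = \<bar>sqrt (enn2real (?Q R)) / sqrt R - sqrt (2 * pi * ?M)\<bar>"
        using R by (subst abs_div_pos) (auto simp: diff_divide_distrib)
      finally show "\<bar>sqrt (enn2real (?Q R)) / sqrt R - sqrt (2 * pi * ?M)\<bar> \<le> sqrt e * (sqrt (4 * ?K) + sqrt (2 * pi)) + sqrt C / sqrt R" .
    qed
  qed
  have Q_fin: "?Q R < \<infinity>" if "R > 0" for R
    using key[of 1] that by auto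
  have "((\<lambda>R. sqrt (enn2real (?Q R)) / sqrt R) \<longlongrightarrow> sqrt (2 * pi * ?M)) at_top"
  proof (rule tendstoI)
    fix \<epsilon> :: real assume \<epsilon>: "\<epsilon> > 0"
    define B where "B = sqrt (4 * ?K) + sqrt (2 * pi)"
    have B: "B > 0" unfolding B_def using K0 by (intro add_nonneg_pos) auto
    \<comment> \<open>Chosen so that sqrt e * B is half of the tolerance; the other half is left for
      the dispersive error.\<close>
    define e where "e = (\<epsilon> / (2 * B))\<^sup>2"
    have e: "e > 0" using \<epsilon> B by (simp add: e_def)
    have eB: "sqrt e * B = \<epsilon> / 2" using \<epsilon> B by (simp add: e_def)
    obtain C where C: "C \<ge> 0" "\<And>R. R > 0 \<Longrightarrow> \<bar>sqrt (enn2real (?Q R)) / sqrt R - sqrt (2 * pi * ?M)\<bar> \<le> \<epsilon> / 2 + sqrt C / sqrt R"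
      using key[OF e] unfolding B_def[symmetric] eB by blast
    have "((\<lambda>R. sqrt C / sqrt R) \<longlongrightarrow> 0) at_top"
      by (intro tendsto_divide_0[OF tendsto_const] filterlim_at_top_imp_at_infinity sqrt_at_top)
    then have "\<forall>\<^sub>F R in at_top. sqrt C / sqrt R < \<epsilon> / 2"
      using \<epsilon> by (intro order_tendstoD(2)) auto
    then show "\<forall>\<^sub>F R in at_top. dist (sqrt (enn2real (?Q R)) / sqrt R) (sqrt (2 * pi * ?M)) < \<epsilon>"
      using eventually_gt_at_top[of 0]
    proof eventually_elim
      case (elim R)
      then show ?case using C(2)[of R] unfolding dist_real_def by linarith
    qed
  qed
  then have "((\<lambda>R. ennreal ((sqrt (enn2real (?Q R)) / sqrt R)\<^sup>2)) \<longlongrightarrow> ennreal ((sqrt (2 * pi * ?M))\<^sup>2)) at_top"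
    by (intro tendsto_ennrealI tendsto_power)
  also have "(sqrt (2 * pi * ?M))\<^sup>2 = 2 * pi * ?M" using M0 by simp
  finally show ?thesis
  proof (rule Lim_transform_eventually)
    show "\<forall>\<^sub>F R in at_top. ennreal ((sqrt (enn2real (?Q R)) / sqrt R)\<^sup>2) = ?Q R / ennreal R"
      using eventually_gt_at_top[of 0]
    proof eventually_elim
      case (elim R)
      have "ennreal ((sqrt (enn2real (?Q R)) / sqrt R)\<^sup>2) = ennreal (enn2real (?Q R) / R)"
        using elim by (simp add: power_divide)
      also have "\<dots> = ennreal (enn2real (?Q R)) / ennreal R"
        using elim by (simp add: divide_ennreal)
      also have "ennreal (enn2real (?Q R)) = ?Q R"
        using Q_fin[OF elim] by simp
      finally show ?case .
    qed
  qed
qed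

end

section \<open>The Schroedinger evolution of data in the homogeneous Sobolev space\<close>

lemma Basis_real_vec: "(Basis :: (real^'n) set) = range (\<lambda>j. axis j 1)"
  by (auto simp: Basis_vec_def)

lemma inj_axis_1: "inj (\<lambda>j::'n::finite. axis j (1::real))"
  by (auto simp: inj_def axis_eq_axis)

lemma sum_Basis_real_vec: "(\<Sum>b\<in>(Basis :: (real^'n) set). g b) = (\<Sum>j\<in>UNIV. g (axis j 1))"
  unfolding Basis_real_vec by (subst sum.reindex[OF inj_axis_1]) simp

lemma radial_component_eq_radial_sum:
  fixes w :: "complex^'n"
  assumes "\<And>j. e (axis j 1) = w $ j"
  shows "radial_component x w = radial_sum x e"
  unfolding radial_component_def radial_sum_def sum_Basis_real_vec
  by (simp add: inner_axis assms)

lemma radial_component_le_norm: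
  fixes w :: "complex^'n"
  shows "(cmod (radial_component x w))\<^sup>2 \<le> (norm w)\<^sup>2"
proof -
  \<comment> \<open>\<open>radial_sum\<close> expects components indexed by basis vectors; the
    inverse of \<open>axis\<close> recovers the index.\<close>
  let ?e = "\<lambda>b. w $ (inv (\<lambda>j. axis j (1::real)) b)"
  have e: "?e (axis j 1) = w $ j" for j
    using inv_f_f[OF inj_axis_1, of j] by simp
  have "(cmod (radial_component x w))\<^sup>2 \<le> (\<Sum>b\<in>Basis. (cmod (?e b))\<^sup>2)"
    unfolding radial_component_eq_radial_sum[of ?e w x, OF e] by (rule radial_sum_le)
  also have "\<dots> = (\<Sum>j\<in>UNIV. (cmod (w $ j))\<^sup>2)"
    unfolding sum_Basis_real_vec e ..
  also have "\<dots> = (norm w)\<^sup>2"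
    by (simp add: norm_vec_def L2_set_def sum_nonneg)
  finally show ?thesis .
qed

lemma borel_measurable_complex_vec:
  fixes f :: "'a \<Rightarrow> complex^'n"
  assumes "\<And>j. (\<lambda>x. f x $ j) \<in> borel_measurable M"
  shows "f \<in> borel_measurable M"
  unfolding borel_measurable_euclidean_space[of f]
proof
  fix b :: "complex^'n" assume "b \<in> Basis"
  then obtain j u where b: "b = axis j u" by (auto simp: Basis_vec_def)
  show "(\<lambda>x. f x \<bullet> b) \<in> borel_measurable M"
    unfolding b inner_axis using assms[of j] by measurable
qed

context
  fixes f :: "(real^'n) distribution"
  assumes f: "f \<in> hdot_half"
begin

lemma hdot_half_symbol:
  "locally_integrable (function_of (fourier_dist f))"
  "integrable lborel (\<lambda>\<xi>. norm \<xi> * (cmod (function_of (fourier_dist f) \<xi>))\<^sup>2)"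
proof -
  have "\<exists>g. represented_by (fourier_dist f) g" using f by (simp add: hdot_half_def)
  then have "represented_by (fourier_dist f) (function_of (fourier_dist f))"
    unfolding function_of_def by (rule someI_ex)
  then show "locally_integrable (function_of (fourier_dist f))" by (simp add: represented_by_def)
  show "integrable lborel (\<lambda>\<xi>. norm \<xi> * (cmod (function_of (fourier_dist f) \<xi>))\<^sup>2)"
    using f by (simp add: hdot_half_def mult.commute)
qed

text \<open>The sign of the distributional derivative cancels the one in
  \<open>inv_fourier_partial\<close>, so the derivative acts as its symbol on the frequency side, as
  in \<open>limit_gradient_pairing\<close>.\<close>

lemma partial_schroedinger_evolution:
  assumes \<phi>: "test_function \<phi>" and b: "b \<in> Basis"
  shows "partial_dist b (schroedinger_evolution f t) \<phi> =
    (LINT \<xi>|lborel. cis (- 4 * pi\<^sup>2 * t * (norm \<xi>)\<^sup>2) * deriv_symbol b (function_of (fourier_dist f)) \<xi> * inv_fourier \<phi> \<xi>)"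
proof -
  let ?F = "function_of (fourier_dist f)"
  have "partial_dist b (schroedinger_evolution f t) \<phi> =
      - (LINT \<xi>|lborel. cis (- 4 * pi\<^sup>2 * t * (norm \<xi>)\<^sup>2) * ?F \<xi> * inv_fourier (partial b \<phi>) \<xi>)"
    by (simp add: partial_dist_def schroedinger_evolution_def inv_fourier_dist_def distribution_of_def)
  also have "\<dots> = (LINT \<xi>|lborel. - (cis (- 4 * pi\<^sup>2 * t * (norm \<xi>)\<^sup>2) * ?F \<xi> * inv_fourier (partial b \<phi>) \<xi>))"
    by simp
  also have "\<dots> = (LINT \<xi>|lborel. cis (- 4 * pi\<^sup>2 * t * (norm \<xi>)\<^sup>2) * deriv_symbol b ?F \<xi> * inv_fourier \<phi> \<xi>)"
    by (intro Bochner_Integration.integral_cong refl)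
       (simp add: inv_fourier_partial[OF \<phi> b] deriv_symbol_def mult_ac)
  finally show ?thesis .
qed

lemma hdot_half_norm_square:
  "(hdot_half_norm f)\<^sup>2 = (LINT \<xi>|lborel. norm \<xi> * (cmod (function_of (fourier_dist f) \<xi>))\<^sup>2)"
proof -
  have "0 \<le> (LINT \<xi>|lborel. (cmod (function_of (fourier_dist f) \<xi>))\<^sup>2 * norm \<xi>)"
    by (intro Bochner_Integration.integral_nonneg) simp
  then show ?thesis by (simp add: hdot_half_norm_def mult.commute)
qed

text \<open>The components of v0 are the limit gradients. At good times the pairing on the space
  side and that of the distributional derivative are the same frequency integral, which makes v0 the
  gradient of the evolution.\<close>

lemma schroedinger_gradient:
  obtains v0 :: "real \<Rightarrow> real^'n \<Rightarrow> complex^'n"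
  where "space_gradient (schroedinger_evolution f) v0"
    and "((\<lambda>R::real. (\<integral>\<^sup>+t. (\<integral>\<^sup>+x\<in>ball 0 R. ennreal ((cmod (radial_component x (v0 t x)))\<^sup>2) \<partial>lborel) \<partial>lborel) / ennreal R)
         \<longlongrightarrow> ennreal (2 * pi * (hdot_half_norm f)\<^sup>2)) at_top"
proof -
  let ?F = "function_of (fourier_dist f)"
  obtain Fk where "gradient_approximation ?F Fk"
    using gradient_approximation_exists[OF hdot_half_symbol] by blast
  then interpret gradient_approximation ?F Fk .
  define v0 :: "real \<Rightarrow> real^'n \<Rightarrow> complex^'n" where "v0 t x = (\<chi> j. limit_gradient (axis j 1) (t, x))" for t x
  have ax: "axis j 1 \<in> (Basis :: (real^'n) set)" for j by (simp add: Basis_real_vec)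
  show thesis
  proof (rule that[of v0])
    have "(\<lambda>(t, x). v0 t x) \<in> borel_measurable borel"
    proof (rule borel_measurable_complex_vec)
      fix j :: 'n
      have "(\<lambda>p. (case p of (t, x) \<Rightarrow> v0 t x) $ j) = limit_gradient (axis j 1)"
        by (auto simp: v0_def fun_eq_iff)
      then show "(\<lambda>p. (case p of (t, x) \<Rightarrow> v0 t x) $ j) \<in> borel_measurable borel" by simp
    qed
    moreover have "AE t in lborel. \<forall>j. represented_by (partial_dist (axis j 1) (schroedinger_evolution f t)) (\<lambda>x. v0 t x $ j)"
    proof (rule AE_mp[OF AE_weighted_increments_slice], intro AE_I2 impI allI)
      fix t :: real and j :: 'n
      assume weighted_increments: "\<forall>n. (\<integral>\<^sup>+x\<in>ball 0 (real (Suc n)). weighted_increments (t, x) \<partial>lborel) < \<infinity>"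
      show "represented_by (partial_dist (axis j 1) (schroedinger_evolution f t)) (\<lambda>x. v0 t x $ j)"
        unfolding represented_by_def distribution_of_def v0_def
        using limit_gradient_locally_integrable[OF weighted_increments[rule_format] ax[of j]]
          limit_gradient_pairing[OF weighted_increments[rule_format] ax[of j]]
        by (simp add: partial_schroedinger_evolution[OF _ ax])
    qed
    ultimately show "space_gradient (schroedinger_evolution f) v0" by (simp add: space_gradient_def)
    have rc: "radial_component x (v0 t x) = radial_limit (t, x)" for t x
      unfolding radial_limit_def snd_conv by (rule radial_component_eq_radial_sum) (simp add: v0_def)
    have "(\<integral>\<^sup>+p\<in>UNIV \<times> ball 0 R. ennreal ((cmod (radial_limit p))\<^sup>2) \<partial>lborel) =
      (\<integral>\<^sup>+t. (\<integral>\<^sup>+x\<in>ball 0 R. ennreal ((cmod (radial_component x (v0 t x)))\<^sup>2) \<partial>lborel) \<partial>lborel)" for R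
      unfolding rc by (subst nn_integral_lborel_pair) (auto simp: indicator_def intro!: nn_integral_cong)
    then show "((\<lambda>R::real. (\<integral>\<^sup>+t. (\<integral>\<^sup>+x\<in>ball 0 R. ennreal ((cmod (radial_component x (v0 t x)))\<^sup>2) \<partial>lborel) \<partial>lborel) / ennreal R)
         \<longlongrightarrow> ennreal (2 * pi * (hdot_half_norm f)\<^sup>2)) at_top"
      using radial_limit_asymptotics by (simp add: hdot_half_norm_square)
  qed
qed

text \<open>Uniqueness of representatives at almost every time. The exceptional set in x varies with
  t, so the statement is an iterated one, which suffices for the iterated integrals.\<close>

lemma schroedinger_gradient_unique:
  assumes "space_gradient (schroedinger_evolution f) v" "space_gradient (schroedinger_evolution f) v0"
  shows "AE t in lborel. AE x in lborel. v t x = v0 t x"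
proof -
  have "AE t in lborel. \<forall>j. represented_by (partial_dist (axis j 1) (schroedinger_evolution f t)) (\<lambda>x. v t x $ j)"
    "AE t in lborel. \<forall>j. represented_by (partial_dist (axis j 1) (schroedinger_evolution f t)) (\<lambda>x. v0 t x $ j)"
    using assms by (simp_all add: space_gradient_def)
  then show ?thesis
  proof eventually_elim
    case (elim t)
    have "AE x in lborel. v t x $ j = v0 t x $ j" for j
      using elim by (intro represented_by_unique) auto
    then have "AE x in lborel. \<forall>j\<in>UNIV. v t x $ j = v0 t x $ j"
      by (intro AE_finite_allI) auto
    then show ?case by (simp add: vec_eq_iff)
  qed
qed

text \<open>The weight |\<xi>| vanishes only at the origin, so a vanishing norm forces the symbol to
  vanish almost everywhere; no frequency part at 0 survives.\<close>

lemma schroedinger_evolution_eq_0: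
  assumes "hdot_half_norm f = 0"
  shows "schroedinger_evolution f t \<phi> = 0"
proof -
  let ?F = "function_of (fourier_dist f)"
  have "(LINT \<xi>|lborel. norm \<xi> * (cmod (?F \<xi>))\<^sup>2) = 0"
    using assms hdot_half_norm_square by simp
  then have "AE \<xi> in lborel. norm \<xi> * (cmod (?F \<xi>))\<^sup>2 = 0"
    by (subst (asm) integral_nonneg_eq_0_iff_AE[OF hdot_half_symbol(2)]) auto
  moreover have "AE \<xi> in lborel. \<xi> \<noteq> (0 :: real^'n)" by (rule AE_lborel_singleton)
  ultimately have "AE \<xi> in lborel. cis (- 4 * pi\<^sup>2 * t * (norm \<xi>)\<^sup>2) * ?F \<xi> * inv_fourier \<phi> \<xi> = 0"
    by eventually_elim auto
  then have "(LINT \<xi>|lborel. cis (- 4 * pi\<^sup>2 * t * (norm \<xi>)\<^sup>2) * ?F \<xi> * inv_fourier \<phi> \<xi>) = 0"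
    by (rule integral_eq_zero_AE)
  then show ?thesis
    by (simp add: schroedinger_evolution_def inv_fourier_dist_def distribution_of_def)
qed

end

theorem corollary0p1:
  fixes f :: "(real^'n) distribution"
  assumes "f \<in> hdot_half"
  shows "(\<exists>v. space_gradient (schroedinger_evolution f) v) \<and>
    (\<forall>v. space_gradient (schroedinger_evolution f) v \<longrightarrow>
      ((\<lambda>R::real. (\<integral>\<^sup>+t. (\<integral>\<^sup>+x\<in>ball 0 R.
            ennreal ((cmod (radial_component x (v t x)))\<^sup>2) \<partial>lborel) \<partial>lborel) / ennreal R)
         \<longlongrightarrow> ennreal (2 * pi * (hdot_half_norm f)\<^sup>2)) at_top \<and>
      (SUP R\<in>{0::real<..}. (\<integral>\<^sup>+t. (\<integral>\<^sup>+x\<in>ball 0 R.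
            ennreal ((norm (v t x))\<^sup>2) \<partial>lborel) \<partial>lborel) / ennreal R)
         \<ge> ennreal (2 * pi * (hdot_half_norm f)\<^sup>2) \<and>
      (Liminf at_top (\<lambda>R::real. (\<integral>\<^sup>+t. (\<integral>\<^sup>+x\<in>ball 0 R.
            ennreal ((norm (v t x))\<^sup>2) \<partial>lborel) \<partial>lborel) / ennreal R) = 0 \<longrightarrow>
         (\<forall>t \<phi>. schwartz \<phi> \<longrightarrow> schroedinger_evolution f t \<phi> = 0)))"
proof -
  let ?L = "ennreal (2 * pi * (hdot_half_norm f)\<^sup>2)"
  let ?q = "\<lambda>v::real \<Rightarrow> real^'n \<Rightarrow> complex^'n. \<lambda>R::real. (\<integral>\<^sup>+t. (\<integral>\<^sup>+x\<in>ball 0 R. ennreal ((cmod (radial_component x (v t x)))\<^sup>2) \<partial>lborel) \<partial>lborel) / ennreal R"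
  let ?p = "\<lambda>v::real \<Rightarrow> real^'n \<Rightarrow> complex^'n. \<lambda>R::real. (\<integral>\<^sup>+t. (\<integral>\<^sup>+x\<in>ball 0 R. ennreal ((norm (v t x))\<^sup>2) \<partial>lborel) \<partial>lborel) / ennreal R"
  obtain v0 where v0: "space_gradient (schroedinger_evolution f) v0" and lim0: "(?q v0 \<longlongrightarrow> ?L) at_top"
    using schroedinger_gradient[OF assms] by blast
  have qp: "?q v R \<le> ?p v R" for v R
    by (intro divide_right_mono_ennreal nn_integral_mono mult_right_mono ennreal_leI radial_component_le_norm) simp
  have "(?q v \<longlongrightarrow> ?L) at_top \<and> (SUP R\<in>{0<..}. ?p v R) \<ge> ?L \<and>
      (Liminf at_top (?p v) = 0 \<longrightarrow> (\<forall>t \<phi>. schwartz \<phi> \<longrightarrow> schroedinger_evolution f t \<phi> = 0))"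
    if v: "space_gradient (schroedinger_evolution f) v" for v
  proof -
    \<comment> \<open>The integral does not depend on the chosen gradient, so the limit proved for
      v0 holds for v.\<close>
    have "(\<integral>\<^sup>+t. (\<integral>\<^sup>+x\<in>ball 0 R. ennreal ((cmod (radial_component x (v t x)))\<^sup>2) \<partial>lborel) \<partial>lborel) =
       (\<integral>\<^sup>+t. (\<integral>\<^sup>+x\<in>ball 0 R. ennreal ((cmod (radial_component x (v0 t x)))\<^sup>2) \<partial>lborel) \<partial>lborel)" for R
    proof (rule nn_integral_cong_AE, rule AE_mp[OF schroedinger_gradient_unique[OF assms v v0]], intro AE_I2 impI)
      fix t assume "AE x in lborel. v t x = v0 t x"
      then show "(\<integral>\<^sup>+x\<in>ball 0 R. ennreal ((cmod (radial_component x (v t x)))\<^sup>2) \<partial>lborel) =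
        (\<integral>\<^sup>+x\<in>ball 0 R. ennreal ((cmod (radial_component x (v0 t x)))\<^sup>2) \<partial>lborel)"
        by (intro nn_integral_cong_AE) auto
    qed
    then have lim: "(?q v \<longlongrightarrow> ?L) at_top" using lim0 by simp
    moreover have "?L \<le> (SUP R\<in>{0<..}. ?p v R)"
    \<comment> \<open>Each radial quotient lies below the supremum of the gradient quotients, and so
      does their limit at infinity.\<close>
    proof (rule tendsto_upperbound[OF lim])
      show "\<forall>\<^sub>F R in at_top. ?q v R \<le> (SUP R\<in>{0<..}. ?p v R)"
        using eventually_gt_at_top[of 0]
        by eventually_elim (intro order_trans[OF qp] SUP_upper, simp)
    qed simp
    moreover have "schroedinger_evolution f t \<phi> = 0" if 0: "Liminf at_top (?p v) = 0" for t \<phi>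
    proof (rule schroedinger_evolution_eq_0[OF assms])
      \<comment> \<open>The radial quotients have a limit, which is then their lower limit and lies
        below that of the full gradient; if the latter is 0, the norm of the datum vanishes.\<close>
      have "?L = Liminf at_top (?q v)" using lim_imp_Liminf[OF _ lim] by simp
      also have "\<dots> \<le> Liminf at_top (?p v)" by (intro Liminf_mono always_eventually allI qp)
      finally have "2 * pi * (hdot_half_norm f)\<^sup>2 \<le> 0" using 0 by (simp add: ennreal_eq_0_iff)
      then show "hdot_half_norm f = 0"
        by (metis mult_pos_pos not_le pi_gt_zero zero_less_numeral zero_less_power2)
    qed
    ultimately show ?thesis by blast
  qed
  then show ?thesis using v0 by blast
qed

end
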